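(* Let $M$ be a non-orientable surface equipped with a complete euclidean or hyperbolic structure, and let $\gamma_0:S^1\to M$ be an orientation preserving, non-null-homotopic, non-reversible closed curve on $M$. Fix a cover $\widetilde\gamma_0:\mathbb R\to\widetilde M$ of $\gamma_0$. If $\gamma:S^1\to M$ is a generic regular closed curve homotopic to $\gamma_0$, then $$W_{\widetilde\gamma_0|[0,1]}(\gamma)=I_{\widetilde\gamma_0}(\gamma)\in\mathbb Z,$$ where $\widetilde\gamma_0|[0,1]:[0,1]\to\widetilde M$ denotes the restriction of $\widetilde\gamma_0$ to $[0,1]$, and the winding number $W_{\widetilde\gamma_0|[0,1]}(\gamma)$ and the integer $I_{\widetilde\gamma_0}(\gamma)$ are as defined in the context.
   Context: A regular closed curve is a $C^1$ immersion $\gamma:S^1\to M$; it is generic if all its self-intersection points are transversal double points. "Homotopic" means freely homotopic. Let $w:\pi_1(M)\to\{\pm1\}$ be the orientation homomorphism; a closed curve $\gamma$ is orientation preserving if $w([\gamma])=+1$. A loop $\gamma$ based at $p$ is reversible if there is an element $h$ of the centralizer of $[\gamma]$ in $\pi_1(M,p)$ with $w(h)=-1$, and non-reversible otherwise. Let $p_M:\widetilde M\to M$ be the universal covering, where $\widetilde M$ is the euclidean plane $\mathbb E^2$ or the hyperbolic plane $\mathbb H^2$ with its standard orientation, and let $p_{S^1}:\mathbb R\to S^1$, $p_{S^1}(t)=(\cos 2\pi t,\sin 2\pi t)$. A cover of a closed curve $\gamma$ is a lift $\widetilde\gamma:\mathbb R\to\widetilde M$ of $\gamma\circ p_{S^1}$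 to $\widetilde M$. A free homotopy from $\gamma_0$ to $\gamma$, composed with $p_{S^1}$, lifts uniquely to a homotopy of maps $\mathbb R\to\widetilde M$ starting at $\widetilde\gamma_0$ and ending at a cover $\widetilde\gamma$ of $\gamma$; fix such a $\widetilde\gamma$. Let $T_0$ be the deck transformation with $T_0\circ\widetilde\gamma(t)=\widetilde\gamma(t+1)$. Definition of $I_{\widetilde\gamma_0}(\gamma)$. At each double point $d$ of $\gamma$ the curve splits into two loops based at $d$; $D_\pm(\gamma)$ is the set of those $d$ for which one of these loops is null-homotopic, equivalently for which every cover of $\gamma$ has a double point $\widetilde d$ with $p_M(\widetilde d)=d$. For a double point $\widetilde d=\widetilde\gamma(t_1)=\widetilde\gamma(t_2)$, $t_1<t_2$, of $\widetilde\gamma$, and small $\delta>0$, $\operatorname{sgn}(\widetilde\gamma,\widetilde d)=+1$ (resp. $-1$) if the arc $\widetilde\gamma((t_2-\delta,t_2+\delta))$ crosses the arc $\widetilde\gamma((t_1-\delta,t_1+\delta))$ from left to right (resp. from right to left). Set $$I_{\widetilde\gamma_0}(\gamma)=i_{\widetilde\gamma}(\gamma)=\sum_{d\in D_\pm(\gamma)}\operatorname{sgn}(\widetilde\gamma,\widetilde d)\in\mathbb Z,$$ where for each $d$ a double point $\widetilde d$ of $\widetilde\gamma$ over $d$ is chosen. The value does not depend on these choices nor on the homotopy used to obtain $\widetilde\gamma$; double points of $\gamma$ outside $D_\pm(\gamma)$ contribute $0$. Definition of $W_{\widetilde\gamma_0|[0,1]}(\gamma)$. $T_0$ is a nontrivial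 orientation-preserving fixed-point-free isometry of $\widetilde M$: a translation of $\mathbb E^2$, or a hyperbolic or parabolic isometry of $\mathbb H^2$. Let $(\varphi_s)_{s\in\mathbb R}$ be the one-parameter group of isometries (of translations, in the euclidean case) with $\varphi_1=T_0$, and let $X$ be the nowhere vanishing, $T_0$-invariant vector field on $\widetilde M$ generating it. Let $\theta:\mathbb R\to\mathbb R$ be a continuous choice of the oriented (counterclockwise positive) angle from $X(\widetilde\gamma(t))$ to $\widetilde\gamma'(t)$. Then $W_{\widetilde\gamma_0|[0,1]}(\gamma)=\frac{1}{2\pi}(\theta(1)-\theta(0))\in\mathbb Z$, which does not depend on the homotopy used to obtain $\widetilde\gamma$. *)

theory Defs
  imports "HOL-Analysis.Analysis"
begin

section \<open>The two model planes\<close>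

text \<open>
  Both planes are open subsets of the complex numbers: the euclidean plane is the whole plane, the
  hyperbolic plane is the upper half-plane. The half-plane model is conformal, so oriented angles,
  transversality and the orientation are in both cases those of the complex plane.
\<close>

datatype geometry = Euclidean | Hyperbolic

fun plane :: "geometry \<Rightarrow> complex set" where
  "plane Euclidean = UNIV"
| "plane Hyperbolic = {z. 0 < Im z}"

fun plane_dist :: "geometry \<Rightarrow> complex \<Rightarrow> complex \<Rightarrow> real" where
  "plane_dist Euclidean z w = dist z w"
| "plane_dist Hyperbolic z w = arcosh (1 + (dist z w)\<^sup>2 / (2 * Im z * Im w))"

definition plane_isometry :: "geometry \<Rightarrow> (complex \<Rightarrow> complex) \<Rightarrow> bool" where
  "plane_isometry g f \<longleftrightarrow> f ` plane g = plane g \<and>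
     (\<forall>z\<in>plane g. \<forall>w\<in>plane g. plane_dist g (f z) (f w) = plane_dist g z w)"

text \<open>\<open>Im (cnj a * b)\<close> is the determinant of the real 2 by 2 matrix with columns \<open>a\<close>, \<open>b\<close>.\<close>

definition cdet :: "complex \<Rightarrow> complex \<Rightarrow> real" where
  "cdet a b = Im (cnj a * b)"

definition orientation_preserving_map :: "geometry \<Rightarrow> (complex \<Rightarrow> complex) \<Rightarrow> bool" where
  "orientation_preserving_map g f \<longleftrightarrow>
     (\<forall>z\<in>plane g. \<exists>D. (f has_derivative D) (at z) \<and> 0 < cdet (D 1) (D \<i>))"


section \<open>Complete euclidean and hyperbolic surfaces\<close>

text \<open>
  The surface \<open>M\<close> is a complete metric space and \<open>p\<close> is its universal covering by the model plane;
  the geometric structure is expressed by \<open>p\<close> being a local isometry.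
\<close>

definition complete_geometric_surface ::
  "geometry \<Rightarrow> (complex \<Rightarrow> 'm::metric_space) \<Rightarrow> 'm set \<Rightarrow> bool" where
  "complete_geometric_surface g p M \<longleftrightarrow>
     complete M \<and> covering_space (plane g) p M \<and>
     (\<forall>z\<in>plane g. \<exists>r>0. \<forall>a\<in>plane g. \<forall>b\<in>plane g.
        plane_dist g z a < r \<longrightarrow> plane_dist g z b < r \<longrightarrow> dist (p a) (p b) = plane_dist g a b)"

definition deck_transformation ::
  "geometry \<Rightarrow> (complex \<Rightarrow> 'm::metric_space) \<Rightarrow> (complex \<Rightarrow> complex) \<Rightarrow> bool" where
  "deck_transformation g p f \<longleftrightarrow>
     (\<exists>f'. homeomorphism (plane g) (plane g) f f') \<and> (\<forall>z\<in>plane g. p (f z) = p z)"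

definition loop_in :: "'m::metric_space set \<Rightarrow> (real \<Rightarrow> 'm) \<Rightarrow> bool" where
  "loop_in M c \<longleftrightarrow> path c \<and> path_image c \<subseteq> M \<and> pathfinish c = pathstart c"

text \<open>
  The orientation homomorphism \<open>w\<close> on a loop \<open>c\<close>. Transporting the local orientation along \<open>c\<close>
  amounts to following a lift \<open>h\<close> of \<open>c\<close> in the oriented plane; it comes back unchanged iff the deck
  transformation taking the initial point of \<open>h\<close> to its end point preserves the orientation.
\<close>

definition orientation_hom ::
  "geometry \<Rightarrow> (complex \<Rightarrow> 'm::metric_space) \<Rightarrow> (real \<Rightarrow> 'm) \<Rightarrow> int" where
  "orientation_hom g p c =
     (if \<forall>h f. path h \<and> path_image h \<subseteq> plane g \<and> (\<forall>t\<in>{0..1}. p (h t) = c t) \<and>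
              deck_transformation g p f \<and> f (pathstart h) = pathfinish h
            \<longrightarrow> orientation_preserving_map g f
      then 1 else - 1)"

definition non_orientable ::
  "geometry \<Rightarrow> (complex \<Rightarrow> 'm::metric_space) \<Rightarrow> 'm set \<Rightarrow> bool" where
  "non_orientable g p M \<longleftrightarrow> (\<exists>c. loop_in M c \<and> orientation_hom g p c = - 1)"


section \<open>Closed curves and their covers\<close>

text \<open>The circle is the unit circle in the complex plane.\<close>

definition p_S1 :: "real \<Rightarrow> complex" where
  "p_S1 t = cis (2 * pi * t)"

definition closed_curve :: "'m::metric_space set \<Rightarrow> (complex \<Rightarrow> 'm) \<Rightarrow> bool" where
  "closed_curve M \<gamma> \<longleftrightarrow> continuous_on (sphere 0 1) \<gamma> \<and> \<gamma> ` sphere 0 1 \<subseteq> M"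

definition freely_homotopic ::
  "'m::metric_space set \<Rightarrow> (complex \<Rightarrow> 'm) \<Rightarrow> (complex \<Rightarrow> 'm) \<Rightarrow> bool" where
  "freely_homotopic M \<gamma> \<delta> \<longleftrightarrow> homotopic_with_canon (\<lambda>_. True) (sphere 0 1) M \<gamma> \<delta>"

definition null_homotopic :: "'m::metric_space set \<Rightarrow> (complex \<Rightarrow> 'm) \<Rightarrow> bool" where
  "null_homotopic M \<gamma> \<longleftrightarrow> (\<exists>a\<in>M. freely_homotopic M \<gamma> (\<lambda>_. a))"

definition orientation_preserving_curve ::
  "geometry \<Rightarrow> (complex \<Rightarrow> 'm::metric_space) \<Rightarrow> (complex \<Rightarrow> 'm) \<Rightarrow> bool" where
  "orientation_preserving_curve g p \<gamma> \<longleftrightarrow> orientation_hom g p (\<gamma> \<circ> p_S1) = 1"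

text \<open>
  The loop \<open>c\<close> represents the element \<open>h\<close> of the fundamental group at \<open>\<gamma> 1\<close>; it lies in the
  centralizer of the class of \<open>\<gamma>\<close> iff the two concatenations are homotopic relative to end points.
\<close>

definition reversible ::
  "geometry \<Rightarrow> (complex \<Rightarrow> 'm::metric_space) \<Rightarrow> 'm set \<Rightarrow> (complex \<Rightarrow> 'm) \<Rightarrow> bool" where
  "reversible g p M \<gamma> \<longleftrightarrow>
     (\<exists>c. loop_in M c \<and> pathstart c = \<gamma> 1 \<and>
          homotopic_paths M (c +++ (\<gamma> \<circ> p_S1)) ((\<gamma> \<circ> p_S1) +++ c) \<and>
          orientation_hom g p c = - 1)"

definition cover_of ::
  "geometry \<Rightarrow> (complex \<Rightarrow> 'm::metric_space) \<Rightarrow> (complex \<Rightarrow> 'm) \<Rightarrow> (real \<Rightarrow> complex) \<Rightarrow> bool" where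
  "cover_of g p \<gamma> \<gamma>t \<longleftrightarrow>
     continuous_on UNIV \<gamma>t \<and> range \<gamma>t \<subseteq> plane g \<and> (\<forall>t. p (\<gamma>t t) = \<gamma> (p_S1 t))"

text \<open>
  The smooth structure of \<open>M\<close> is the one for which \<open>p\<close> is a local diffeomorphism, so \<open>\<gamma>\<close> is a
  \<open>C\<^sup>1\<close> immersion iff its covers are (any two of them differ by a deck transformation).
\<close>

definition regular_closed_curve ::
  "geometry \<Rightarrow> (complex \<Rightarrow> 'm::metric_space) \<Rightarrow> 'm set \<Rightarrow> (complex \<Rightarrow> 'm) \<Rightarrow> bool" where
  "regular_closed_curve g p M \<gamma> \<longleftrightarrow> closed_curve M \<gamma> \<and>
     (\<forall>\<gamma>t. cover_of g p \<gamma> \<gamma>t \<longrightarrow>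
        \<gamma>t C1_differentiable_on UNIV \<and> (\<forall>t. vector_derivative \<gamma>t (at t) \<noteq> 0))"

text \<open>
  No point of \<open>M\<close> is passed more than twice, and when \<open>\<gamma>\<close> passes a point at two different
  parameters, the two branches are transversal there. To compare their tangents, the branches are
  lifted to covers \<open>\<alpha>\<close>, \<open>\<beta>\<close> through a common point of the plane.
\<close>

definition generic_regular_closed_curve ::
  "geometry \<Rightarrow> (complex \<Rightarrow> 'm::metric_space) \<Rightarrow> 'm set \<Rightarrow> (complex \<Rightarrow> 'm) \<Rightarrow> bool" where
  "generic_regular_closed_curve g p M \<gamma> \<longleftrightarrow> regular_closed_curve g p M \<gamma> \<and>
     (\<forall>d. finite {u \<in> sphere 0 1. \<gamma> u = d} \<and> card {u \<in> sphere 0 1. \<gamma> u = d} \<le> 2) \<and>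
     (\<forall>\<alpha> \<beta> s t. cover_of g p \<gamma> \<alpha> \<and> cover_of g p \<gamma> \<beta> \<and> \<alpha> s = \<beta> t \<and> p_S1 s \<noteq> p_S1 t \<longrightarrow>
        cdet (vector_derivative \<alpha> (at s)) (vector_derivative \<beta> (at t)) \<noteq> 0)"

text \<open>
  \<open>\<gamma>t\<close> is the end of the lift \<open>K\<close>, starting at \<open>\<gamma>t0\<close>, of a free homotopy \<open>H\<close> from \<open>\<gamma>0\<close> to \<open>\<gamma>\<close>.
\<close>

definition transported_cover ::
  "geometry \<Rightarrow> (complex \<Rightarrow> 'm::metric_space) \<Rightarrow> 'm set \<Rightarrow> (complex \<Rightarrow> 'm) \<Rightarrow> (real \<Rightarrow> complex) \<Rightarrow>
   (complex \<Rightarrow> 'm) \<Rightarrow> (real \<Rightarrow> complex) \<Rightarrow> bool" where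
  "transported_cover g p M \<gamma>0 \<gamma>t0 \<gamma> \<gamma>t \<longleftrightarrow>
     (\<exists>(H :: real \<times> complex \<Rightarrow> 'm) (K :: real \<times> real \<Rightarrow> complex).
        continuous_on ({0..1} \<times> sphere 0 1) H \<and> H ` ({0..1} \<times> sphere 0 1) \<subseteq> M \<and>
        (\<forall>u\<in>sphere 0 1. H (0, u) = \<gamma>0 u \<and> H (1, u) = \<gamma> u) \<and>
        continuous_on ({0..1} \<times> UNIV) K \<and> K ` ({0..1} \<times> UNIV) \<subseteq> plane g \<and>
        (\<forall>s\<in>{0..1}. \<forall>t. p (K (s, t)) = H (s, p_S1 t)) \<and>
        (\<forall>t. K (0, t) = \<gamma>t0 t \<and> K (1, t) = \<gamma>t t))"


section \<open>The signed number of double points\<close>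

text \<open>
  Double points at which one of the two loops is null-homotopic. Since \<open>a\<close> and \<open>b\<close> are arbitrary
  reals, the pairs \<open>(a, b)\<close> and \<open>(b, a + 1)\<close> give both loops at \<open>d\<close>.
\<close>

definition D_pm :: "'m::metric_space set \<Rightarrow> (complex \<Rightarrow> 'm) \<Rightarrow> 'm set" where
  "D_pm M \<gamma> = {d. \<exists>a b. a < b \<and> b < a + 1 \<and> \<gamma> (p_S1 a) = d \<and> \<gamma> (p_S1 b) = d \<and>
     homotopic_paths M (\<lambda>x. \<gamma> (p_S1 (a + (b - a) * x))) (\<lambda>_. d)}"

text \<open>
  The arc at \<open>t2\<close> crosses the arc at \<open>t1\<close> from left to right iff its tangent points to the right of
  the tangent at \<open>t1\<close>, i.e. iff the determinant is negative.
\<close>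

definition crossing_sgn :: "(real \<Rightarrow> complex) \<Rightarrow> real \<Rightarrow> real \<Rightarrow> int" where
  "crossing_sgn \<gamma>t t1 t2 =
     (let \<Delta> = cdet (vector_derivative \<gamma>t (at t1)) (vector_derivative \<gamma>t (at t2))
      in if \<Delta> < 0 then 1 else if \<Delta> > 0 then - 1 else 0)"

text \<open>
  \<open>t1\<close> and \<open>t2\<close> choose for each \<open>d\<close> a double point \<open>\<gamma>t (t1 d) = \<gamma>t (t2 d)\<close> of \<open>\<gamma>t\<close> over \<open>d\<close>.
  For \<open>\<gamma>0\<close> and \<open>\<gamma>\<close> as in the theorem the sum does not depend on these choices nor on \<open>\<gamma>t\<close>.
\<close>

definition I_number ::
  "geometry \<Rightarrow> (complex \<Rightarrow> 'm::metric_space) \<Rightarrow> 'm set \<Rightarrow> (complex \<Rightarrow> 'm) \<Rightarrow> (real \<Rightarrow> complex) \<Rightarrow>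
   (complex \<Rightarrow> 'm) \<Rightarrow> int" where
  "I_number g p M \<gamma>0 \<gamma>t0 \<gamma> =
     (THE n. \<exists>\<gamma>t t1 t2. transported_cover g p M \<gamma>0 \<gamma>t0 \<gamma> \<gamma>t \<and>
        (\<forall>d\<in>D_pm M \<gamma>. t1 d < t2 d \<and> \<gamma>t (t1 d) = \<gamma>t (t2 d) \<and> p (\<gamma>t (t1 d)) = d) \<and>
        n = (\<Sum>d\<in>D_pm M \<gamma>. crossing_sgn \<gamma>t (t1 d) (t2 d)))"


section \<open>The winding number\<close>

definition isometry_flow ::
  "geometry \<Rightarrow> (complex \<Rightarrow> complex) \<Rightarrow> (real \<Rightarrow> complex \<Rightarrow> complex) \<Rightarrow> (complex \<Rightarrow> complex) \<Rightarrow> bool"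
  where
  "isometry_flow g T \<phi> X \<longleftrightarrow>
     (\<forall>s. plane_isometry g (\<phi> s)) \<and>
     (\<forall>s t. \<forall>z\<in>plane g. \<phi> (s + t) z = \<phi> s (\<phi> t z)) \<and>
     (g = Euclidean \<longrightarrow> (\<forall>s. \<exists>v. \<forall>z. \<phi> s z = z + v)) \<and>
     (\<forall>z\<in>plane g. \<phi> 1 z = T z) \<and>
     (\<forall>z\<in>plane g. ((\<lambda>s. \<phi> s z) has_vector_derivative X z) (at 0))"

text \<open>
  \<open>T\<close> is \<open>T\<^sub>0\<close>, and \<open>\<theta> t\<close> is the angle from \<open>X (\<gamma>t t)\<close> to the tangent of \<open>\<gamma>t\<close> at \<open>t\<close>. The value does
  not depend on any of the choices.
\<close>

definition W_number ::
  "geometry \<Rightarrow> (complex \<Rightarrow> 'm::metric_space) \<Rightarrow> 'm set \<Rightarrow> (complex \<Rightarrow> 'm) \<Rightarrow> (real \<Rightarrow> complex) \<Rightarrow>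
   (complex \<Rightarrow> 'm) \<Rightarrow> real" where
  "W_number g p M \<gamma>0 \<gamma>t0 \<gamma> =
     (THE x. \<exists>\<gamma>t T \<phi> X \<theta>. transported_cover g p M \<gamma>0 \<gamma>t0 \<gamma> \<gamma>t \<and>
        deck_transformation g p T \<and> (\<forall>t. T (\<gamma>t t) = \<gamma>t (t + 1)) \<and>
        isometry_flow g T \<phi> X \<and>
        continuous_on UNIV \<theta> \<and>
        (\<forall>t. \<exists>r>0. vector_derivative \<gamma>t (at t) = of_real r * cis (\<theta> t) * X (\<gamma>t t)) \<and>
        x = (\<theta> 1 - \<theta> 0) / (2 * pi))"

end

theory Submission
  imports Defs "HOL-Complex_Analysis.Complex_Analysis"
begin

text \<open>
  Let \<open>T0\<close> be the deck transformation that translates the transported cover \<open>\<gamma>t\<close> by one period. It is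
  a fixed-point-free holomorphic automorphism of the plane, and there is an injective holomorphic
  coordinate \<open>\<Phi>\<close> (up to a Moebius map the identity or a logarithm) in which \<open>T0\<close> is the translation
  by some \<open>c \<noteq> 0\<close> and the field \<open>X\<close> is the constant \<open>c\<close>. The curve \<open>b = \<Phi> \<circ> \<gamma>t\<close> satisfies
  \<open>b (t + 1) = b t + c\<close>, and \<open>W\<close> is the number of turns of its tangent over a period. As in
  Whitney's formula, consider the secant \<open>(b (s + h) - b s) / h\<close> on the annulus \<open>s\<close> modulo \<open>1\<close>,
  \<open>0 \<le> h \<le> 1\<close>: it winds \<open>W\<close> times around \<open>0\<close> along \<open>h = 0\<close>, where it is the tangent, and is the
  constant \<open>c\<close> along \<open>h = 1\<close>, so \<open>W\<close> is its signed number of zeros. These are the double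
  points of \<open>\<gamma>t\<close> whose parameters differ by less than \<open>1\<close>, which correspond to \<open>D_pm M \<gamma>\<close>. Double
  points of \<open>\<gamma>t\<close> with parameters further apart lie over points outside \<open>D_pm M \<gamma>\<close>.
  Two transported covers differ by a deck transformation commuting with \<open>T0\<close>; as \<open>\<gamma>0\<close> is not
  reversible, it preserves the orientation and hence the signs.
\<close>


section \<open>An argument principle on the annulus\<close>

text \<open>Two obstacles shape the proof. The secant of a \<open>C1\<close> curve is only
  continuous up to \<open>h = 0\<close>, so its zeros are counted by a topological argument
  principle: a zero is described by where a quotient stays, and zeros are divided out one at a time.
  Moreover, the deck transformations and the flow are given through metric properties only. A deck
  transformation is compatible with the local isometry \<open>p\<close>, so its differential is a
  similarity; preserving the orientation then makes it holomorphic, and Liouville's theorem or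
  Schwarz's lemma identifies it. The field \<open>X\<close> may come from any one-parameter group of
  isometries through \<open>T0\<close>, so the winding number makes sense only because this field is
  unique; uniqueness is read off the invariance of distances, differentiated at time 0. Both numbers
  are definite descriptions, hence existence and uniqueness of the described values have to be
  shown. That the crossing sum does not depend on the chosen double points falls out of the winding
  formula itself.\<close>

lemma exp_eq_imp_diff_eq:
  fixes f h :: "'a::topological_space \<Rightarrow> complex"
  assumes "connected A" "continuous_on A f" "continuous_on A h"
    and eq: "\<And>x. x \<in> A \<Longrightarrow> exp (f x) = exp (h x)" and "x \<in> A" "y \<in> A"
  shows "f x - f y = h x - h y"
proof -
  have "(\<lambda>x. f x - h x) constant_on A"
  proof (rule continuous_discrete_range_constant[OF \<open>connected A\<close>])
    show "continuous_on A (\<lambda>x. f x - h x)" by (intro continuous_intros assms)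
    fix x assume x: "x \<in> A"
    have mult: "\<exists>n::int. f z - h z = of_int (2 * n) * pi * \<i>" if "z \<in> A" for z
      using eq[OF that] by (auto simp: exp_eq algebra_simps)
    \<comment> \<open>Logarithms of the same value differ by multiples of
      \<open>2 * pi * \<i>\<close>, and distinct multiples are at least \<open>2 * pi\<close> apart.
      The difference thus has discrete range, which forces it to be constant on a connected
      set.\<close>
    show "\<exists>e>0. \<forall>y. y \<in> A \<and> f y - h y \<noteq> f x - h x \<longrightarrow> e \<le> cmod (f y - h y - (f x - h x))"
    proof (intro exI[of _ "2*pi"] conjI allI impI)
      fix y assume y: "y \<in> A \<and> f y - h y \<noteq> f x - h x"
      obtain m where m: "f x - h x = of_int (2 * m) * pi * \<i>" using mult[OF x] by blast
      obtain n where n: "f y - h y = of_int (2 * n) * pi * \<i>" using mult y by blast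
      have "n \<noteq> m" using y m n by auto
      then have "1 \<le> \<bar>real_of_int (n - m)\<bar>" by linarith
      moreover have "f y - h y - (f x - h x) = of_real (2 * pi * of_int (n - m)) * \<i>"
        unfolding m n by (simp add: algebra_simps)
      then have "cmod (f y - h y - (f x - h x)) = 2 * pi * \<bar>real_of_int (n - m)\<bar>"
        by (simp add: norm_mult abs_mult del: of_int_diff)
      ultimately show "2 * pi \<le> cmod (f y - h y - (f x - h x))"
        by (simp add: mult_le_cancel_left1)
    qed simp
  qed
  then obtain k where "\<And>x. x \<in> A \<Longrightarrow> f x - h x = k" unfolding constant_on_def by auto
  from this[OF \<open>x \<in> A\<close>] this[OF \<open>y \<in> A\<close>] show ?thesis by (simp add: algebra_simps)
qed

text \<open>A zero of index -1 looks like a zero of index 1 in the conjugate variable; the flag lets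
  one proof treat both signs.\<close>

definition orient :: "bool \<Rightarrow> complex \<Rightarrow> complex" where
  "orient s z = (if s then z else cnj z)"

definition orient_sgn :: "bool \<Rightarrow> int" where
  "orient_sgn s = (if s then 1 else - 1)"

lemma orient_simps [simp]:
  "orient s (x * y) = orient s x * orient s y" "orient s (x + y) = orient s x + orient s y"
  "orient s (x - y) = orient s x - orient s y" "orient s (- x) = - orient s x"
  "orient s (x / y) = orient s x / orient s y" "orient s (exp x) = exp (orient s x)"
  "orient s 1 = 1" "orient s 0 = 0" "norm (orient s x) = norm x" "orient s (of_real r) = of_real r"
  "orient s x = 0 \<longleftrightarrow> x = 0"
  by (auto simp: orient_def exp_cnj)

lemma continuous_on_orient [continuous_intros]:
  "continuous_on A f \<Longrightarrow> continuous_on A (\<lambda>x. orient s (f x))"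
  by (cases s) (auto simp: orient_def intro!: continuous_intros)

text \<open>The quotient need not converge, so the condition is stable under continuous nonzero factors,
  and a nondegenerate zero of a merely differentiable map satisfies it.\<close>

definition indexed_zero :: "(complex \<Rightarrow> complex) \<Rightarrow> complex \<Rightarrow> bool \<Rightarrow> bool" where
  "indexed_zero F z s \<longleftrightarrow> (\<exists>\<alpha> \<kappa>. \<alpha> \<noteq> 0 \<and> 0 \<le> \<kappa> \<and> \<kappa> < 1 \<and>
     (\<forall>\<^sub>F w in at z. norm (F w / orient s (w - z) - \<alpha>) \<le> \<kappa> * norm \<alpha>))"

lemma indexed_zero_mult:
  assumes "indexed_zero F z s" and m: "isCont m z" "m z \<noteq> 0"
    and eq: "\<forall>\<^sub>F w in at z. G w = m w * F w"
  shows "indexed_zero G z s"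
proof -
  obtain \<alpha> \<kappa> where a: "\<alpha> \<noteq> 0" "0 \<le> \<kappa>" "\<kappa> < 1"
    and ev: "\<forall>\<^sub>F w in at z. norm (F w / orient s (w - z) - \<alpha>) \<le> \<kappa> * norm \<alpha>"
    using assms(1) unfolding indexed_zero_def by auto
  \<comment> \<open>Any constant strictly between \<kappa> and 1 would do: the gap absorbs the
    oscillation of \<open>m\<close> near \<open>z\<close>.\<close>
  define \<kappa>' where "\<kappa>' = (1 + \<kappa>) / 2"
  have k': "\<kappa> < \<kappa>'" "\<kappa>' < 1" using a by (auto simp: \<kappa>'_def)
  have lim: "((\<lambda>w. norm (m w) * (\<kappa> * norm \<alpha>) + norm (m w - m z) * norm \<alpha>) \<longlongrightarrow>
     norm (m z) * (\<kappa> * norm \<alpha>) + norm (m z - m z) * norm \<alpha>) (at z)"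
    using m(1) unfolding isCont_def by (intro tendsto_intros)
  have "norm (m z) * (\<kappa> * norm \<alpha>) + norm (m z - m z) * norm \<alpha> < \<kappa>' * norm (m z * \<alpha>)"
    using a m k' by (simp add: norm_mult mult.commute)
  from order_tendstoD(2)[OF lim this]
  have ev2: "\<forall>\<^sub>F w in at z. norm (m w) * (\<kappa> * norm \<alpha>) + norm (m w - m z) * norm \<alpha> < \<kappa>' * norm (m z * \<alpha>)" .
  have "\<forall>\<^sub>F w in at z. norm (G w / orient s (w - z) - m z * \<alpha>) \<le> \<kappa>' * norm (m z * \<alpha>)"
    using ev ev2 eq
  proof eventually_elim
    case (elim w)
    have "G w / orient s (w - z) - m z * \<alpha>
        = m w * (F w / orient s (w - z) - \<alpha>) + (m w - m z) * \<alpha>"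
      unfolding elim(3) by (simp add: algebra_simps)
    also have "norm \<dots> \<le> norm (m w) * norm (F w / orient s (w - z) - \<alpha>) + norm (m w - m z) * norm \<alpha>"
      by (metis norm_mult norm_triangle_ineq)
    also have "\<dots> \<le> norm (m w) * (\<kappa> * norm \<alpha>) + norm (m w - m z) * norm \<alpha>"
      by (intro add_right_mono mult_left_mono elim) auto
    finally show ?case using elim(2) by linarith
  qed
  then show ?thesis unfolding indexed_zero_def
    using a m k' by (intro exI[of _ "m z * \<alpha>"] exI[of _ \<kappa>']) auto
qed

lemma indexed_zero_isolated:
  assumes "indexed_zero F z s" shows "\<forall>\<^sub>F w in at z. F w \<noteq> 0"
proof -
  obtain \<alpha> \<kappa> where a: "\<alpha> \<noteq> 0" "0 \<le> \<kappa>" "\<kappa> < 1"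
    and ev: "\<forall>\<^sub>F w in at z. norm (F w / orient s (w - z) - \<alpha>) \<le> \<kappa> * norm \<alpha>"
    using assms(1) unfolding indexed_zero_def by auto
  from ev show ?thesis
  proof eventually_elim
    case (elim w)
    show ?case
    proof
      assume "F w = 0"
      then have "norm \<alpha> \<le> \<kappa> * norm \<alpha>" using elim by simp
      then show False using a by simp
    qed
  qed
qed

section \<open>A periodic function with a single simple zero per period\<close>

abbreviation "period_strip \<equiv> {z::complex. 0 \<le> Im z \<and> Im z \<le> 1}"

text \<open>The periodic substitute for \<open>w - a\<close>: up to a constant factor it is the
  difference of the values at \<open>w\<close> and \<open>a\<close> of the coordinate
  \<open>exp (2 * pi * \<i> * w)\<close> of the annulus.\<close>

definition efac :: "complex \<Rightarrow> complex \<Rightarrow> complex" where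
  "efac a w = exp (2 * pi * \<i> * (w - a)) - 1"

lemma efac_period: "efac a (w + of_int k) = efac a w"
proof -
  have "exp (2 * pi * \<i> * (w + of_int k - a)) = exp (2 * pi * \<i> * (w - a) + of_int (2 * k) * pi * \<i>)"
    by (rule arg_cong[where f = exp]) (simp add: algebra_simps)
  also have "\<dots> = exp (2 * pi * \<i> * (w - a))" by (subst exp_eq) auto
  finally show ?thesis by (simp add: efac_def)
qed

lemma efac_eq_0: "efac a w = 0 \<longleftrightarrow> (\<exists>k::int. w = a + of_int k)"
proof -
  have "efac a w = 0 \<longleftrightarrow> exp (2 * pi * \<i> * (w - a)) = 1" by (simp add: efac_def)
  also have "\<dots> \<longleftrightarrow> (\<exists>k::int. w = a + of_int k)" (is "_ = ?R")
  proof
    assume "exp (2 * pi * \<i> * (w - a)) = 1"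
    then obtain n :: int where n: "2 * pi * (Re w - Re a) = of_int (2 * n) * pi" "Im w = Im a"
      by (auto simp: exp_eq_1)
    have "Re w - Re a = n" using n(1) by simp
    then have "w = a + of_int n" using n(2) by (simp add: complex_eq_iff)
    then show ?R by blast
  next
    assume ?R then show "exp (2 * pi * \<i> * (w - a)) = 1"
      using efac_period[of a a] by (auto simp: efac_def)
  qed
  finally show ?thesis .
qed

lemma continuous_on_efac [continuous_intros]:
  "continuous_on A f \<Longrightarrow> continuous_on A (\<lambda>x. efac a (f x))"
  by (auto simp: efac_def intro!: continuous_intros)

text \<open>Near 1 the principal logarithm is a continuous inverse of \<open>exp\<close>; the branch
  that it selects supplies the integer shift.\<close>

lemma efac_small:
  assumes "\<epsilon> > 0"
  obtains r where "r > 0" "\<And>w. norm (efac a w) < r \<Longrightarrow> \<exists>k::int. dist (w + of_int k) a < \<epsilon>"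
proof -
  have "isCont Ln 1" by (intro continuous_at_Ln) auto
  then obtain r where r: "r > 0" "\<And>z. dist z 1 < r \<Longrightarrow> dist (Ln z) (Ln 1) < 2 * pi * \<epsilon>"
    unfolding continuous_at_eps_delta using assms by (metis mult_pos_pos pi_gt_zero zero_less_numeral)
  show ?thesis
  proof
    show "r > 0" by fact
    fix w assume "norm (efac a w) < r"
    then have d: "norm (Ln (exp (2 * pi * \<i> * (w - a)))) < 2 * pi * \<epsilon>"
      using r(2)[of "exp (2 * pi * \<i> * (w - a))"] by (simp add: efac_def dist_norm)
    have "exp (Ln (exp (2 * pi * \<i> * (w - a)))) = exp (2 * pi * \<i> * (w - a))" by simp
    then obtain k :: int where k: "Ln (exp (2 * pi * \<i> * (w - a))) = 2 * pi * \<i> * (w - a) + of_int (2 * k) * pi * \<i>"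
      unfolding exp_eq by auto
    have "Ln (exp (2 * pi * \<i> * (w - a))) = 2 * pi * \<i> * (w + of_int k - a)"
      unfolding k by (simp add: algebra_simps)
    then have "2 * pi * norm (w + of_int k - a) < 2 * pi * \<epsilon>"
      using d by (simp add: norm_mult)
    then show "\<exists>k::int. dist (w + of_int k) a < \<epsilon>" by (auto simp: dist_norm)
  qed
qed

lemma efac_quotient: "((\<lambda>w. (w - a) / efac a w) \<longlongrightarrow> 1 / (2 * pi * \<i>)) (at a)"
proof -
  have "(efac a has_field_derivative (2 * pi * \<i>)) (at a)"
    unfolding efac_def by (auto intro!: derivative_eq_intros)
  then have "((\<lambda>w. efac a w / (w - a)) \<longlongrightarrow> 2 * pi * \<i>) (at a)"
    using efac_period[of a a 0] by (simp add: has_field_derivative_iff efac_def)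
  then have "((\<lambda>w. inverse (efac a w / (w - a))) \<longlongrightarrow> inverse (2 * pi * \<i>)) (at a)"
    by (rule tendsto_inverse) auto
  then show ?thesis by (simp add: field_simps)
qed


lemma Re_one_minus_exp_pos:
  assumes "Re z < 0" shows "0 < Re (1 - exp z)"
proof -
  have "norm (exp z) < 1" using assms by simp
  then have "Re (exp z) < 1" using complex_Re_le_cmod[of "exp z"] by linarith
  then show ?thesis by simp
qed

text \<open>Below the zero the exponential has modulus greater than 1 and dominates. Factoring it
  out leaves \<open>1 - exp (...)\<close> in the right half-plane, where \<open>Ln\<close> is
  continuous and periodic in \<open>t\<close>, so the whole increment \<open>2 * pi * \<i>\<close>
  comes from the linear term.\<close>

lemma efac_log_bottom:
  assumes "0 < Im a"
  obtains L where "continuous_on UNIV L" "\<And>t::real. exp (L t) = efac a (of_real t)"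
    "L 1 - L 0 = 2 * pi * \<i>"
proof
  let ?L = "\<lambda>t::real. 2 * pi * \<i> * (t - a) + Ln (1 - exp (- (2 * pi * \<i> * (t - a))))"
  have pos: "0 < Re (1 - exp (- (2 * pi * \<i> * (t - a))))" for t :: real
    using assms by (intro Re_one_minus_exp_pos) simp
  show "continuous_on UNIV ?L"
    using pos by (intro continuous_intros) (metis complex_nonpos_Reals_iff not_less)
  fix t :: real
  have "1 - exp (- (2 * pi * \<i> * (t - a))) \<noteq> 0" using pos[of t] by auto
  then have "exp (?L t) = exp (2 * pi * \<i> * (t - a)) * (1 - exp (- (2 * pi * \<i> * (t - a))))"
    by (simp only: exp_add exp_Ln not_False_eq_True)
  also have "\<dots> = efac a (of_real t)"
    by (simp add: efac_def right_diff_distrib[of "exp _"] flip: exp_add)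
  finally show "exp (?L t) = efac a (of_real t)" .
next
  have "exp (- (2 * pi * \<i> * (of_real 1 - a))) = exp (- (2 * pi * \<i> * (of_real 0 - a)))"
    unfolding exp_eq by (rule exI[of _ "-1"]) (simp add: algebra_simps)
  then show "(2 * pi * \<i> * (of_real 1 - a) + Ln (1 - exp (- (2 * pi * \<i> * (of_real 1 - a)))))
    - (2 * pi * \<i> * (of_real 0 - a) + Ln (1 - exp (- (2 * pi * \<i> * (of_real 0 - a))))) = 2 * pi * \<i>"
    by (simp add: algebra_simps)
qed

text \<open>Above the zero the exponential has modulus less than 1, so \<open>-1\<close> dominates
  and nothing winds. The contrast with the bottom line is the contribution of one zero.\<close>

lemma efac_log_top:
  assumes "Im a < 1"
  obtains L where "continuous_on UNIV L" "\<And>t::real. exp (L t) = efac a (of_real t + \<i>)"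
    "L 1 - L 0 = 0"
proof
  let ?L = "\<lambda>t::real. pi * \<i> + Ln (1 - exp (2 * pi * \<i> * (t + \<i> - a)))"
  have pos: "0 < Re (1 - exp (2 * pi * \<i> * (t + \<i> - a)))" for t :: real
    using assms by (intro Re_one_minus_exp_pos) (simp add: algebra_simps)
  show "continuous_on UNIV ?L"
    using pos by (intro continuous_intros) (metis complex_nonpos_Reals_iff not_less)
  fix t :: real
  have "1 - exp (2 * pi * \<i> * (t + \<i> - a)) \<noteq> 0" using pos[of t] by auto
  then show "exp (?L t) = efac a (of_real t + \<i>)"
    by (simp add: exp_add efac_def)
next
  have "exp (2 * pi * \<i> * (of_real 1 + \<i> - a)) = exp (2 * pi * \<i> * (of_real 0 + \<i> - a))"
    unfolding exp_eq by (rule exI[of _ "1"]) (simp add: algebra_simps)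
  then show "(pi * \<i> + Ln (1 - exp (2 * pi * \<i> * (of_real 1 + \<i> - a))))
    - (pi * \<i> + Ln (1 - exp (2 * pi * \<i> * (of_real 0 + \<i> - a)))) = 0"
    by simp
qed

lemma efac_norm_bottom: "Im w = 0 \<Longrightarrow> exp (2 * pi * Im a) - 1 \<le> norm (efac a w)"
  using norm_triangle_ineq2[of "exp (2 * pi * \<i> * (w - a))" 1]
  by (simp add: efac_def)

lemma efac_norm_top: "Im w = 1 \<Longrightarrow> 1 - exp (2 * pi * (Im a - 1)) \<le> norm (efac a w)"
  using norm_triangle_ineq2[of 1 "exp (2 * pi * \<i> * (w - a))"]
  by (simp add: efac_def norm_minus_commute right_diff_distrib)

lemma add_of_int_period:
  fixes f :: "'b::ring_1 \<Rightarrow> 'a"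
  assumes "\<And>w. f (w + 1) = f w"
  shows "f (w + of_int k) = f w"
proof (induction k rule: int_induct[where k = 0])
  case (step1 i)
  then show ?case using assms[of "w + of_int i"] by (simp add: add.assoc)
next
  case (step2 i)
  then show ?case using assms[of "w + of_int (i - 1)"] by (simp add: add.assoc)
qed simp

text \<open>Near \<open>a\<close> the quotient of \<open>F\<close> by the periodic factor need not
  converge, but it stays in a disc around some \<alpha> that misses 0. Blending it with the constant
  \<alpha> by a cutoff keeps it in this disc, which is convex, so the result \<open>G\<close> is
  continuous and nonzero there. The cutoff region avoids both boundary lines, where \<open>G\<close>
  is exactly the quotient.\<close>

lemma divide_out_zero:
  fixes F :: "complex \<Rightarrow> complex"
  assumes contF: "continuous_on period_strip F" and per: "\<And>w. F (w + 1) = F w"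
    and a: "0 < Im a" "Im a < 1" and iz: "indexed_zero F a s"
  obtains G r where "r > 0" "continuous_on period_strip G" "\<And>w. G (w + 1) = G w"
    "\<And>w. r \<le> norm (efac a w) \<Longrightarrow> G w = F w / orient s (efac a w)"
    "\<And>w. norm (efac a w) < 2 * r \<Longrightarrow> G w \<noteq> 0"
    "\<And>w. norm (efac a w) < 2 * r \<Longrightarrow> F w = 0 \<Longrightarrow> efac a w = 0"
    "\<And>w. Im w = 0 \<or> Im w = 1 \<Longrightarrow> r \<le> norm (efac a w)"
proof -
  let ?E = "efac a"
  \<comment> \<open>Passing from \<open>w - a\<close> to \<open>efac a w\<close> multiplies by their
    quotient, which extends continuously to \<open>a\<close> with the nonzero reciprocal of the
    derivative as its value.\<close>
  have "indexed_zero (\<lambda>w. F w / orient s (?E w) * orient s (w - a)) a s"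
  proof -
    define m where "m = (\<lambda>w. if w = a then 1 / orient s (2 * pi * \<i>) else orient s ((w - a) / ?E w))"
    have lim: "((\<lambda>w. orient s ((w - a) / ?E w)) \<longlongrightarrow> orient s (1 / (2 * pi * \<i>))) (at a)"
      using efac_quotient[of a] by (cases s) (auto simp: orient_def intro: tendsto_cnj simp del: complex_cnj_divide)
    have ev: "\<forall>\<^sub>F w in at a. m w = orient s ((w - a) / ?E w)"
      by (auto simp: m_def eventually_at_filter)
    have ma: "m a = orient s (1 / (2 * pi * \<i>))" by (simp add: m_def)
    have "isCont m a" unfolding isCont_def ma
      using Lim_transform_eventually[OF lim] ev by (simp add: eq_commute del: orient_simps)
    moreover have "m a \<noteq> 0" by (simp add: ma)
    moreover have "\<forall>\<^sub>F w in at a. F w / orient s (?E w) * orient s (w - a) = m w * F w"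
      using ev by eventually_elim simp
    ultimately show ?thesis by (rule indexed_zero_mult[OF iz])
  qed
  then obtain \<alpha> \<kappa> where ak: "\<alpha> \<noteq> 0" "0 \<le> \<kappa>" "\<kappa> < 1"
    and ev: "\<forall>\<^sub>F w in at a. norm (F w / orient s (?E w) * orient s (w - a) / orient s (w - a) - \<alpha>) \<le> \<kappa> * norm \<alpha>"
    unfolding indexed_zero_def by auto
  have "\<forall>\<^sub>F w in at a. norm (F w / orient s (?E w) - \<alpha>) \<le> \<kappa> * norm \<alpha>"
    using ev unfolding eventually_at_filter
    by (rule eventually_mono) (auto simp del: orient_simps(3) simp: orient_simps(3)[symmetric])
  then obtain \<epsilon> where eps: "\<epsilon> > 0"
    "\<And>w. w \<noteq> a \<Longrightarrow> dist w a < \<epsilon> \<Longrightarrow> norm (F w / orient s (?E w) - \<alpha>) \<le> \<kappa> * norm \<alpha>"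
    unfolding eventually_at by auto
  obtain r0 where r0: "r0 > 0" "\<And>w. norm (?E w) < r0 \<Longrightarrow> \<exists>k::int. dist (w + of_int k) a < \<epsilon>"
    using efac_small[OF eps(1)] by blast
  have near: "norm (F w / orient s (?E w) - \<alpha>) \<le> \<kappa> * norm \<alpha>"
    if w: "norm (?E w) < r0" "?E w \<noteq> 0" for w
  proof -
    obtain k :: int where k: "dist (w + of_int k) a < \<epsilon>" using r0(2)[OF w(1)] by blast
    have "w + of_int k \<noteq> a"
      using w(2) efac_period[of a w k] efac_eq_0[of a a] by (metis add.right_neutral of_int_0)
    from eps(2)[OF this k] show ?thesis
      by (simp add: efac_period add_of_int_period[of F, OF per])
  qed
  \<comment> \<open>Half of \<open>r0\<close> keeps the estimate valid on the doubled region
    \<open>2 * r\<close>, so that other zeros have a margin; the remaining two entries are lower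
    bounds of the periodic factor on the two boundary lines.\<close>
  define r where "r = Min {r0 / 2, exp (2 * pi * Im a) - 1, 1 - exp (2 * pi * (Im a - 1))}"
  have "exp (2 * pi * (Im a - 1)) < 1" using a by (simp add: mult_less_0_iff)
  then have r: "r > 0" "2 * r \<le> r0" "r \<le> exp (2 * pi * Im a) - 1" "r \<le> 1 - exp (2 * pi * (Im a - 1))"
    using r0(1) a by (auto simp: r_def min_def)
  define u where "u = (\<lambda>w. max 0 (1 - norm (?E w) / r))"
  have u01: "0 \<le> u w" "u w \<le> 1" for w using r by (auto simp: u_def)
  define G where "G = (\<lambda>w. of_real (u w) * \<alpha> + of_real (1 - u w) * (F w / orient s (?E w)))"
  have Gdiff: "G w - \<alpha> = of_real (1 - u w) * (F w / orient s (?E w) - \<alpha>)" for w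
    by (simp add: G_def algebra_simps)
  have G0: "G w = \<alpha>" if "?E w = 0" for w using that by (simp add: G_def u_def)
  have Gnear: "norm (G w - \<alpha>) \<le> (1 - u w) * (\<kappa> * norm \<alpha>)" if "norm (?E w) < r0" for w
  proof (cases "?E w = 0")
    case True then show ?thesis using u01[of w] ak by (simp add: G0)
  next
    case False
    then show ?thesis unfolding Gdiff norm_mult norm_of_real
      using near[OF that False] u01[of w] by (intro mult_mono) auto
  qed
  have contu: "continuous_on A u" for A unfolding u_def using r by (intro continuous_intros) auto
  show ?thesis
  proof
    show "r > 0" by fact
    show "continuous_on period_strip G"
    proof (unfold continuous_on_eq_continuous_within, intro ballI)
      fix w assume w: "w \<in> period_strip"
      show "continuous (at w within period_strip) G"
      proof (cases "?E w = 0")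
        case False
        have "continuous (at w within period_strip) F" "continuous (at w within period_strip) u"
          using w contF contu by (auto simp: continuous_on_eq_continuous_within)
        moreover have "continuous (at w within period_strip) (\<lambda>w. orient s (?E w))"
          using w continuous_on_orient[OF continuous_on_efac[OF continuous_on_id], of period_strip s a]
          by (auto simp: continuous_on_eq_continuous_within)
        ultimately show ?thesis unfolding G_def
          using False by (intro continuous_intros) auto
      next
        case True
        \<comment> \<open>The weight of the quotient tends to 0 at the zero while the quotient stays
          bounded; hence \<open>G\<close> is continuous although the quotient may have no
          limit.\<close>
        have "((\<lambda>w. (1 - u w) * (\<kappa> * norm \<alpha>)) \<longlongrightarrow> (1 - u w) * (\<kappa> * norm \<alpha>)) (at w within period_strip)"
          using w contu by (intro tendsto_intros) (auto simp: continuous_on)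
        then have lim: "((\<lambda>w. (1 - u w) * (\<kappa> * norm \<alpha>)) \<longlongrightarrow> 0) (at w within period_strip)"
          using True by (simp add: u_def)
        have "((\<lambda>w. norm (?E w)) \<longlongrightarrow> norm (?E w)) (at w within period_strip)"
          using continuous_on_efac[OF continuous_on_id, of period_strip a] w
          by (intro tendsto_norm) (auto simp: continuous_on)
        then have "\<forall>\<^sub>F w in at w within period_strip. norm (?E w) < r0"
          using r0 True by (intro order_tendstoD(2)) auto
        then have "\<forall>\<^sub>F w in at w within period_strip. norm (G w - \<alpha>) \<le> (1 - u w) * (\<kappa> * norm \<alpha>)"
          by eventually_elim (rule Gnear)
        from Lim_null_comparison[OF this lim]
        have "((\<lambda>w. G w - \<alpha>) \<longlongrightarrow> 0) (at w within period_strip)" .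
        then show ?thesis unfolding continuous_within G0[OF True] by (simp add: LIM_zero_iff)
      qed
    qed
    show "G (w + 1) = G w" for w
      using per[of w] efac_period[of a w 1] by (simp add: G_def u_def)
    show "G w = F w / orient s (?E w)" if "r \<le> norm (?E w)" for w
      using that r by (simp add: G_def u_def)
    show "G w \<noteq> 0" if "norm (?E w) < 2 * r" for w
    proof
      assume "G w = 0"
      then have "norm \<alpha> \<le> (1 - u w) * (\<kappa> * norm \<alpha>)" using Gnear[of w] that r by simp
      also have "\<dots> \<le> 1 * (\<kappa> * norm \<alpha>)" using u01[of w] ak by (intro mult_right_mono) auto
      finally show False using ak by simp
    qed
    show "efac a w = 0" if "norm (?E w) < 2 * r" "F w = 0" for w
    proof (rule ccontr)
      assume "efac a w \<noteq> 0"
      then have "norm (F w / orient s (?E w) - \<alpha>) \<le> \<kappa> * norm \<alpha>"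
        using near[of w] that r by linarith
      then have "norm \<alpha> \<le> \<kappa> * norm \<alpha>" using \<open>F w = 0\<close> by simp
      then show False using ak by simp
    qed
    show "r \<le> norm (efac a w)" if "Im w = 0 \<or> Im w = 1" for w
      using that efac_norm_bottom[of w a] efac_norm_top[of w a] r by auto
  qed
qed

text \<open>Induction on the zeros. Without zeros \<open>F\<close> has a continuous logarithm on the
  contractible strip, and its increment over a period is the same at every height. Dividing out a
  zero removes \<open>2 * pi * \<i>\<close>, with the sign of its orientation, from the increment
  along the bottom and nothing from the increment along the top.\<close>

theorem annulus_argument_principle:
  fixes F :: "complex \<Rightarrow> complex" and g0 g1 :: "real \<Rightarrow> complex"
  assumes "finite Z" and contF: "continuous_on period_strip F" and per: "\<And>w. F (w + 1) = F w"
    and zeros: "\<And>w. w \<in> period_strip \<Longrightarrow> F w = 0 \<longleftrightarrow> (\<exists>a\<in>Z. \<exists>k::int. w = a + of_int k)"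
    and Z: "\<And>a. a \<in> Z \<Longrightarrow> 0 < Im a \<and> Im a < 1 \<and> indexed_zero F a (s a)"
    and dist: "\<And>a b k. a \<in> Z \<Longrightarrow> b \<in> Z \<Longrightarrow> a = b + of_int k \<Longrightarrow> a = b"
    and g: "continuous_on UNIV g0" "continuous_on UNIV g1"
      "\<And>t. F (of_real t) = exp (g0 t)" "\<And>t. F (of_real t + \<i>) = exp (g1 t)"
  shows "(g0 1 - g0 0) - (g1 1 - g1 0) = 2 * pi * \<i> * of_int (\<Sum>a\<in>Z. orient_sgn (s a))"
  using assms
proof (induction Z arbitrary: F g0 g1 rule: finite_induct)
  case empty
  have conv: "convex period_strip"
    using convex_Int[OF convex_halfspace_Im_ge[of 0] convex_halfspace_Im_le[of 1]]
    by (simp add: Int_def)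
  then have contr: "contractible period_strip" by (rule convex_imp_contractible)
  have "F w \<noteq> 0" if "w \<in> period_strip" for w using empty(3)[OF that] by simp
  from continuous_logarithm_on_contractible[OF empty(1) contr this]
  obtain g where g: "continuous_on period_strip g" "\<And>w. w \<in> period_strip \<Longrightarrow> F w = exp (g w)"
    by metis
  have "continuous_on UNIV (\<lambda>t. g (of_real t))" "continuous_on UNIV (\<lambda>t. g (of_real t + \<i>))"
    by (auto intro!: continuous_on_compose2[OF g(1)] continuous_intros)
  moreover have "exp (g0 t) = exp (g (of_real t))" "exp (g1 t) = exp (g (of_real t + \<i>))" for t
    using g(2)[of "of_real t"] g(2)[of "of_real t + \<i>"] empty(8)[of t] empty(9)[of t] by auto
  ultimately have g0: "g0 1 - g0 0 = g (of_real 1) - g (of_real 0)"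
    and g1: "g1 1 - g1 0 = g (of_real 1 + \<i>) - g (of_real 0 + \<i>)"
    using exp_eq_imp_diff_eq[OF connected_UNIV empty(6), of "\<lambda>t. g (of_real t)" 1 0]
      exp_eq_imp_diff_eq[OF connected_UNIV empty(7), of "\<lambda>t. g (of_real t + \<i>)" 1 0]
    by simp_all
  have "continuous_on period_strip (\<lambda>w. g (w + 1))"
    by (auto intro!: continuous_on_compose2[OF g(1)] continuous_intros)
  moreover have "exp (g (w + 1)) = exp (g w)" if "w \<in> period_strip" for w
    using g(2)[of w] g(2)[of "w + 1"] empty(2)[of w] that by auto
  \<comment> \<open>Both \<open>g (w + 1)\<close> and \<open>g w\<close> are logarithms of
    \<open>F w\<close> on the connected strip, so their difference is the same at \<open>0\<close>
    and at \<open>\<i>\<close>.\<close>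
  ultimately have "g (\<i> + 1) - g (0 + 1) = g \<i> - g 0"
    by (intro exp_eq_imp_diff_eq[OF convex_connected[OF conv] _ g(1)]) auto
  then show ?case unfolding g0 g1 by (simp add: algebra_simps)
next
  case (insert a Z)
  let ?E = "efac a" and ?s = "s a"
  have a: "0 < Im a" "Im a < 1" "indexed_zero F a ?s" using insert.prems(4) by auto
  obtain G r where r: "r > 0" and contG: "continuous_on period_strip G" and perG: "\<And>w. G (w + 1) = G w"
    and Gout: "\<And>w. r \<le> norm (?E w) \<Longrightarrow> G w = F w / orient ?s (?E w)"
    and Gin: "\<And>w. norm (?E w) < 2 * r \<Longrightarrow> G w \<noteq> 0"
    and Fin: "\<And>w. norm (?E w) < 2 * r \<Longrightarrow> F w = 0 \<Longrightarrow> ?E w = 0"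
    and bd: "\<And>w. Im w = 0 \<or> Im w = 1 \<Longrightarrow> r \<le> norm (?E w)"
    by (rule divide_out_zero[OF insert.prems(1,2) a]) (rule that)
  obtain L0 where L0: "continuous_on UNIV L0" "\<And>t::real. exp (L0 t) = ?E (of_real t)"
    "L0 1 - L0 0 = 2 * pi * \<i>" using efac_log_bottom[OF a(1)] by blast
  obtain L1 where L1: "continuous_on UNIV L1" "\<And>t::real. exp (L1 t) = ?E (of_real t + \<i>)"
    "L1 1 - L1 0 = 0" using efac_log_top[OF a(2)] by blast
  have Enz: "?E b \<noteq> 0" if "b \<in> Z" for b
  proof
    assume "?E b = 0"
    then obtain k :: int where "b = a + of_int k" unfolding efac_eq_0 by blast
    then have "b = a" using insert.prems(5)[of b a k] that by auto
    then show False using that insert.hyps by auto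
  qed
  \<comment> \<open>The factor 2 matters: it leaves each remaining zero a whole neighbourhood
    outside the cutoff region, where \<open>G\<close> is \<open>F\<close> times a continuous nonzero
    function.\<close>
  have far: "2 * r \<le> norm (?E b)" if "b \<in> Z" for b
  proof -
    have "b \<in> period_strip" using insert.prems(4)[of b] that by auto
    then have "F b = 0" using insert.prems(3)[of b] that
      by (metis add.right_neutral insertI2 of_int_0)
    then show ?thesis using Fin[of b] Enz[OF that] by linarith
  qed
  have zG: "G w = 0 \<longleftrightarrow> (\<exists>b\<in>Z. \<exists>k::int. w = b + of_int k)" if w: "w \<in> period_strip" for w
  proof
    assume G0: "G w = 0"
    then have big: "2 * r \<le> norm (?E w)" using Gin[of w] by linarith
    then have nz: "?E w \<noteq> 0" using r by auto
    have "F w = 0" using Gout[of w] big r G0 nz by auto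
    then obtain b k where "b \<in> insert a Z" "w = b + of_int k" using insert.prems(3)[OF w] by blast
    moreover have "b \<noteq> a" using nz calculation(2) efac_eq_0[of a w] by auto
    ultimately show "\<exists>b\<in>Z. \<exists>k::int. w = b + of_int k" by blast
  next
    assume "\<exists>b\<in>Z. \<exists>k::int. w = b + of_int k"
    then obtain b k where b: "b \<in> Z" "w = b + of_int k" by blast
    then have "F w = 0" using insert.prems(3)[OF w] by blast
    moreover have "2 * r \<le> norm (?E w)" using far[OF b(1)] b(2) by (simp add: efac_period)
    ultimately show "G w = 0" using Gout[of w] r by simp
  qed
  have ZG: "0 < Im b \<and> Im b < 1 \<and> indexed_zero G b (s b)" if b: "b \<in> Z" for b
  proof -
    have F: "indexed_zero F b (s b)" using insert.prems(4) b by auto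
    have contE: "isCont ?E b" using continuous_on_efac[OF continuous_on_id, of UNIV a]
      by (simp add: continuous_on_eq_continuous_at)
    have contOE: "isCont (\<lambda>w. orient ?s (?E w)) b"
      using continuous_on_orient[OF continuous_on_efac[OF continuous_on_id], of UNIV ?s a]
      by (simp add: continuous_on_eq_continuous_at)
    have "\<forall>\<^sub>F w in at b. r < norm (?E w)"
      using contE far[OF b] r unfolding isCont_def
      by (intro order_tendstoD(1)[OF tendsto_norm]) auto
    then have "\<forall>\<^sub>F w in at b. G w = (1 / orient ?s (?E w)) * F w"
      by eventually_elim (simp add: Gout)
    then have "indexed_zero G b (s b)"
      using contOE Enz[OF b]
      by (intro indexed_zero_mult[OF F, of "\<lambda>w. 1 / orient ?s (?E w)"] continuous_intros) auto
    then show ?thesis using insert.prems(4) b by auto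
  qed
  let ?h0 = "\<lambda>t. g0 t - orient ?s (L0 t)" and ?h1 = "\<lambda>t. g1 t - orient ?s (L1 t)"
  have "(?h0 1 - ?h0 0) - (?h1 1 - ?h1 0) = 2 * pi * \<i> * of_int (\<Sum>a\<in>Z. orient_sgn (s a))"
  proof (rule insert.IH[OF contG perG zG ZG])
    show "x = y" if "x \<in> Z" "y \<in> Z" "x = y + of_int k" for x y k
      using insert.prems(5) that by blast
    show "continuous_on UNIV ?h0" "continuous_on UNIV ?h1"
      by (intro continuous_intros insert.prems L0 L1)+
    show "G (of_real t) = exp (?h0 t)" for t
      using Gout[OF bd, of "of_real t"] insert.prems(8)[of t]
      by (simp add: exp_diff L0(2) flip: orient_simps(6))
    show "G (of_real t + \<i>) = exp (?h1 t)" for t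
      using Gout[OF bd, of "of_real t + \<i>"] insert.prems(9)[of t]
      by (simp add: exp_diff L1(2) flip: orient_simps(6))
  qed auto
  moreover have "orient ?s (L0 1) - orient ?s (L0 0) = 2 * pi * \<i> * of_int (orient_sgn ?s)"
    using L0(3) by (auto simp: orient_def orient_sgn_def simp flip: complex_cnj_diff)
  moreover have "orient ?s (L1 1) - orient ?s (L1 0) = 0"
    using L1(3) by (auto simp: orient_def simp flip: complex_cnj_diff)
  moreover have "(\<Sum>x\<in>insert a Z. orient_sgn (s x)) = orient_sgn ?s + (\<Sum>x\<in>Z. orient_sgn (s x))"
    using insert.hyps by simp
  ultimately show ?case by (simp only: of_int_add) (simp add: algebra_simps)
qed


section \<open>Whitney's formula for periodic curves\<close>

text \<open>A real linear map of the plane has the form \<open>p * \<zeta> + q * cnj \<zeta>\<close>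
  with determinant \<open>|p|^2 - |q|^2\<close>. The sign of the determinant tells which of the two
  coefficients is larger; this one becomes \<alpha>, and the other one accounts for the deviation of
  the quotient.\<close>

lemma indexed_zero_differentiable:
  assumes der: "(F has_derivative D) (at z)" and "F z = 0" and nd: "cdet (D 1) (D \<i>) \<noteq> 0"
  shows "indexed_zero F z (0 < cdet (D 1) (D \<i>))"
proof -
  define p q where "p = (D 1 - \<i> * D \<i>) / 2" and "q = (D 1 + \<i> * D \<i>) / 2"
  have lin: "linear D" using der has_derivative_linear by blast
  have D: "D \<zeta> = p * \<zeta> + q * cnj \<zeta>" for \<zeta>
  proof -
    have "D \<zeta> = D (Re \<zeta> *\<^sub>R 1 + Im \<zeta> *\<^sub>R \<i>)"
      by (rule arg_cong[where f = D]) (simp add: complex_eq_iff)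
    also have "\<dots> = Re \<zeta> *\<^sub>R D 1 + Im \<zeta> *\<^sub>R D \<i>"
      by (simp only: linear_add[OF lin] linear_scale[OF lin])
    also have "\<dots> = p * \<zeta> + q * cnj \<zeta>"
      by (simp add: p_def q_def complex_eq_iff field_simps)
    finally show ?thesis .
  qed
  have det: "cdet (D 1) (D \<i>) = (norm p)\<^sup>2 - (norm q)\<^sup>2"
    unfolding cdet_def p_def q_def cmod_power2 by (simp add: field_simps power2_eq_square)
  have lim: "((\<lambda>w. norm (F w - D (w - z)) / norm (w - z)) \<longlongrightarrow> 0) (at z)"
  proof -
    have "((\<lambda>w. (F w - D (w - z)) /\<^sub>R norm (w - z)) \<longlongrightarrow> 0) (at z)"
      using der \<open>F z = 0\<close> unfolding has_derivative_at2 by (simp add: divide_inverse)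
    from tendsto_norm_zero[OF this] show ?thesis by (simp add: divide_inverse mult.commute)
  qed
  define s where "s = (0 < cdet (D 1) (D \<i>))"
  define \<alpha> \<beta> where "\<alpha> = (if s then p else q)" and "\<beta> = (if s then q else p)"
  have ab: "norm \<beta> < norm \<alpha>"
  proof (rule power_less_imp_less_base[of _ 2])
    show "(norm \<beta>)\<^sup>2 < (norm \<alpha>)\<^sup>2"
    proof (cases "0 < cdet (D 1) (D \<i>)")
      case True then show ?thesis using det by (simp add: s_def \<alpha>_def \<beta>_def)
    next
      case False
      then have "(norm p)\<^sup>2 < (norm q)\<^sup>2" using det nd by linarith
      then show ?thesis using False by (simp add: s_def \<alpha>_def \<beta>_def)
    qed
  qed simp
  have D': "D \<zeta> = \<alpha> * orient s \<zeta> + \<beta> * cnj (orient s \<zeta>)" for \<zeta>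
    using D by (simp add: \<alpha>_def \<beta>_def orient_def)
  \<comment> \<open>The midpoint between \<open>norm \<beta> / norm \<alpha>\<close> and 1: the
    excess over the first absorbs the remainder of the linear approximation.\<close>
  define \<kappa> where "\<kappa> = (norm \<beta> / norm \<alpha> + 1) / 2"
  have \<alpha>: "\<alpha> \<noteq> 0" using ab by auto
  have k: "0 \<le> \<kappa>" "\<kappa> < 1" "norm \<beta> < \<kappa> * norm \<alpha>"
    using ab \<alpha> by (auto simp: \<kappa>_def field_simps)
  have "\<forall>\<^sub>F w in at z. norm (F w - D (w - z)) / norm (w - z) < \<kappa> * norm \<alpha> - norm \<beta>"
    using k by (intro order_tendstoD(2)[OF lim]) simp
  moreover have "\<forall>\<^sub>F w in at z. w \<noteq> z" by (simp add: eventually_at_filter)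
  ultimately have "\<forall>\<^sub>F w in at z. norm (F w / orient s (w - z) - \<alpha>) \<le> \<kappa> * norm \<alpha>"
  proof eventually_elim
    case (elim w)
    define \<zeta> where "\<zeta> = orient s (w - z)"
    have nz: "\<zeta> \<noteq> 0" "norm \<zeta> = norm (w - z)"
      using elim unfolding \<zeta>_def by (auto simp del: orient_simps(3))
    have "F w / \<zeta> - \<alpha> = (F w - D (w - z)) / \<zeta> + \<beta> * (cnj \<zeta> / \<zeta>)"
      using nz unfolding D' \<zeta>_def[symmetric] by (simp add: field_simps)
    also have "norm \<dots> \<le> norm ((F w - D (w - z)) / \<zeta>) + norm (\<beta> * (cnj \<zeta> / \<zeta>))"
      by (rule norm_triangle_ineq)
    also have "\<dots> = norm (F w - D (w - z)) / norm (w - z) + norm \<beta>"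
      using nz elim(2) by (simp add: norm_mult norm_divide)
    finally show ?case using elim unfolding \<zeta>_def by linarith
  qed
  then show ?thesis unfolding indexed_zero_def s_def[symmetric]
    using \<alpha> k by blast
qed

text \<open>Only the line \<open>Im w = 0\<close> is delicate. There the mean value inequality
  bounds the difference quotient minus \<open>b' (Re w)\<close> by the oscillation of
  \<open>b'\<close> near \<open>Re w\<close>.\<close>

lemma continuous_on_secant:
  assumes der: "\<And>t. (b has_vector_derivative b' t) (at t)" and cont: "continuous_on UNIV b'"
  shows "continuous_on period_strip
    (\<lambda>w. if Im w = 0 then b' (Re w) else (b (Re w + Im w) - b (Re w)) / of_real (Im w) :: complex)"
    (is "continuous_on _ ?G")
proof (unfold continuous_on_eq_continuous_within, intro ballI)
  fix w assume w: "w \<in> period_strip"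
  have contb: "continuous_on UNIV b"
    using der by (meson continuous_at_imp_continuous_on has_vector_derivative_continuous)
  show "continuous (at w within period_strip) ?G"
  proof (cases "Im w = 0")
    case False
    have "isCont (\<lambda>w. (b (Re w + Im w) - b (Re w)) / of_real (Im w)) w"
    proof -
      have "continuous_on {w. Im w \<noteq> 0} (\<lambda>w. (b (Re w + Im w) - b (Re w)) / of_real (Im w))"
        by (intro continuous_intros continuous_on_compose2[OF contb]) auto
      moreover have "open {w. Im w \<noteq> 0}"
        by (intro open_Collect_neq continuous_intros)
      ultimately show ?thesis using False by (simp add: continuous_on_eq_continuous_at)
    qed
    moreover have "\<forall>\<^sub>F v in at w. Im v \<noteq> 0"
      using False by (intro tendsto_imp_eventually_ne[where c = "Im w"] tendsto_intros)
    then have "\<forall>\<^sub>F v in at w. (b (Re v + Im v) - b (Re v)) / of_real (Im v) = ?G v"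
      by eventually_elim simp
    ultimately have "isCont ?G w"
      using False unfolding isCont_def by (auto intro: Lim_transform_eventually)
    then show ?thesis by (rule continuous_at_imp_continuous_at_within)
  next
    case True
    show ?thesis unfolding continuous_within_eps_delta
    proof (intro allI impI)
      fix e :: real assume e: "e > 0"
      have "isCont b' (Re w)" using cont by (simp add: continuous_on_eq_continuous_at)
      then obtain d where d: "d > 0" "\<And>x. dist x (Re w) < d \<Longrightarrow> dist (b' x) (b' (Re w)) < e / 2"
        unfolding continuous_at_eps_delta using e by (metis half_gt_zero)
      show "\<exists>d>0. \<forall>v\<in>period_strip. dist v w < d \<longrightarrow> dist (?G v) (?G w) < e"
      proof (intro exI[of _ "d / 2"] conjI ballI impI)
        fix v assume v: "v \<in> period_strip" "dist v w < d / 2"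
        have Re: "\<bar>Re v - Re w\<bar> < d / 2" using v(2) abs_Re_le_cmod[of "v - w"] by (simp add: dist_norm)
        have Im: "\<bar>Im v\<bar> < d / 2" using v(2) abs_Im_le_cmod[of "v - w"] True by (simp add: dist_norm)
        show "dist (?G v) (?G w) < e"
        proof (cases "Im v = 0")
          case Tr: True
          have "dist (b' (Re v)) (b' (Re w)) < e / 2"
            using d(1) Re by (intro d(2)) (simp add: dist_real_def)
          then show ?thesis using Tr True e by simp
        next
          case False
          have seg: "closed_segment (Re v) (Re v + Im v) \<subseteq> ball (Re w) d"
          proof (rule closed_segment_subset[OF _ _ convex_ball])
            show "Re v \<in> ball (Re w) d" "Re v + Im v \<in> ball (Re w) d"
              unfolding mem_ball dist_real_def using Re Im d(1) by linarith+
          qed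
          have "norm (b (Re v + Im v) - b (Re v) - (Re v + Im v - Re v) *\<^sub>R b' (Re w))
              \<le> norm (Re v + Im v - Re v) * (e / 2)"
          proof (rule vector_differentiable_bound_linearization[OF _ seg])
            show "(b has_vector_derivative b' t) (at t within ball (Re w) d)" for t
              by (rule has_vector_derivative_at_within[OF der])
            show "norm (b' x - b' (Re w)) \<le> e / 2" if "x \<in> ball (Re w) d" for x
              using d(2)[of x] that by (simp add: dist_norm dist_commute abs_minus_commute)
            show "Re w \<in> ball (Re w) d" using d by simp
          qed
          then have "norm (b (Re v + Im v) - b (Re v) - of_real (Im v) * b' (Re w)) \<le> \<bar>Im v\<bar> * (e / 2)"
            by (simp add: scaleR_conv_of_real)
          moreover have "?G v - ?G w = (b (Re v + Im v) - b (Re v) - of_real (Im v) * b' (Re w)) / of_real (Im v)"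
            using True False by (simp add: field_simps)
          ultimately have "norm (?G v - ?G w) \<le> e / 2"
            using False by (simp add: norm_divide divide_le_eq mult.commute)
          then show ?thesis using e by (simp add: dist_norm)
        qed
      qed (use d in simp)
    qed
  qed
qed

text \<open>The annulus variable is \<open>w\<close> with \<open>Re w = s\<close> and
  \<open>Im w = h\<close>. Taking \<open>0 \<le> s < 1\<close> and \<open>s < t < s + 1\<close>
  picks one representative of each zero of the secant modulo the period, with the earlier parameter
  first, as the crossing sign requires.\<close>

theorem whitney_formula_periodic:
  fixes b b' :: "real \<Rightarrow> complex" and c :: complex and \<theta> :: "real \<Rightarrow> real"
  assumes der: "\<And>t. (b has_vector_derivative b' t) (at t)" and cont: "continuous_on UNIV b'"
    and per: "\<And>t. b (t + 1) = b t + c" and c: "c \<noteq> 0"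
    and tr: "\<And>s t. s < t \<Longrightarrow> t < s + 1 \<Longrightarrow> b s = b t \<Longrightarrow> cdet (b' s) (b' t) \<noteq> 0"
    and \<theta>: "continuous_on UNIV \<theta>" "\<And>t. \<exists>r>0. b' t = of_real r * cis (\<theta> t) * c"
  defines "Z \<equiv> {(s, t). 0 \<le> s \<and> s < 1 \<and> s < t \<and> t < s + 1 \<and> b s = b t}"
  shows "finite Z" "\<theta> 1 - \<theta> 0 = 2 * pi * of_int (\<Sum>(s, t)\<in>Z. crossing_sgn b s t)"
proof -
  define F where "F = (\<lambda>w. b (Re w + Im w) - b (Re w))"
  define G where "G = (\<lambda>w. if Im w = 0 then b' (Re w) else F w / of_real (Im w))"
  define sg where "sg = (\<lambda>w. cdet (b' (Re w)) (b' (Re w + Im w)) < 0)"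
  define ZC where "ZC = {w. 0 \<le> Re w \<and> Re w < 1 \<and> 0 < Im w \<and> Im w < 1 \<and> b (Re w) = b (Re w + Im w)}"
  have contG: "continuous_on period_strip G"
    unfolding G_def F_def by (rule continuous_on_secant[OF der cont])
  have b'nz: "b' t \<noteq> 0" for t using \<theta>(2)[of t] c by auto
  have per': "b' (t + 1) = b' t" for t
  proof -
    have "((\<lambda>x. b (x + 1)) has_vector_derivative b' (t + 1)) (at t)"
    proof -
      have "((\<lambda>x::real. x + 1) has_vector_derivative 1) (at t)"
        using has_vector_derivative_add[OF has_vector_derivative_id has_vector_derivative_const]
        by (auto simp: id_def)
      from vector_diff_chain_at[OF this der] show ?thesis by (simp add: o_def)
    qed
    moreover have "((\<lambda>x. b (x + 1)) has_vector_derivative b' t) (at t)"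
      unfolding per using has_vector_derivative_add[OF der has_vector_derivative_const] by simp
    ultimately show ?thesis by (rule vector_derivative_unique_at)
  qed
  have G0: "G w = 0 \<longleftrightarrow> 0 < Im w \<and> Im w < 1 \<and> b (Re w) = b (Re w + Im w)"
    if "w \<in> period_strip" for w
    using that b'nz per[of "Re w"] c by (cases "Im w = 0"; cases "Im w = 1") (auto simp: G_def F_def)
  have iz: "indexed_zero G w (sg w)" if w: "w \<in> period_strip" "G w = 0" for w
  proof -
    have h: "0 < Im w" "Im w < 1" "b (Re w) = b (Re w + Im w)" using G0 w by auto
    \<comment> \<open>The partial derivatives are \<open>b' (s + h) - b' (s)\<close> and
      \<open>b' (s + h)\<close>; their determinant is minus that of the two tangents. This minus
      sign matches crossings from left to right being counted as \<open>1\<close>.\<close>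
    define D where "D = (\<lambda>\<zeta>. (Re \<zeta> + Im \<zeta>) *\<^sub>R b' (Re w + Im w) - Re \<zeta> *\<^sub>R b' (Re w))"
    have "(F has_derivative D) (at w)"
      unfolding F_def D_def
      by (intro has_derivative_diff
          has_derivative_compose[of "\<lambda>w. Re w + Im w" "\<lambda>w. Re w + Im w" w UNIV b "\<lambda>x. x *\<^sub>R b' (Re w + Im w)"]
          has_derivative_compose[of Re Re w UNIV b "\<lambda>x. x *\<^sub>R b' (Re w)"]
          derivative_intros der[unfolded has_vector_derivative_def])
    moreover have "cdet (D 1) (D \<i>) = - cdet (b' (Re w)) (b' (Re w + Im w))"
      by (simp add: D_def cdet_def algebra_simps)
    ultimately have "indexed_zero F w (sg w)"
      using indexed_zero_differentiable[of F D w] h tr[of "Re w" "Re w + Im w"]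
      by (simp add: F_def sg_def)
    moreover have "isCont (\<lambda>w. 1 / of_real (Im w) :: complex) w" using h by (intro continuous_intros) auto
    moreover have "\<forall>\<^sub>F v in at w. Im v \<noteq> 0"
      using h by (intro tendsto_imp_eventually_ne[where c = "Im w"] tendsto_intros) auto
    then have "\<forall>\<^sub>F v in at w. G v = 1 / of_real (Im v) * F v"
      by eventually_elim (simp add: G_def)
    ultimately show ?thesis using h
      by (intro indexed_zero_mult[of F w "sg w" "\<lambda>w. 1 / of_real (Im w)" G]) auto
  qed
  have Gper: "G (v + 1) = G v" for v
    using per[of "Re v"] per[of "Re v + Im v"] per'[of "Re v"] by (simp add: G_def F_def add_ac)
  have fin: "finite ZC"
  proof (rule ccontr)
    assume inf: "infinite ZC"
    \<comment> \<open>\<open>ZC\<close> is half-open, so the accumulation argument takes place in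
      the closed unit square. The accumulation point is again a zero of \<open>G\<close>, and such
      zeros are isolated.\<close>
    define K where "K = {w \<in> cbox 0 (1 + \<i>). G w = 0}"
    have sub: "cbox 0 (1 + \<i>) \<subseteq> period_strip" by (auto simp: in_cbox_complex_iff)
    have "closed K" unfolding K_def
      by (intro continuous_closed_preimage_constant continuous_on_subset[OF contG sub] closed_cbox)
    then have "compact K"
      using compact_Int_closed[OF compact_cbox, of K 0 "1 + \<i>"] by (simp add: K_def Collect_conj_eq Int_assoc[symmetric])
    moreover have "ZC \<subseteq> K"
    proof
      fix w assume w: "w \<in> ZC"
      then have "w \<in> period_strip" by (simp add: ZC_def)
      then show "w \<in> K" using G0[of w] w by (auto simp: ZC_def K_def in_cbox_complex_iff)
    qed
    ultimately obtain x where x: "x \<in> K" "x islimpt K"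
      using Heine_Borel_imp_Bolzano_Weierstrass[OF _ inf] islimpt_subset by meson
    have "\<forall>\<^sub>F w in at x. G w \<noteq> 0"
      using x sub by (intro indexed_zero_isolated[OF iz]) (auto simp: K_def)
    then have "\<forall>\<^sub>F w in at x. w \<notin> K" by eventually_elim (simp add: K_def)
    then show False using x(2) by (simp add: islimpt_conv_frequently_at frequently_def)
  qed
  \<comment> \<open>A logarithm of \<open>b'\<close> read off from
    \<open>b' t = r * cis (\<theta> t) * c\<close>. The modulus is periodic, so only \<theta>
    contributes to the increment.\<close>
  define g0 where "g0 = (\<lambda>t. of_real (ln (norm (b' t) / norm c)) + \<i> * of_real (\<theta> t) + Ln c)"
  have "(g0 1 - g0 0) - (Ln c - Ln c) = 2 * pi * \<i> * of_int (\<Sum>w\<in>ZC. orient_sgn (sg w))"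
  proof (rule annulus_argument_principle[where F = G and ?g1.0 = "\<lambda>_. Ln c" and s = sg, OF fin contG])
    show "G (w + 1) = G w" for w by (rule Gper)
    show "G w = 0 \<longleftrightarrow> (\<exists>a\<in>ZC. \<exists>k::int. w = a + of_int k)" if w: "w \<in> period_strip" for w
    proof
      assume Gw: "G w = 0"
      define v where "v = w + of_int (- \<lfloor>Re w\<rfloor>)"
      have "G v = 0" unfolding v_def add_of_int_period[of G, OF Gper] by (rule Gw)
      moreover have "v \<in> period_strip" using w by (simp add: v_def)
      moreover have "0 \<le> Re v" "Re v < 1" unfolding v_def by (simp_all, linarith+)
      ultimately have "v \<in> ZC" using G0[of v] by (auto simp: ZC_def)
      then show "\<exists>a\<in>ZC. \<exists>k::int. w = a + of_int k"
        by (intro bexI[of _ v] exI[of _ "\<lfloor>Re w\<rfloor>"]) (auto simp: v_def)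
    next
      assume "\<exists>a\<in>ZC. \<exists>k::int. w = a + of_int k"
      then obtain a k where a: "a \<in> ZC" "w = a + of_int k" by blast
      have "G a = 0" using a G0[of a] by (auto simp: ZC_def)
      then show "G w = 0" unfolding a add_of_int_period[of G, OF Gper] .
    qed
    show "0 < Im a \<and> Im a < 1 \<and> indexed_zero G a (sg a)" if "a \<in> ZC" for a
      using that iz[of a] G0[of a] by (auto simp: ZC_def)
    show "a = a'" if "a \<in> ZC" "a' \<in> ZC" "a = a' + of_int k" for a a' k
    proof -
      have "Re a = Re a' + of_int k" using that by simp
      then have "k = 0" using that(1,2) unfolding ZC_def mem_Collect_eq by linarith
      then show ?thesis using that by simp
    qed
    show "continuous_on UNIV g0" unfolding g0_def using b'nz c
      by (intro continuous_intros cont \<theta>) auto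
    show "continuous_on UNIV (\<lambda>_::real. Ln c)" by simp
    show "G (of_real t) = exp (g0 t)" for t
    proof -
      obtain r where r: "r > 0" "b' t = of_real r * cis (\<theta> t) * c" using \<theta>(2) by blast
      have "norm (b' t) / norm c = r" using r c by (simp add: norm_mult)
      then show ?thesis using r c by (simp add: G_def g0_def exp_add cis_conv_exp exp_of_real)
    qed
    show "G (of_real t + \<i>) = exp (Ln c)" for t using per[of t] c by (simp add: G_def F_def)
  qed
  moreover have "g0 1 - g0 0 = \<i> * of_real (\<theta> 1 - \<theta> 0)"
    using per'[of 0] by (simp add: g0_def algebra_simps)
  ultimately have "\<i> * of_real (\<theta> 1 - \<theta> 0) = \<i> * of_real (2 * pi * of_int (\<Sum>w\<in>ZC. orient_sgn (sg w)))"
    by (simp add: algebra_simps)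
  then have main: "\<theta> 1 - \<theta> 0 = 2 * pi * of_int (\<Sum>w\<in>ZC. orient_sgn (sg w))"
    by (simp only: mult_cancel_left of_real_eq_iff) simp
  have vd: "vector_derivative b (at t) = b' t" for t using der by (rule vector_derivative_at)
  have bij: "bij_betw (\<lambda>w. (Re w, Re w + Im w)) ZC Z"
    by (rule bij_betwI[where g = "\<lambda>(s, t). Complex s (t - s)"])
      (auto simp: ZC_def Z_def complex_eq_iff)
  show "finite Z" using fin bij bij_betw_finite by blast
  have "(\<Sum>(s, t)\<in>Z. crossing_sgn b s t) = (\<Sum>w\<in>ZC. crossing_sgn b (Re w) (Re w + Im w))"
    using sum.reindex_bij_betw[OF bij, of "\<lambda>(s, t). crossing_sgn b s t"] by simp
  also have "\<dots> = (\<Sum>w\<in>ZC. orient_sgn (sg w))"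
  proof (rule sum.cong)
    fix w assume "w \<in> ZC"
    then have "cdet (b' (Re w)) (b' (Re w + Im w)) \<noteq> 0" by (intro tr) (auto simp: ZC_def)
    then show "crossing_sgn b (Re w) (Re w + Im w) = orient_sgn (sg w)"
      by (simp add: crossing_sgn_def vd orient_sgn_def sg_def Let_def)
  qed simp
  finally show "\<theta> 1 - \<theta> 0 = 2 * pi * of_int (\<Sum>(s, t)\<in>Z. crossing_sgn b s t)" using main by simp
qed


section \<open>Deck transformations are conformal\<close>

text \<open>The reciprocal of the conformal factor: the metric of the plane is
  \<open>|dz| / plane_weight\<close>.\<close>

fun plane_weight :: "geometry \<Rightarrow> complex \<Rightarrow> real" where
  "plane_weight Euclidean z = 1"
| "plane_weight Hyperbolic z = Im z"

lemma plane_weight_pos: "z \<in> plane g \<Longrightarrow> 0 < plane_weight g z"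
  by (cases g) auto

lemma open_plane: "open (plane g)"
  by (cases g) (auto simp: open_halfspace_Im_gt)

lemma convex_plane: "convex (plane g)"
  by (cases g) (auto simp: convex_halfspace_Im_gt)

lemma continuous_on_plane_weight: "continuous_on A (plane_weight g)"
  by (cases g) (auto intro!: continuous_intros)

text \<open>As \<open>arcosh\<close> is injective on arguments from 1 on, an equality of hyperbolic
  distances becomes polynomial; the weights give the euclidean case the same shape.\<close>

lemma plane_dist_eq_iff:
  assumes "z \<in> plane g" "w \<in> plane g" "z' \<in> plane g" "w' \<in> plane g"
  shows "plane_dist g z w = plane_dist g z' w' \<longleftrightarrow>
    (dist z w)\<^sup>2 * (plane_weight g z' * plane_weight g w') = (dist z' w')\<^sup>2 * (plane_weight g z * plane_weight g w)"
proof (cases g)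
  case Hyperbolic
  have pos: "0 < Im z" "0 < Im w" "0 < Im z'" "0 < Im w'" using assms Hyperbolic by auto
  define x y where "x = (dist z w)\<^sup>2 / (2 * Im z * Im w)" and "y = (dist z' w')\<^sup>2 / (2 * Im z' * Im w')"
  have "0 \<le> x" "0 \<le> y" using pos by (auto simp: x_def y_def)
  then have "cosh (arcosh (1 + x)) = 1 + x" "cosh (arcosh (1 + y)) = 1 + y"
    by (simp_all add: cosh_arcosh_real)
  then have "arcosh (1 + x) = arcosh (1 + y) \<longleftrightarrow> x = y"
    by (metis add_left_cancel)
  also have "\<dots> \<longleftrightarrow> (dist z w)\<^sup>2 * (2 * Im z' * Im w') = (dist z' w')\<^sup>2 * (2 * Im z * Im w)"
    unfolding x_def y_def using pos by (intro frac_eq_eq) auto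
  also have "\<dots> \<longleftrightarrow> (dist z w)\<^sup>2 * (Im z' * Im w') = (dist z' w')\<^sup>2 * (Im z * Im w)"
    by (simp only: mult.assoc mult.left_commute[of _ 2] mult_cancel_left) simp
  finally show ?thesis using Hyperbolic by (simp only: plane_dist.simps plane_weight.simps x_def y_def)
qed simp

lemma plane_dist_tendsto_0:
  assumes "z \<in> plane g"
  shows "((\<lambda>a. plane_dist g z a) \<longlongrightarrow> 0) (at z)"
proof (cases g)
  case Euclidean
  then show ?thesis using tendsto_dist[OF tendsto_const tendsto_ident_at, of z z UNIV] by simp
next
  case Hyperbolic
  let ?u = "\<lambda>a. 1 + (dist z a)\<^sup>2 / (2 * Im z * Im a)"
  have z: "0 < Im z" using assms Hyperbolic by simp
  have "(?u \<longlongrightarrow> 1 + (dist z z)\<^sup>2 / (2 * Im z * Im z)) (at z)"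
    using z by (intro tendsto_intros) auto
  then have u: "(?u \<longlongrightarrow> 1) (at z)" by simp
  have "\<forall>\<^sub>F a in at z. 0 < Im a"
    using z by (intro order_tendstoD(1)[OF tendsto_Im[OF tendsto_ident_at]]) auto
  then have ev: "\<forall>\<^sub>F a in at z. ?u a \<in> {1..}" by eventually_elim (use z in auto)
  have "continuous_on {1..} (arcosh :: real \<Rightarrow> real)" by (rule continuous_on_arcosh) simp
  from continuous_on_tendsto_compose[OF this u _ ev] show ?thesis
    using Hyperbolic by (simp add: arcosh_1)
qed

lemma deck_transformation_plane:
  "deck_transformation g p f \<Longrightarrow> z \<in> plane g \<Longrightarrow> f z \<in> plane g"
  unfolding deck_transformation_def homeomorphism_def by blast

lemma deck_transformation_continuous:
  "deck_transformation g p f \<Longrightarrow> continuous_on (plane g) f"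
  unfolding deck_transformation_def homeomorphism_def by blast

lemma deck_transformation_inj: "deck_transformation g p f \<Longrightarrow> inj_on f (plane g)"
  unfolding deck_transformation_def homeomorphism_def by (auto intro: inj_on_inverseI)

lemma deck_transformation_image: "deck_transformation g p f \<Longrightarrow> f ` plane g = plane g"
  unfolding deck_transformation_def homeomorphism_def by blast

text \<open>Near both \<open>z\<close> and \<open>f z\<close> the map \<open>p\<close> preserves
  distances, and \<open>p \<circ> f = p\<close>. Continuity of \<open>f\<close> keeps
  \<open>f a\<close> in the second neighbourhood when \<open>a\<close> is close to
  \<open>z\<close>.\<close>

lemma deck_transformation_local_isometry:
  assumes M: "complete_geometric_surface g p M" and f: "deck_transformation g p f" and z: "z \<in> plane g"
  shows "\<forall>\<^sub>F a in at z. (dist (f z) (f a))\<^sup>2 * (plane_weight g z * plane_weight g a)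
    = (dist z a)\<^sup>2 * (plane_weight g (f z) * plane_weight g (f a))"
proof -
  have fz: "f z \<in> plane g" by (rule deck_transformation_plane[OF f z])
  have ev: "\<forall>\<^sub>F a in at z. a \<in> plane g" using open_plane z by (rule eventually_at_in_open')
  obtain r1 where r1: "r1 > 0" "\<And>a b. a \<in> plane g \<Longrightarrow> b \<in> plane g \<Longrightarrow> plane_dist g z a < r1 \<Longrightarrow>
      plane_dist g z b < r1 \<Longrightarrow> dist (p a) (p b) = plane_dist g a b"
    using M z unfolding complete_geometric_surface_def by blast
  obtain r2 where r2: "r2 > 0" "\<And>a b. a \<in> plane g \<Longrightarrow> b \<in> plane g \<Longrightarrow> plane_dist g (f z) a < r2 \<Longrightarrow>
      plane_dist g (f z) b < r2 \<Longrightarrow> dist (p a) (p b) = plane_dist g a b"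
    using M fz unfolding complete_geometric_surface_def by blast
  have zero: "plane_dist g v v = 0" if "v \<in> plane g" for v using that by (cases g) (auto simp: arcosh_1)
  have e1: "\<forall>\<^sub>F a in at z. plane_dist g z a < r1"
    using plane_dist_tendsto_0[OF z] r1(1) by (rule order_tendstoD)
  have "isCont f z"
    using deck_transformation_continuous[OF f] z open_plane continuous_on_eq_continuous_at by blast
  then have lim: "(f \<longlongrightarrow> f z) (at z)" by (simp add: isCont_def)
  have "((\<lambda>a. plane_dist g (f z) a) \<longlongrightarrow> plane_dist g (f z) (f z)) (at (f z))"
    using plane_dist_tendsto_0[OF fz] zero[OF fz] by simp
  from isCont_tendsto_compose[OF this[folded isCont_def] lim]
  have "((\<lambda>a. plane_dist g (f z) (f a)) \<longlongrightarrow> 0) (at z)" using zero[OF fz] by simp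
  then have e2: "\<forall>\<^sub>F a in at z. plane_dist g (f z) (f a) < r2" using r2(1) by (rule order_tendstoD)
  from ev e1 e2 show ?thesis
  proof eventually_elim
    case (elim a)
    have "plane_dist g (f z) (f a) = dist (p (f z)) (p (f a))"
      using r2(2)[of "f z" "f a"] elim fz zero[OF fz] r2(1) deck_transformation_plane[OF f] by simp
    also have "\<dots> = dist (p z) (p a)" using f z elim unfolding deck_transformation_def by simp
    also have "\<dots> = plane_dist g z a" using r1(2)[of z a] elim z zero[OF z] r1(1) by simp
    finally show ?case
      using plane_dist_eq_iff[of "f z" g "f a" z a] fz z elim deck_transformation_plane[OF f] by simp
  qed
qed

text \<open>Approaching \<open>z\<close> along each line shows that the differential stretches all
  directions by the same factor, so it is a similarity; a positive determinant rules out
  reflections, leaving multiplication by a complex number.\<close>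

lemma similarity_derivative:
  assumes der: "(f has_derivative D) (at z)" and det: "0 < cdet (D 1) (D \<i>)"
    and ev: "\<forall>\<^sub>F a in at z. (dist (f z) (f a))\<^sup>2 = (dist z a)\<^sup>2 * k a" and k: "(k \<longlongrightarrow> K) (at z)"
  shows "(f has_field_derivative D 1) (at z)" "(norm (D 1))\<^sup>2 = K"
proof -
  have lin: "linear D" using der has_derivative_linear by blast
  have stretch: "(norm (D h))\<^sup>2 = (norm h)\<^sup>2 * K" if h: "h \<noteq> 0" for h
  proof -
    have path: "((\<lambda>x::real. z + of_real x * h) has_derivative (\<lambda>x. of_real x * h)) (at 0)"
      by (auto intro!: derivative_eq_intros)
    have "((\<lambda>x::real. f (z + of_real x * h)) has_derivative (\<lambda>x. D (of_real x * h))) (at 0)"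
      using has_derivative_compose[OF path, of f D] der by simp
    moreover have "D (of_real x * h) = x *\<^sub>R D h" for x
      using linear_scale[OF lin, of x h] by (simp add: scaleR_conv_of_real)
    ultimately have "((\<lambda>x::real. f (z + of_real x * h)) has_vector_derivative D h) (at 0)"
      by (simp add: has_vector_derivative_def)
    then have "((\<lambda>x. (1 / norm x) *\<^sub>R (f (z + of_real x * h) - (f z + x *\<^sub>R D h))) \<longlongrightarrow> 0) (at 0)"
      by (simp add: has_vector_derivative_def has_derivative_at2)
    from tendsto_norm_zero[OF this]
    have "((\<lambda>x. norm ((f (z + of_real x * h) - f z) /\<^sub>R x - D h)) \<longlongrightarrow> 0) (at 0)"
    proof (rule Lim_transform_eventually)
      have "norm ((1 / norm x) *\<^sub>R (f (z + of_real x * h) - (f z + x *\<^sub>R D h))) =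
          norm ((f (z + of_real x * h) - f z) /\<^sub>R x - D h)" if "x \<noteq> 0" for x
      proof -
        have "norm ((1 / norm x) *\<^sub>R (f (z + of_real x * h) - (f z + x *\<^sub>R D h))) =
            norm ((1 / x) *\<^sub>R (f (z + of_real x * h) - (f z + x *\<^sub>R D h)))" by simp
        also have "(1 / x) *\<^sub>R (f (z + of_real x * h) - (f z + x *\<^sub>R D h)) =
            (f (z + of_real x * h) - f z) /\<^sub>R x - D h"
          using that by (simp add: scaleR_diff_right scaleR_add_right divide_inverse)
        finally show ?thesis .
      qed
      then show "\<forall>\<^sub>F x in at 0. norm ((1 / norm x) *\<^sub>R (f (z + of_real x * h) - (f z + x *\<^sub>R D h))) =
          norm ((f (z + of_real x * h) - f z) /\<^sub>R x - D h)"
        by (auto simp: eventually_at_filter)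
    qed
    then have "((\<lambda>x. (f (z + of_real x * h) - f z) /\<^sub>R x) \<longlongrightarrow> D h) (at 0)"
      by (rule LIM_zero_cancel[OF tendsto_norm_zero_cancel])
    from tendsto_power[OF tendsto_norm[OF this], of 2]
    have lim1: "((\<lambda>x. (norm ((f (z + of_real x * h) - f z) /\<^sub>R x))\<^sup>2) \<longlongrightarrow> (norm (D h))\<^sup>2) (at 0)" .
    have fl: "filterlim (\<lambda>x::real. z + of_real x * h) (at z) (at 0)"
    proof (rule filterlim_atI)
      have "((\<lambda>x::real. z + of_real x * h) \<longlongrightarrow> z + of_real 0 * h) (at 0)" by (intro tendsto_intros)
      then show "((\<lambda>x::real. z + of_real x * h) \<longlongrightarrow> z) (at 0)" by simp
      show "\<forall>\<^sub>F x::real in at 0. z + of_real x * h \<noteq> z"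
        using h by (auto simp: eventually_at_filter)
    qed
    have lim2: "((\<lambda>x::real. (norm h)\<^sup>2 * k (z + of_real x * h)) \<longlongrightarrow> (norm h)\<^sup>2 * K) (at 0)"
      by (intro tendsto_intros filterlim_compose[OF k fl])
    have "\<forall>\<^sub>F x::real in at 0. (norm ((f (z + of_real x * h) - f z) /\<^sub>R x))\<^sup>2 = (norm h)\<^sup>2 * k (z + of_real x * h)"
      using fl[THEN filterlim_iff[THEN iffD1], rule_format, OF ev] eventually_neq_at_within[of 0 0 UNIV]
    proof eventually_elim
      case (elim x)
      have "(norm ((f (z + of_real x * h) - f z) /\<^sub>R x))\<^sup>2 = (dist (f z) (f (z + of_real x * h)))\<^sup>2 / x\<^sup>2"
        by (simp add: dist_norm norm_minus_commute power_mult_distrib power_inverse divide_inverse mult.commute)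
      also have "\<dots> = (norm h)\<^sup>2 * k (z + of_real x * h)"
        unfolding elim(1) using elim(2) by (simp add: dist_norm norm_mult power_mult_distrib)
      finally show ?case .
    qed
    from tendsto_cong[OF this] lim1 have "((\<lambda>x::real. (norm h)\<^sup>2 * k (z + of_real x * h)) \<longlongrightarrow> (norm (D h))\<^sup>2) (at 0)"
      by simp
    from tendsto_unique[OF _ this lim2] show ?thesis by simp
  qed
  show K: "(norm (D 1))\<^sup>2 = K" using stretch[of 1] by simp
  have Ki: "(norm (D \<i>))\<^sup>2 = K" using stretch[of \<i>] by simp
  \<comment> \<open>Polarization: equal stretching of \<open>1\<close>, \<open>\<i>\<close> and
    \<open>1 + \<i>\<close> makes \<open>D 1\<close> and \<open>D \<i>\<close> orthogonal.
    Lagrange's identity then yields the determinant.\<close>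
  have "(norm (D 1 + D \<i>))\<^sup>2 = 2 * K"
    using stretch[of "1 + \<i>"] linear_add[OF lin, of 1 \<i>] by (simp add: cmod_power2 complex_eq_iff)
  then have orth: "Re (D 1) * Re (D \<i>) + Im (D 1) * Im (D \<i>) = 0"
    using K Ki unfolding cmod_power2 by (simp add: power2_eq_square algebra_simps)
  let ?d = "cdet (D 1) (D \<i>)"
  have d: "?d = Re (D 1) * Im (D \<i>) - Im (D 1) * Re (D \<i>)" by (simp add: cdet_def)
  have "?d\<^sup>2 + (Re (D 1) * Re (D \<i>) + Im (D 1) * Im (D \<i>))\<^sup>2 = (norm (D 1))\<^sup>2 * (norm (D \<i>))\<^sup>2"
    unfolding d cmod_power2 by (simp add: power2_eq_square algebra_simps)
  then have "?d\<^sup>2 = K\<^sup>2" unfolding orth K Ki by (simp add: power2_eq_square)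
  moreover have "0 \<le> K" unfolding K[symmetric] by simp
  ultimately have dK: "?d = K" using det by (simp add: power2_eq_iff)
  \<comment> \<open>Both lengths squared and the determinant equal \<open>K\<close>, so this square
    vanishes and \<open>D\<close> is complex linear.\<close>
  have "(norm (D \<i> - \<i> * D 1))\<^sup>2 = (norm (D 1))\<^sup>2 + (norm (D \<i>))\<^sup>2 - 2 * ?d"
    unfolding d cmod_power2 by (simp add: power2_eq_square algebra_simps)
  then have Di: "D \<i> = \<i> * D 1" using K Ki dK by simp
  have "D h = D 1 * h" for h
  proof -
    have "D h = D (Re h *\<^sub>R 1 + Im h *\<^sub>R \<i>)"
      by (rule arg_cong[where f = D]) (simp add: complex_eq_iff)
    also have "\<dots> = Re h *\<^sub>R D 1 + Im h *\<^sub>R D \<i>"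
      by (simp only: linear_add[OF lin] linear_scale[OF lin])
    also have "\<dots> = D 1 * h" by (simp add: Di complex_eq_iff algebra_simps)
    finally show ?thesis .
  qed
  then have "D = (\<lambda>h. D 1 * h)" by blast
  then show "(f has_field_derivative D 1) (at z)" using der by (simp add: has_field_derivative_def)
qed

text \<open>In the local isometry identity the squared stretching factor is a quotient of weights,
  whose limit at \<open>z\<close> is the square of
  \<open>plane_weight g (f z) / plane_weight g z\<close>.\<close>

lemma deck_transformation_conformal:
  assumes M: "complete_geometric_surface g p M" and f: "deck_transformation g p f"
    and op: "orientation_preserving_map g f" and z: "z \<in> plane g"
  shows "(f has_field_derivative deriv f z) (at z)"
    "norm (deriv f z) = plane_weight g (f z) / plane_weight g z"
proof -
  obtain D where D: "(f has_derivative D) (at z)" "0 < cdet (D 1) (D \<i>)"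
    using op z unfolding orientation_preserving_map_def by blast
  have fz: "f z \<in> plane g" by (rule deck_transformation_plane[OF f z])
  let ?k = "\<lambda>a. plane_weight g (f z) * plane_weight g (f a) / (plane_weight g z * plane_weight g a)"
  have pos: "0 < plane_weight g z" "0 < plane_weight g (f z)" by (intro plane_weight_pos z fz)+
  have ev: "\<forall>\<^sub>F a in at z. a \<in> plane g" using open_plane z by (rule eventually_at_in_open')
  have "\<forall>\<^sub>F a in at z. (dist (f z) (f a))\<^sup>2 = (dist z a)\<^sup>2 * ?k a"
    using deck_transformation_local_isometry[OF M f z] ev
  proof eventually_elim
    case (elim a)
    then have "0 < plane_weight g a" by (intro plane_weight_pos)
    then show ?case using elim(1) pos by (simp add: eq_divide_eq mult.assoc)
  qed
  moreover have "(?k \<longlongrightarrow> plane_weight g (f z) * plane_weight g (f z) / (plane_weight g z * plane_weight g z)) (at z)"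
  proof -
    have c: "isCont (plane_weight g) v" for v
      using continuous_on_plane_weight[of UNIV g] by (simp add: continuous_on_eq_continuous_at)
    have "isCont f z" using D(1) has_derivative_continuous by blast
    then have "((\<lambda>a. plane_weight g (f a)) \<longlongrightarrow> plane_weight g (f z)) (at z)"
      using isCont_tendsto_compose[OF c] by (simp add: isCont_def)
    moreover have "(plane_weight g \<longlongrightarrow> plane_weight g z) (at z)" using c by (simp add: isCont_def)
    ultimately show ?thesis using pos by (intro tendsto_intros) auto
  qed
  ultimately have D1: "(f has_field_derivative D 1) (at z)"
      "(norm (D 1))\<^sup>2 = plane_weight g (f z) * plane_weight g (f z) / (plane_weight g z * plane_weight g z)"
    using similarity_derivative[OF D, of ?k] by blast+
  then show "(f has_field_derivative deriv f z) (at z)" by (simp add: DERIV_imp_deriv)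
  have "(norm (D 1))\<^sup>2 = (plane_weight g (f z) / plane_weight g z)\<^sup>2"
    unfolding D1(2) by (simp only: power2_eq_square times_divide_times_eq)
  then have "norm (D 1) = plane_weight g (f z) / plane_weight g z"
    by (rule power2_eq_imp_eq) (use pos in auto)
  then show "norm (deriv f z) = plane_weight g (f z) / plane_weight g z"
    using D1(1) by (simp add: DERIV_imp_deriv)
qed

text \<open>The derivative is entire of modulus 1, hence constant by Liouville's theorem; an affine
  map without fixed points has slope 1.\<close>

lemma euclidean_deck_translation:
  assumes M: "complete_geometric_surface Euclidean p M" and f: "deck_transformation Euclidean p f"
    and op: "orientation_preserving_map Euclidean f" and nofix: "\<And>z. f z \<noteq> z"
  obtains v where "v \<noteq> 0" "\<And>z. f z = z + v"
proof -
  have der: "(f has_field_derivative deriv f z) (at z)" "norm (deriv f z) = 1" for z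
    using deck_transformation_conformal[OF M f op, of z] by auto
  have hol: "f holomorphic_on UNIV" using der(1) by (auto simp: holomorphic_on_open)
  have "deriv f constant_on UNIV"
    using Liouville_theorem[of "deriv f"] hol der(2)
    by (auto simp: bounded_iff constant_on_def intro!: holomorphic_deriv)
  then obtain \<alpha> where \<alpha>: "\<And>z. deriv f z = \<alpha>" by (auto simp: constant_on_def)
  have "((\<lambda>z. f z - \<alpha> * z) has_field_derivative 0) (at z)" for z
    using der(1)[of z] unfolding \<alpha> by (auto intro!: derivative_eq_intros)
  then have "(\<lambda>z. f z - \<alpha> * z) constant_on UNIV"
    using has_field_derivative_zero_constant[of UNIV "\<lambda>z. f z - \<alpha> * z"]
    by (auto simp: constant_on_def)
  then obtain \<beta> where "\<And>z. f z - \<alpha> * z = \<beta>" by (auto simp: constant_on_def)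
  then have fz: "f z = \<alpha> * z + \<beta>" for z by (simp add: diff_eq_eq add.commute)
  have "\<alpha> = 1"
  proof (rule ccontr)
    assume "\<alpha> \<noteq> 1"
    then have "f (\<beta> / (1 - \<alpha>)) = \<beta> / (1 - \<alpha>)" unfolding fz by (simp add: field_simps)
    then show False using nofix by blast
  qed
  show ?thesis
  proof (rule that)
    show f: "f z = z + \<beta>" for z using fz[of z] \<open>\<alpha> = 1\<close> by simp
    show "\<beta> \<noteq> 0" using f[of 0] nofix[of 0] by auto
  qed
qed


section \<open>Automorphisms of the half-plane\<close>

abbreviation "half_plane \<equiv> plane Hyperbolic"

definition mob :: "real \<Rightarrow> real \<Rightarrow> real \<Rightarrow> real \<Rightarrow> complex \<Rightarrow> complex" where
  "mob a b c d z = (of_real a * z + of_real b) / (of_real c * z + of_real d)"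

definition mob_deriv :: "real \<Rightarrow> real \<Rightarrow> real \<Rightarrow> real \<Rightarrow> complex \<Rightarrow> complex" where
  "mob_deriv a b c d z = of_real (a * d - b * c) / (of_real c * z + of_real d)\<^sup>2"

lemma mob_denom_nonzero:
  assumes "0 < a * d - b * c" "0 < Im z"
  shows "of_real c * z + of_real d \<noteq> (0::complex)"
proof
  assume "of_real c * z + of_real d = (0::complex)"
  then have "c * Im z = 0" "c * Re z + d = 0" by (auto simp: complex_eq_iff)
  then show False using assms by auto
qed

lemma mob_diff:
  assumes "0 < a * d - b * c" "0 < Im z" "0 < Im w"
  shows "mob a b c d z - mob a b c d w =
    of_real (a * d - b * c) * (z - w) / ((of_real c * z + of_real d) * (of_real c * w + of_real d))"
  using mob_denom_nonzero[OF assms(1,2)] mob_denom_nonzero[OF assms(1,3)]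
  unfolding mob_def by (simp add: diff_frac_eq) (simp add: algebra_simps)

lemma Im_mob:
  assumes "0 < a * d - b * c" "0 < Im z"
  shows "Im (mob a b c d z) = (a * d - b * c) * Im z / (norm (of_real c * z + of_real d))\<^sup>2"
proof -
  have "Im (mob a b c d z) = ((a * d - b * c) * Im z) / (norm (of_real c * z + of_real d))\<^sup>2"
    unfolding mob_def Im_divide cmod_power2 by (simp add: algebra_simps)
  then show ?thesis .
qed

lemma mob_in_half_plane:
  assumes "0 < a * d - b * c" "z \<in> half_plane"
  shows "mob a b c d z \<in> half_plane"
  using assms mob_denom_nonzero[of a d b c z] by (simp add: Im_mob)

lemma mob_inverse:
  assumes "0 < a * d - b * c" "z \<in> half_plane"
  shows "mob d (- b) (- c) a (mob a b c d z) = z"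
proof -
  let ?q = "of_real c * z + of_real d :: complex" and ?p = "of_real a * z + of_real b :: complex"
  have q: "?q \<noteq> 0" using mob_denom_nonzero assms by auto
  have det: "of_real a * of_real d - of_real b * of_real c \<noteq> (0::complex)"
    using assms(1) by (metis less_irrefl of_real_0 of_real_diff of_real_eq_iff of_real_mult)
  have "mob d (- b) (- c) a (?p / ?q) =
    ((of_real d * ?p - of_real b * ?q) / ?q) / ((of_real a * ?q - of_real c * ?p) / ?q)"
    using q by (simp add: mob_def divide_simps)
  also have "\<dots> = (of_real d * ?p - of_real b * ?q) / (of_real a * ?q - of_real c * ?p)"
    using q by simp
  also have "of_real d * ?p - of_real b * ?q = (of_real a * of_real d - of_real b * of_real c) * z"
    by (simp add: algebra_simps)
  also have "of_real a * ?q - of_real c * ?p = of_real a * of_real d - of_real b * of_real c"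
    by (simp add: algebra_simps)
  finally show ?thesis using det by (simp add: mob_def)
qed

lemma mob_inverse':
  assumes "0 < a * d - b * c" "z \<in> half_plane"
  shows "mob a b c d (mob d (- b) (- c) a z) = z"
  using mob_inverse[of d a "- b" "- c" z] assms by (simp add: mult.commute)

lemma mob_has_field_derivative:
  assumes "0 < a * d - b * c" "z \<in> half_plane"
  shows "(mob a b c d has_field_derivative mob_deriv a b c d z) (at z)"
proof -
  have "of_real c * z + of_real d \<noteq> (0::complex)" using mob_denom_nonzero assms by auto
  then show ?thesis unfolding mob_def mob_deriv_def
    by (auto intro!: derivative_eq_intros simp: power2_eq_square divide_simps) (simp add: algebra_simps)
qed

lemma mob_plane_dist:
  assumes "0 < a * d - b * c" "z \<in> half_plane" "w \<in> half_plane"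
  shows "plane_dist Hyperbolic (mob a b c d z) (mob a b c d w) = plane_dist Hyperbolic z w"
proof -
  have zw: "0 < Im z" "0 < Im w" using assms by auto
  let ?q = "\<lambda>z. norm (of_real c * z + of_real d :: complex)"
  have q: "0 < ?q z" "0 < ?q w" using mob_denom_nonzero[OF assms(1)] zw by auto
  define D where "D = a * d - b * c"
  have dist: "dist (mob a b c d z) (mob a b c d w) = D * dist z w / (?q z * ?q w)"
    using assms(1) unfolding dist_norm mob_diff[OF assms(1) zw] D_def
    by (simp add: norm_mult norm_divide del: of_real_diff of_real_mult)
  have Im: "Im (mob a b c d z) = D * Im z / (?q z)\<^sup>2" "Im (mob a b c d w) = D * Im w / (?q w)\<^sup>2"
    unfolding D_def by (intro Im_mob assms zw)+
  have "(D * dist z w / (?q z * ?q w))\<^sup>2 * (Im z * Im w)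
      = (dist z w)\<^sup>2 * (D * Im z / (?q z)\<^sup>2 * (D * Im w / (?q w)\<^sup>2))"
    by (simp add: power_divide power_mult_distrib power2_eq_square[of D])
  then have "(dist (mob a b c d z) (mob a b c d w))\<^sup>2 * (plane_weight Hyperbolic z * plane_weight Hyperbolic w)
      = (dist z w)\<^sup>2 * (plane_weight Hyperbolic (mob a b c d z) * plane_weight Hyperbolic (mob a b c d w))"
    by (simp only: dist Im plane_weight.simps)
  then show ?thesis
    by (intro plane_dist_eq_iff[THEN iffD2] mob_in_half_plane assms)
qed

section \<open>The Cayley transform and the classification of half-plane automorphisms\<close>

definition cayley :: "complex \<Rightarrow> complex" where "cayley z = (z - \<i>) / (z + \<i>)"
definition cayley_inv :: "complex \<Rightarrow> complex" where "cayley_inv w = \<i> * (1 + w) / (1 - w)"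

lemma cayley_denom: "0 < Im z \<Longrightarrow> z + \<i> \<noteq> 0"
  by (metis add.inverse_inverse eq_neg_iff_add_eq_0 imaginary_unit.sel(2) less_irrefl neg_less_0_iff_less
      not_one_less_zero uminus_complex.sel(2) less_trans zero_less_one)

lemma cayley_in_ball: assumes "z \<in> half_plane" shows "norm (cayley z) < 1"
proof -
  have "(norm (z - \<i>))\<^sup>2 < (norm (z + \<i>))\<^sup>2"
    using assms unfolding cmod_power2 by (simp add: power2_eq_square algebra_simps)
  then have "norm (z - \<i>) < norm (z + \<i>)" by (rule power_less_imp_less_base) simp
  moreover from this have "0 < norm (z + \<i>)" using norm_ge_zero[of "z - \<i>"] by linarith
  ultimately show ?thesis by (simp add: cayley_def norm_divide)
qed

lemma cayley_inv_in_half_plane: assumes "norm w < 1" shows "cayley_inv w \<in> half_plane"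
proof -
  have "w \<noteq> 1" using assms by auto
  then have pos: "0 < (1 - Re w)\<^sup>2 + (Im w)\<^sup>2" by (simp add: complex_eq_iff sum_power2_gt_zero_iff)
  have "(norm w)\<^sup>2 < 1" using assms by (simp add: abs_square_less_1)
  moreover have "Im (cayley_inv w) = (1 - (norm w)\<^sup>2) / ((1 - Re w)\<^sup>2 + (Im w)\<^sup>2)"
    unfolding cayley_inv_def Im_divide cmod_power2 by (simp add: algebra_simps power2_eq_square)
  ultimately show ?thesis using pos by simp
qed

lemma cayley_inv_cayley: assumes "z \<in> half_plane" shows "cayley_inv (cayley z) = z"
proof -
  have nz: "z + \<i> \<noteq> 0" using cayley_denom assms by simp
  then have "1 + cayley z = 2 * z / (z + \<i>)" "1 - cayley z = 2 * \<i> / (z + \<i>)"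
    by (simp_all add: cayley_def add_divide_eq_iff eq_divide_eq diff_divide_eq_iff)
  then show ?thesis using nz by (simp add: cayley_inv_def)
qed

lemma cayley_cayley_inv: assumes "norm w < 1" shows "cayley (cayley_inv w) = w"
proof -
  have "1 - w \<noteq> 0" using assms by auto
  moreover have "cayley_inv w + \<i> \<noteq> 0"
    using cayley_denom cayley_inv_in_half_plane[OF assms] by simp
  ultimately show ?thesis by (simp add: cayley_def cayley_inv_def field_simps)
qed

lemma cayley_holomorphic: "cayley holomorphic_on half_plane"
  unfolding cayley_def using cayley_denom by (intro holomorphic_intros) auto

lemma cayley_inv_holomorphic: "cayley_inv holomorphic_on ball 0 1"
  unfolding cayley_inv_def by (intro holomorphic_intros) auto

text \<open>Schwarz's lemma for \<open>f\<close> and for its inverse gives equality of norms at one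
  nonzero point, and the equality case of the lemma is a rotation.\<close>

lemma disc_automorphism_fixing_0:
  assumes f: "f holomorphic_on ball 0 1" "f 0 = 0" "\<And>z. norm z < 1 \<Longrightarrow> norm (f z) < 1"
    and h: "h holomorphic_on ball 0 1" "h 0 = 0" "\<And>z. norm z < 1 \<Longrightarrow> norm (h z) < 1"
    and inv: "\<And>z. norm z < 1 \<Longrightarrow> h (f z) = z"
  obtains \<alpha> where "norm \<alpha> = 1" "\<And>z. norm z < 1 \<Longrightarrow> f z = \<alpha> * z"
proof -
  let ?z = "1/2 :: complex"
  have "norm (f ?z) \<le> norm ?z" by (rule Schwarz_Lemma[OF f]) auto
  moreover have "norm (h (f ?z)) \<le> norm (f ?z)" by (rule Schwarz_Lemma[OF h]) (use f(3) in auto)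
  ultimately have "norm (f ?z) = norm ?z" using inv[of ?z] by simp
  then have "\<exists>z. norm z < 1 \<and> z \<noteq> 0 \<and> norm (f z) = norm z" by (intro exI[of _ ?z]) simp
  then show ?thesis using Schwarz_Lemma(3)[OF f, of 0] that by auto
qed

text \<open>The affine map \<open>m\<close> brings \<open>f \<i>\<close> back to
  \<open>\<i>\<close>, so that the Cayley transform turns \<open>m \<circ> f\<close> into a disc
  automorphism fixing 0. The resulting rotation is transported back to the half-plane as the
  elliptic map \<open>R\<close>, and \<open>f\<close> is \<open>m'\<close> after
  \<open>R\<close>.\<close>

lemma half_plane_automorphism:
  assumes hol: "f holomorphic_on half_plane" and inj: "inj_on f half_plane" and im: "f ` half_plane = half_plane"
  obtains a b c d where "0 < a * d - b * c" "\<And>z. z \<in> half_plane \<Longrightarrow> f z = mob a b c d z"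
proof -
  obtain k where k: "k holomorphic_on half_plane" "\<And>z. z \<in> half_plane \<Longrightarrow> k (f z) = z"
    using holomorphic_has_inverse[OF hol open_plane inj] im by metis
  have f: "f z \<in> half_plane" if "z \<in> half_plane" for z using im that by blast
  have kH: "k z \<in> half_plane" if "z \<in> half_plane" for z using im k(2) that by (metis imageE)
  define x y where "x = Re (f \<i>)" and "y = Im (f \<i>)"
  have y: "0 < y" using f[of \<i>] by (simp add: y_def)
  define m where "m = mob 1 (- x) 0 y"
  define m' where "m' = mob y x 0 1"
  have m: "m z \<in> half_plane" "m' z \<in> half_plane" "m' (m z) = z" if "z \<in> half_plane" for z
    using y that mob_in_half_plane[of 1 y "- x" 0 z] mob_in_half_plane[of y 1 x 0 z] mob_inverse[of 1 y "-x" 0 z]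
    by (auto simp: m_def m'_def)
  have fi: "f \<i> = Complex x y" by (simp add: x_def y_def)
  have mf: "m (f \<i>) = \<i>" unfolding fi using y by (simp add: m_def mob_def complex_eq_iff Re_divide Im_divide power2_eq_square)
  have m'i: "m' \<i> = f \<i>" unfolding fi by (simp add: m'_def mob_def complex_eq_iff)
  have holm: "m holomorphic_on half_plane" "m' holomorphic_on half_plane"
    unfolding m_def m'_def mob_def using y by (auto intro!: holomorphic_intros)
  define F where "F = cayley \<circ> m \<circ> f \<circ> cayley_inv"
  define G where "G = cayley \<circ> k \<circ> m' \<circ> cayley_inv"
  have ci: "cayley_inv ` ball 0 1 \<subseteq> half_plane" using cayley_inv_in_half_plane by auto
  have "F holomorphic_on ball 0 1" unfolding F_def
    by (intro holomorphic_on_compose cayley_inv_holomorphic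
        holomorphic_on_subset[OF hol] holomorphic_on_subset[OF holm(1)] holomorphic_on_subset[OF cayley_holomorphic])
      (use ci f m in auto)
  moreover have "G holomorphic_on ball 0 1" unfolding G_def
    by (intro holomorphic_on_compose cayley_inv_holomorphic
        holomorphic_on_subset[OF k(1)] holomorphic_on_subset[OF holm(2)] holomorphic_on_subset[OF cayley_holomorphic])
      (use ci kH m in auto)
  moreover have "F 0 = 0" "G 0 = 0" using mf m'i k(2)[of \<i>]
    by (auto simp: F_def G_def cayley_inv_def cayley_def)
  moreover have "norm (F z) < 1" "norm (G z) < 1" if "norm z < 1" for z
    using cayley_in_ball cayley_inv_in_half_plane[OF that] m f kH by (simp_all add: F_def G_def)
  moreover have "G (F z) = z" if z: "norm z < 1" for z
  proof -
    have c: "cayley_inv z \<in> half_plane" by (rule cayley_inv_in_half_plane[OF z])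
    then have "cayley_inv (cayley (m (f (cayley_inv z)))) = m (f (cayley_inv z))"
      by (intro cayley_inv_cayley m f)
    then have "G (F z) = cayley (k (m' (m (f (cayley_inv z)))))" by (simp add: F_def G_def)
    also have "\<dots> = z" using c f m k cayley_cayley_inv[OF z] by simp
    finally show ?thesis .
  qed
  ultimately obtain \<alpha> where \<alpha>: "norm \<alpha> = 1" "\<And>z. norm z < 1 \<Longrightarrow> F z = \<alpha> * z"
    using disc_automorphism_fixing_0[of F G] by blast
  \<comment> \<open>Half the argument, because a rotation matrix of angle \<phi> acts in the disc as
    multiplication by \<open>cis \<phi> / cis (- \<phi>)\<close>.\<close>
  define \<phi> where "\<phi> = Arg \<alpha> / 2"
  have cis: "\<alpha> = cis \<phi> * cis \<phi>"
  proof -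
    have "\<alpha> = cis (Arg \<alpha>)" using \<alpha>(1) Arg_eq[of \<alpha>] by (cases "\<alpha> = 0") (auto simp: cis_conv_exp)
    then show ?thesis by (simp add: \<phi>_def cis_mult)
  qed
  define R where "R = mob (cos \<phi>) (sin \<phi>) (- sin \<phi>) (cos \<phi>)"
  have detR: "0 < cos \<phi> * cos \<phi> - sin \<phi> * (- sin \<phi>)"
    using sin_cos_squared_add3[of \<phi>] by (simp add: algebra_simps)
  have cR: "cayley (R z) = \<alpha> * cayley z" if z: "z \<in> half_plane" for z
  proof -
    let ?q = "of_real (- sin \<phi>) * z + of_real (cos \<phi>) :: complex"
    have q: "?q \<noteq> 0" using mob_denom_nonzero[OF detR] z by auto
    let ?p = "of_real (cos \<phi>) * z + of_real (sin \<phi>) :: complex"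
    have pq: "?p - \<i> * ?q = cis \<phi> * (z - \<i>)" "?p + \<i> * ?q = cis (- \<phi>) * (z + \<i>)"
      by (simp_all add: complex_eq_iff algebra_simps del: of_real_minus)
    have "R z - \<i> = (?p - \<i> * ?q) / ?q" "R z + \<i> = (?p + \<i> * ?q) / ?q"
      using diff_divide_eq_iff[OF q, of ?p \<i>] add_divide_eq_iff[OF q, of \<i> ?p]
        divide_diff_eq_iff[OF q, of ?p \<i>] divide_add_eq_iff[OF q, of ?p \<i>]
      by (simp_all only: R_def mob_def mult.commute)
    then have "R z - \<i> = cis \<phi> * (z - \<i>) / ?q" "R z + \<i> = cis (- \<phi>) * (z + \<i>) / ?q"
      unfolding pq .
    then have "cayley (R z) = cis \<phi> * (z - \<i>) / (cis (- \<phi>) * (z + \<i>))" using q by (simp add: cayley_def)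
    also have "cis (- \<phi>) = inverse (cis \<phi>)" by simp
    also have "cis \<phi> * (z - \<i>) / (inverse (cis \<phi>) * (z + \<i>)) = \<alpha> * cayley z"
      unfolding cis cayley_def divide_inverse inverse_mult_distrib inverse_inverse_eq by (simp only: mult_ac)
    finally show ?thesis .
  qed
  have "f z = mob (y * cos \<phi> - x * sin \<phi>) (y * sin \<phi> + x * cos \<phi>) (- sin \<phi>) (cos \<phi>) z"
    if z: "z \<in> half_plane" for z
  proof -
    let ?q = "of_real (- sin \<phi>) * z + of_real (cos \<phi>) :: complex"
    have q: "?q \<noteq> 0" using mob_denom_nonzero[OF detR] z by auto
    have Rz: "R z \<in> half_plane" unfolding R_def by (rule mob_in_half_plane[OF detR z])
    have "cayley (m (f z)) = F (cayley z)" using cayley_inv_cayley[OF z] by (simp add: F_def)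
    also have "\<dots> = cayley (R z)" using \<alpha>(2) cayley_in_ball z cR by simp
    finally have "m (f z) = R z"
      using cayley_inv_cayley[of "m (f z)"] cayley_inv_cayley[OF Rz] m(1)[OF f[OF z]] by simp
    then have "f z = m' (R z)" using m(3)[OF f[OF z]] by simp
    also have "\<dots> = (of_real y * (of_real (cos \<phi>) * z + of_real (sin \<phi>)) + of_real x * ?q) / ?q"
      using q by (simp add: m'_def R_def mob_def add_divide_distrib distrib_left)
    also have "\<dots> = mob (y * cos \<phi> - x * sin \<phi>) (y * sin \<phi> + x * cos \<phi>) (- sin \<phi>) (cos \<phi>) z"
      unfolding mob_def by (simp add: algebra_simps)
    finally show ?thesis .
  qed
  moreover have "(y * cos \<phi> - x * sin \<phi>) * cos \<phi> - (y * sin \<phi> + x * cos \<phi>) * (- sin \<phi>)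
      = y * (cos \<phi> * cos \<phi> + sin \<phi> * sin \<phi>)" by algebra
  ultimately show ?thesis
    using y by (intro that[of "y * cos \<phi> - x * sin \<phi>" "cos \<phi>" "y * sin \<phi> + x * cos \<phi>" "- sin \<phi>"])
      (simp_all only: sin_cos_squared_add3 mult_1_right)
qed


text \<open>Fixed points are the roots of \<open>c * z^2 + (d - a) * z - b\<close>, with
  discriminant \<open>(d - a)^2 + 4 * b * c\<close>. Two non-real roots would give a fixed point in
  the half-plane. Otherwise a real Moebius map sends a double root to infinity, or two roots to 0
  and infinity; when \<open>c = 0\<close>, infinity is fixed already.\<close>

lemma mob_normal_form:
  assumes det: "0 < a * d - b * c" and T: "\<And>z. z \<in> half_plane \<Longrightarrow> T z = mob a b c d z"
    and nofix: "\<And>z. z \<in> half_plane \<Longrightarrow> T z \<noteq> z"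
  obtains (translation) k l m n \<nu> where "0 < k * n - l * m" "\<nu> \<noteq> 0"
      "\<And>z. z \<in> half_plane \<Longrightarrow> mob k l m n (T z) = mob k l m n z + of_real \<nu>"
    | (dilation) k l m n \<mu> where "0 < k * n - l * m" "0 < \<mu>" "\<mu> \<noteq> 1"
      "\<And>z. z \<in> half_plane \<Longrightarrow> mob k l m n (T z) = of_real \<mu> * mob k l m n z"
proof -
  have q: "of_real c * z + of_real d \<noteq> (0::complex)" if "z \<in> half_plane" for z
    using mob_denom_nonzero[OF det] that by auto
  have nfx: "of_real c * z\<^sup>2 + of_real (d - a) * z - of_real b \<noteq> 0" if z: "z \<in> half_plane" for z
  proof
    assume "of_real c * z\<^sup>2 + of_real (d - a) * z - of_real b = 0"
    then have "of_real a * z + of_real b = z * (of_real c * z + of_real d)"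
      by (simp add: power2_eq_square algebra_simps)
    then have "T z = z" using q[OF z] T[OF z] by (simp add: mob_def)
    then show False using nofix z by blast
  qed
  consider "c = 0" | "c \<noteq> 0" "(d - a)\<^sup>2 + 4 * b * c < 0" | "c \<noteq> 0" "(d - a)\<^sup>2 + 4 * b * c = 0"
    | "c \<noteq> 0" "(d - a)\<^sup>2 + 4 * b * c > 0" by linarith
  then show ?thesis
  proof cases
    case 1
    then have ad: "0 < a * d" using det by simp
    then have d: "d \<noteq> 0" and a: "a \<noteq> 0" by auto
    have Tz: "T z = of_real (a / d) * z + of_real (b / d)" if "z \<in> half_plane" for z
      using T[OF that] 1 d by (simp add: mob_def add_divide_distrib)
    show ?thesis
    proof (cases "a = d")
      case True
      have "b \<noteq> 0" using nfx[of \<i>] 1 True by auto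
      then show ?thesis using d Tz True
        by (intro translation[of 1 1 0 0 "b / d"]) (auto simp: mob_def)
    next
      case False
      have "0 < a / d" using ad by (simp add: zero_less_divide_iff zero_less_mult_iff)
      \<comment> \<open>\<open>x\<close> is the finite fixed point of the affine map with slope
        \<mu>; moving it to 0 leaves a pure dilation.\<close>
      moreover define \<mu> \<beta> x where "\<mu> = a / d" and "\<beta> = b / d" and "x = b / (d - a)"
      have "mob 1 (- x) 0 1 (T z) = of_real \<mu> * mob 1 (- x) 0 1 z" if "z \<in> half_plane" for z
      proof -
        have "x - \<mu> * x = (d - a) / d * x"
          using d by (simp add: \<mu>_def diff_divide_distrib left_diff_distrib)
        also have "\<dots> = \<beta>" using False by (simp add: x_def \<beta>_def)
        finally have "of_real \<beta> = (of_real x - of_real \<mu> * of_real x :: complex)"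
          by (metis of_real_diff of_real_mult)
        then show ?thesis unfolding Tz[OF that, folded \<mu>_def \<beta>_def] mob_def by (simp add: algebra_simps)
      qed
      ultimately show ?thesis using False d
        by (intro dilation[of 1 1 "- x" 0 \<mu>]) (auto simp: \<mu>_def)
    qed
  next
    case 2
    define D where "D = sqrt (- ((d - a)\<^sup>2 + 4 * b * c)) / (2 * \<bar>c\<bar>)"
    have D: "0 < D" "D\<^sup>2 = - ((d - a)\<^sup>2 + 4 * b * c) / (4 * c\<^sup>2)"
      using 2 by (simp_all add: D_def power_divide power_mult_distrib)
    \<comment> \<open>Of the two conjugate roots, the one in the half-plane.\<close>
    define z where "z = Complex ((a - d) / (2 * c)) D"
    have "c * (((a - d) / (2 * c))\<^sup>2 - D\<^sup>2) + (d - a) * ((a - d) / (2 * c)) - b = 0"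
      unfolding D using 2 by (simp add: field_simps power2_eq_square)
    then have "of_real c * z\<^sup>2 + of_real (d - a) * z - of_real b = 0"
      using 2 by (simp add: complex_eq_iff z_def Re_power2 Im_power2) (simp add: diff_divide_distrib left_diff_distrib)
    then show ?thesis using nfx[of z] D by (simp add: z_def)
  next
    case 3
    \<comment> \<open>\<open>x\<close> is the double root and \<open>m\<close> half the trace; with
      vanishing discriminant the square of \<open>m\<close> is the determinant.\<close>
    define x m where "x = (a - d) / (2 * c)" and "m = (a + d) / 2"
    have cx: "a - c * x = m" "c * x + d = m" using 3 by (simp_all add: x_def m_def field_simps)
    have "(d - a)\<^sup>2 = - (4 * b * c)" using 3 by simp
    then have b: "b = - ((d - a)\<^sup>2) / (4 * c)" using 3(1) by simp
    have "x * (d - m) = - ((d - a)\<^sup>2) / (4 * c)"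
      using 3(1) by (simp add: x_def m_def field_simps power2_eq_square)
    then have fx: "b - x * d = - x * m" unfolding b[symmetric] by (simp add: algebra_simps)
    have "4 * m\<^sup>2 = (d - a)\<^sup>2 + 4 * a * d" by (simp add: m_def field_simps power2_eq_square)
    then have "m\<^sup>2 = a * d - b * c" using 3(2) by simp
    then have m: "m \<noteq> 0" using det by auto
    \<comment> \<open>The map \<open>- 1 / (z - x)\<close> sends the fixed point to infinity; the
      minus sign makes its determinant positive.\<close>
    have "mob 0 (- 1) 1 (- x) (T z) = mob 0 (- 1) 1 (- x) z + of_real (- c / m)" if z: "z \<in> half_plane" for z
    proof -
      have zx: "z - of_real x \<noteq> 0" using z by (auto simp: complex_eq_iff)
      let ?q = "of_real c * z + of_real d :: complex"
      have "T z - of_real x = (of_real a * z + of_real b - of_real x * ?q) / ?q"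
        unfolding T[OF z] mob_def using q[OF z] by (simp add: diff_divide_distrib)
      also have "of_real a * z + of_real b - of_real x * ?q = of_real (a - c * x) * z + of_real (b - x * d)"
        by (simp add: algebra_simps)
      also have "\<dots> = of_real m * (z - of_real x)" unfolding cx fx by (simp add: algebra_simps)
      finally have "mob 0 (- 1) 1 (- x) (T z) = - ?q / (of_real m * (z - of_real x))"
        by (simp add: mob_def)
      also have "?q = of_real c * (z - of_real x) + of_real m" unfolding cx(2)[symmetric] by (simp add: algebra_simps)
      also have "- (of_real c * (z - of_real x) + of_real m) / (of_real m * (z - of_real x))
          = mob 0 (- 1) 1 (- x) z + of_real (- c / m)"
        using zx m by (simp add: mob_def field_simps)
      finally show ?thesis .
    qed
    then show ?thesis using m 3 by (intro translation[of 0 "- x" "- 1" 1 "- c / m"]) auto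
  next
    case 4
    define D where "D = sqrt ((d - a)\<^sup>2 + 4 * b * c)"
    have D: "0 < D" "D\<^sup>2 = (d - a)\<^sup>2 + 4 * b * c" using 4 by (simp_all add: D_def)
    \<comment> \<open>The absolute value ensures \<open>y < x\<close> for either sign of
      \<open>c\<close>, and \<open>x - y\<close> is the determinant of the map below that sends
      \<open>x\<close> to 0 and \<open>y\<close> to infinity.\<close>
    define x y where "x = (a - d) / (2 * c) + D / (2 * \<bar>c\<bar>)" and "y = (a - d) / (2 * c) - D / (2 * \<bar>c\<bar>)"
    have xy: "y < x" using D 4 by (simp add: x_def y_def)
    have root: "c * ((a - d) / (2 * c) + s)\<^sup>2 + (d - a) * ((a - d) / (2 * c) + s) - b = 0"
      if "s\<^sup>2 = D\<^sup>2 / (4 * c\<^sup>2)" for s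
    proof -
      have "c * ((a - d) / (2 * c) + s)\<^sup>2 + (d - a) * ((a - d) / (2 * c) + s) - b
          = c * s\<^sup>2 - (d - a)\<^sup>2 / (4 * c) - b" using 4 by (simp add: field_simps power2_eq_square)
      also have "\<dots> = 0" unfolding that D using 4 by (simp add: field_simps power2_eq_square)
      finally show ?thesis .
    qed
    have fx: "b - x * d = - x * (a - c * x)" "b - y * d = - y * (a - c * y)"
    proof -
      have s: "(D / (2 * \<bar>c\<bar>))\<^sup>2 = D\<^sup>2 / (4 * c\<^sup>2)" by (simp add: power_divide power_mult_distrib)
      have "c * x\<^sup>2 + (d - a) * x - b = 0" unfolding x_def by (rule root[OF s])
      then show "b - x * d = - x * (a - c * x)" by (simp add: algebra_simps power2_eq_square)
      have "c * y\<^sup>2 + (d - a) * y - b = 0"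
        using root[of "- (D / (2 * \<bar>c\<bar>))"] s by (simp add: y_def)
      then show "b - y * d = - y * (a - c * y)" by (simp add: algebra_simps power2_eq_square)
    qed
    \<comment> \<open>The factors that \<open>T\<close> puts on \<open>z - x\<close> and
      \<open>z - y\<close>, up to the common denominator. By Vieta's formulas their product is the
      determinant, so the multiplier \<open>u / v\<close> is positive.\<close>
    define u v where "u = a - c * x" and "v = a - c * y"
    have "u * v = a * d - b * c"
    proof -
      have "x + y = (a - d) / c" by (simp add: x_def y_def)
      then have s: "c * (x + y) = a - d" using 4 by simp
      have "c * (x * y) = x * (c * (x + y)) - c * x\<^sup>2" by (simp add: algebra_simps power2_eq_square)
      also have "\<dots> = - b" unfolding s using fx(1) by (simp add: algebra_simps power2_eq_square)
      finally have p: "c * (x * y) = - b" .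
      have "u * v = a * a - a * (c * (x + y)) + c * (c * (x * y))" by (simp add: u_def v_def algebra_simps)
      then show ?thesis unfolding s p by (simp add: algebra_simps)
    qed
    then have uv: "0 < u * v" "u \<noteq> 0" "v \<noteq> 0" using det by auto
    have "mob 1 (- x) 1 (- y) (T z) = of_real (u / v) * mob 1 (- x) 1 (- y) z" if z: "z \<in> half_plane" for z
    proof -
      have zy: "z - of_real y \<noteq> 0" using z by (auto simp: complex_eq_iff)
      let ?q = "of_real c * z + of_real d :: complex"
      have sh: "T z - of_real t = of_real (a - c * t) * (z - of_real t) / ?q"
        if "b - t * d = - t * (a - c * t)" for t
      proof -
        have "T z - of_real t = (of_real a * z + of_real b - of_real t * ?q) / ?q"
          unfolding T[OF z] mob_def using q[OF z] by (simp add: diff_divide_distrib)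
        also have "of_real a * z + of_real b - of_real t * ?q = of_real (a - c * t) * z + of_real (b - t * d)"
          by (simp add: algebra_simps)
        also have "\<dots> = of_real (a - c * t) * (z - of_real t)" unfolding that by (simp add: algebra_simps)
        finally show ?thesis .
      qed
      have "mob 1 (- x) 1 (- y) (T z) = (T z - of_real x) / (T z - of_real y)" by (simp add: mob_def)
      also have "\<dots> = of_real (u / v) * mob 1 (- x) 1 (- y) z"
        unfolding sh[OF fx(1)] sh[OF fx(2)] u_def[symmetric] v_def[symmetric]
        using q[OF z] by (simp add: mob_def)
      finally show ?thesis .
    qed
    moreover have "0 < u / v" using uv by (simp add: zero_less_divide_iff zero_less_mult_iff)
    moreover have "u / v \<noteq> 1" using uv xy 4 by (simp add: u_def v_def)
    ultimately show ?thesis using xy by (intro dilation[of 1 "- y" "- x" 1 "u / v"]) auto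
  qed
qed


section \<open>Flows of isometries\<close>

lemma isometry_flow_plane:
  "isometry_flow g T \<phi> X \<Longrightarrow> z \<in> plane g \<Longrightarrow> \<phi> s z \<in> plane g"
  unfolding isometry_flow_def plane_isometry_def by blast

lemma isometry_flow_dist:
  "isometry_flow g T \<phi> X \<Longrightarrow> z \<in> plane g \<Longrightarrow> w \<in> plane g \<Longrightarrow>
    plane_dist g (\<phi> s z) (\<phi> s w) = plane_dist g z w"
  unfolding isometry_flow_def plane_isometry_def by blast

lemma isometry_flow_add:
  "isometry_flow g T \<phi> X \<Longrightarrow> z \<in> plane g \<Longrightarrow> \<phi> (s + t) z = \<phi> s (\<phi> t z)"
  unfolding isometry_flow_def by blast

lemma isometry_flow_1: "isometry_flow g T \<phi> X \<Longrightarrow> z \<in> plane g \<Longrightarrow> \<phi> 1 z = T z"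
  unfolding isometry_flow_def by blast

text \<open>The group law gives only that \<open>\<phi> 0\<close> is idempotent; since it preserves
  distances, the distance from \<open>\<phi> 0 z\<close> to \<open>z\<close> equals that between
  their images, which is 0.\<close>

lemma isometry_flow_0:
  assumes "isometry_flow g T \<phi> X" "z \<in> plane g"
  shows "\<phi> 0 z = z"
proof -
  have "\<phi> 0 z \<in> plane g" using assms by (rule isometry_flow_plane)
  moreover have "\<phi> 0 (\<phi> 0 z) = \<phi> 0 z" using isometry_flow_add[OF assms, of 0 0] by simp
  then have "plane_dist g (\<phi> 0 z) z = plane_dist g (\<phi> 0 z) (\<phi> 0 z)"
    using isometry_flow_dist[OF assms(1) calculation assms(2), of 0] by simp
  ultimately show ?thesis
    using plane_dist_eq_iff[of "\<phi> 0 z" g z "\<phi> 0 z" "\<phi> 0 z"] assms(2) plane_weight_pos[of "\<phi> 0 z" g] by auto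
qed

lemma isometry_flow_deriv_0:
  "isometry_flow g T \<phi> X \<Longrightarrow> z \<in> plane g \<Longrightarrow> ((\<lambda>s. \<phi> s z) has_vector_derivative X z) (at 0)"
  unfolding isometry_flow_def by blast

lemma isometry_flow_deriv:
  assumes "isometry_flow g T \<phi> X" "z \<in> plane g"
  shows "((\<lambda>s. \<phi> s z) has_vector_derivative X (\<phi> s z)) (at s)"
proof -
  have "((\<lambda>h. \<phi> h (\<phi> s z)) has_vector_derivative X (\<phi> s z)) (at 0)"
    by (intro isometry_flow_deriv_0[OF assms(1)] isometry_flow_plane[OF assms])
  then have "((\<lambda>h. \<phi> h (\<phi> s z)) has_vector_derivative X (\<phi> s z)) (at (s - s))" by simp
  moreover have "((\<lambda>x. x - s) has_vector_derivative 1) (at s)"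
    using has_vector_derivative_diff[OF has_vector_derivative_id has_vector_derivative_const] by simp
  ultimately have "((\<lambda>h. \<phi> h (\<phi> s z)) \<circ> (\<lambda>x. x - s) has_vector_derivative 1 *\<^sub>R X (\<phi> s z)) (at s)"
    by (intro vector_diff_chain_at)
  moreover have "\<phi> (x - s) (\<phi> s z) = \<phi> x z" for x
    using isometry_flow_add[OF assms, of "x - s" s] by simp
  ultimately show ?thesis by (simp add: o_def)
qed

lemma mob_image: "0 < a * d - b * c \<Longrightarrow> mob a b c d ` half_plane = half_plane"
proof (intro equalityI subsetI)
  fix z assume det: "0 < a * d - b * c" and z: "z \<in> half_plane"
  have "mob d (- b) (- c) a z \<in> half_plane" using det z by (intro mob_in_half_plane) (simp add: mult.commute)
  then show "z \<in> mob a b c d ` half_plane" using mob_inverse'[OF det z] by (metis imageI)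
next
  fix z assume "0 < a * d - b * c" "z \<in> mob a b c d ` half_plane"
  then show "z \<in> half_plane" using mob_in_half_plane by blast
qed

lemma plane_isometry_mob: "0 < a * d - b * c \<Longrightarrow> plane_isometry Hyperbolic (mob a b c d)"
  unfolding plane_isometry_def using mob_image mob_plane_dist by blast

lemma isometry_flow_translation:
  assumes "\<And>z. z \<in> plane g \<Longrightarrow> T z = z + \<nu>" and "g = Hyperbolic \<Longrightarrow> Im \<nu> = 0"
  shows "isometry_flow g T (\<lambda>s z. z + of_real s * \<nu>) (\<lambda>_. \<nu>)"
proof -
  have "plane_isometry g (\<lambda>z. z + of_real s * \<nu>)" for s
  proof (cases g)
    case Euclidean
    then show ?thesis by (auto simp: plane_isometry_def dist_norm intro!: surj_plus_right)
  next
    case Hyperbolic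
    then have "\<nu> = of_real (Re \<nu>)" using assms(2) by (simp add: complex_eq_iff)
    then have "(\<lambda>z. z + of_real s * \<nu>) = mob 1 (s * Re \<nu>) 0 1"
      by (simp add: fun_eq_iff mob_def)
    then show ?thesis using plane_isometry_mob[of 1 1 "s * Re \<nu>" 0] Hyperbolic by simp
  qed
  moreover have "((\<lambda>s. z + of_real s * \<nu>) has_vector_derivative \<nu>) (at 0)" for z
    by (auto intro!: derivative_eq_intros simp: has_vector_derivative_def scaleR_conv_of_real)
  ultimately show ?thesis using assms unfolding isometry_flow_def by (auto simp: algebra_simps)
qed

lemma isometry_flow_dilation:
  assumes "\<And>z. z \<in> half_plane \<Longrightarrow> T z = of_real \<mu> * z" and "0 < \<mu>"
  shows "isometry_flow Hyperbolic T (\<lambda>s z. of_real (exp (s * ln \<mu>)) * z) (\<lambda>z. of_real (ln \<mu>) * z)"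
proof -
  have "plane_isometry Hyperbolic (\<lambda>z. of_real (exp (s * ln \<mu>)) * z)" for s
  proof -
    have "(\<lambda>z. of_real (exp (s * ln \<mu>)) * z) = mob (exp (s * ln \<mu>)) 0 0 1"
      by (simp add: fun_eq_iff mob_def)
    then show ?thesis using plane_isometry_mob[of "exp (s * ln \<mu>)" 1 0 0] by simp
  qed
  moreover have "((\<lambda>s. of_real (exp (s * ln \<mu>)) * z) has_vector_derivative of_real (ln \<mu>) * z) (at 0)" for z :: complex
  proof -
    have "((\<lambda>s. exp (s * ln \<mu>)) has_real_derivative ln \<mu>) (at 0)"
      by (auto intro!: derivative_eq_intros)
    from has_vector_derivative_mult_left[OF has_vector_derivative_of_real[OF this]]
    show ?thesis .
  qed
  ultimately show ?thesis using assms unfolding isometry_flow_def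
    by (auto simp: distrib_right exp_add mult.assoc)
qed

text \<open>Carries a flow to the normal form of \<open>T\<close> and back; the field is pushed
  forward by the derivative of the Moebius map.\<close>

lemma isometry_flow_conj:
  assumes flow: "isometry_flow Hyperbolic T \<phi> X" and det: "0 < k * n - l * m"
    and T': "\<And>z. z \<in> half_plane \<Longrightarrow> T' (mob k l m n z) = mob k l m n (T z)"
  defines "N' \<equiv> mob n (- l) (- m) k"
  shows "isometry_flow Hyperbolic T' (\<lambda>s w. mob k l m n (\<phi> s (N' w)))
    (\<lambda>w. X (N' w) * mob_deriv k l m n (N' w))"
proof -
  let ?N = "mob k l m n"
  have det': "0 < n * k - (- l) * (- m)" using det by (simp add: mult.commute)
  have N'H: "N' w \<in> half_plane" if "w \<in> half_plane" for w
    unfolding N'_def by (rule mob_in_half_plane[OF det' that])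
  have N'N: "N' (?N z) = z" if "z \<in> half_plane" for z
    unfolding N'_def by (rule mob_inverse[OF det that])
  have NN': "?N (N' z) = z" if "z \<in> half_plane" for z
    unfolding N'_def by (rule mob_inverse'[OF det that])
  have \<phi>H: "\<phi> s (N' w) \<in> half_plane" if "w \<in> half_plane" for s w
    by (intro isometry_flow_plane[OF flow] N'H that)
  have img: "\<phi> s ` half_plane = half_plane" for s
    using flow unfolding isometry_flow_def plane_isometry_def by blast
  have "plane_isometry Hyperbolic (\<lambda>w. ?N (\<phi> s (N' w)))" for s
    unfolding plane_isometry_def
  proof (intro conjI ballI)
    have "(\<lambda>w. ?N (\<phi> s (N' w))) ` half_plane = ?N ` \<phi> s ` N' ` half_plane" by (simp only: image_image)
    also have "\<dots> = half_plane" using mob_image[OF det'] mob_image[OF det] img by (simp only: N'_def)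
    finally show "(\<lambda>w. ?N (\<phi> s (N' w))) ` half_plane = half_plane" .
    fix z w assume zw: "z \<in> half_plane" "w \<in> half_plane"
    have "plane_dist Hyperbolic (?N (\<phi> s (N' z))) (?N (\<phi> s (N' w))) = plane_dist Hyperbolic (\<phi> s (N' z)) (\<phi> s (N' w))"
      by (intro mob_plane_dist det \<phi>H zw)
    also have "\<dots> = plane_dist Hyperbolic (N' z) (N' w)"
      by (intro isometry_flow_dist[OF flow] N'H zw)
    also have "\<dots> = plane_dist Hyperbolic z w"
      unfolding N'_def by (intro mob_plane_dist det' zw)
    finally show "plane_dist Hyperbolic (?N (\<phi> s (N' z))) (?N (\<phi> s (N' w))) = plane_dist Hyperbolic z w" .
  qed
  moreover have "?N (\<phi> (s + t) (N' z)) = ?N (\<phi> s (N' (?N (\<phi> t (N' z)))))" if "z \<in> half_plane" for s t z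
    using isometry_flow_add[OF flow N'H[OF that]] N'N[OF \<phi>H[OF that]] by simp
  moreover have "?N (\<phi> 1 (N' z)) = T' z" if "z \<in> half_plane" for z
    using isometry_flow_1[OF flow N'H[OF that]] T'[OF N'H[OF that]] NN'[OF that] by simp
  moreover have "((\<lambda>s. ?N (\<phi> s (N' z))) has_vector_derivative X (N' z) * mob_deriv k l m n (N' z)) (at 0)"
    if "z \<in> half_plane" for z
  proof -
    have "(?N has_field_derivative mob_deriv k l m n (N' z)) (at (\<phi> 0 (N' z)))"
      using mob_has_field_derivative[OF det N'H[OF that]] isometry_flow_0[OF flow N'H[OF that]] by simp
    from field_vector_diff_chain_at[OF isometry_flow_deriv_0[OF flow N'H[OF that]] this]
    show ?thesis by (simp add: o_def)
  qed
  ultimately show ?thesis unfolding isometry_flow_def by blast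
qed

text \<open>The Killing equation in integrated form: both sides are the derivatives at time \<open>0\<close> of the
  two sides of the equation expressing that the hyperbolic distance of \<open>\<phi> s z\<close> and \<open>\<phi> s w\<close> is constant.\<close>

lemma isometry_flow_killing:
  assumes flow: "isometry_flow Hyperbolic T \<phi> X" and z: "z \<in> half_plane" and w: "w \<in> half_plane"
  shows "2 * Re ((X z - X w) * cnj (z - w)) * (Im z * Im w)
    = (norm (z - w))\<^sup>2 * (Im (X z) * Im w + Im z * Im (X w))"
proof -
  let ?a = "\<lambda>s. \<phi> s z" and ?b = "\<lambda>s. \<phi> s w"
  have eq: "(norm (?a s - ?b s))\<^sup>2 * (Im z * Im w) = (norm (z - w))\<^sup>2 * (Im (?a s) * Im (?b s))" for s
    using plane_dist_eq_iff[of "?a s" Hyperbolic "?b s" z w] isometry_flow_dist[OF flow z w, of s]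
      isometry_flow_plane[OF flow z, of s] isometry_flow_plane[OF flow w, of s] z w
    by (simp add: dist_norm)
  have a: "(?a has_vector_derivative X z) (at 0)" and b: "(?b has_vector_derivative X w) (at 0)"
    by (rule isometry_flow_deriv_0[OF flow], fact)+
  have Re: "((\<lambda>s. Re (f s)) has_real_derivative Re D) (at 0)"
    and Im: "((\<lambda>s. Im (f s)) has_real_derivative Im D) (at 0)"
    if "(f has_vector_derivative D) (at 0)" for f D
    using that bounded_linear.has_vector_derivative[OF bounded_linear_Re that]
      bounded_linear.has_vector_derivative[OF bounded_linear_Im that]
    by (simp_all add: has_real_derivative_iff_has_vector_derivative)
  define x1 y1 x2 y2 where "x1 = (\<lambda>s. Re (?a s))" and "y1 = (\<lambda>s. Im (?a s))"
    and "x2 = (\<lambda>s. Re (?b s))" and "y2 = (\<lambda>s. Im (?b s))"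
  have D: "(x1 has_real_derivative Re (X z)) (at 0)" "(y1 has_real_derivative Im (X z)) (at 0)"
    "(x2 has_real_derivative Re (X w)) (at 0)" "(y2 has_real_derivative Im (X w)) (at 0)"
    unfolding x1_def y1_def x2_def y2_def by (intro Re Im a b)+
  have 0: "x1 0 = Re z" "y1 0 = Im z" "x2 0 = Re w" "y2 0 = Im w"
    using isometry_flow_0[OF flow] z w by (auto simp: x1_def y1_def x2_def y2_def)
  have L: "((\<lambda>s. ((x1 s - x2 s)\<^sup>2 + (y1 s - y2 s)\<^sup>2) * (Im z * Im w)) has_real_derivative
      2 * Re ((X z - X w) * cnj (z - w)) * (Im z * Im w)) (at 0)"
    by (auto intro!: derivative_eq_intros D simp: 0 algebra_simps)
  have R: "((\<lambda>s. (norm (z - w))\<^sup>2 * (y1 s * y2 s)) has_real_derivative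
      (norm (z - w))\<^sup>2 * (Im (X z) * Im w + Im z * Im (X w))) (at 0)"
    by (auto intro!: derivative_eq_intros D simp: 0 algebra_simps)
  have "((x1 s - x2 s)\<^sup>2 + (y1 s - y2 s)\<^sup>2) * (Im z * Im w) = (norm (z - w))\<^sup>2 * (y1 s * y2 s)" for s
    using eq[of s] unfolding cmod_power2[of "?a s - ?b s"] by (simp add: x1_def x2_def y1_def y2_def)
  from DERIV_unique[OF L[unfolded this] R] show ?thesis .
qed

lemma isometry_flow_commute:
  assumes flow: "isometry_flow g T \<phi> X" and z: "z \<in> plane g"
  shows "\<phi> s (T z) = T (\<phi> s z)"
  using isometry_flow_add[OF flow z, of s 1] isometry_flow_add[OF flow z, of 1 s]
    isometry_flow_1[OF flow z] isometry_flow_1[OF flow isometry_flow_plane[OF flow z]]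
  by (simp add: add.commute)

lemma isometry_flow_field_translation:
  assumes flow: "isometry_flow g T \<phi> X" and X: "\<And>z. z \<in> plane g \<Longrightarrow> X z = k"
    and z: "z \<in> plane g"
  shows "T z = z + k"
proof -
  have "((\<lambda>s. \<phi> s z - of_real s * k) has_vector_derivative 0) (at s)" for s
  proof -
    have "((\<lambda>s. of_real s * k) has_vector_derivative k) (at s)"
      by (auto intro!: derivative_eq_intros simp: has_vector_derivative_def scaleR_conv_of_real)
    from has_vector_derivative_diff[OF isometry_flow_deriv[OF flow z] this]
    show ?thesis using X[OF isometry_flow_plane[OF flow z]] by simp
  qed
  then have "((\<lambda>s. \<phi> s z - of_real s * k) has_derivative (\<lambda>_. 0)) (at s within UNIV)" for s
    by (simp add: has_vector_derivative_def)
  from has_derivative_zero_unique[OF convex_UNIV this, of 0 1]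
  have "\<phi> 1 z - k = \<phi> 0 z" by simp
  then show ?thesis using isometry_flow_0[OF flow z] isometry_flow_1[OF flow z] by (simp add: diff_eq_eq)
qed

text \<open>In the euclidean case a flow consists of translations, so its field is constant;
  integrating up to time 1 gives the translation vector of \<open>T\<close>.\<close>

lemma isometry_flow_euclidean_field:
  assumes flow: "isometry_flow Euclidean T \<phi> X" shows "X z = T w - w"
proof -
  have "X z = X 0" for z
  proof -
    have "\<phi> s z = \<phi> s 0 + z" for s
    proof -
      obtain v where "\<And>z. \<phi> s z = z + v" using flow unfolding isometry_flow_def by blast
      then show ?thesis by (simp add: add.commute)
    qed
    then have "((\<lambda>s. \<phi> s z) has_vector_derivative X 0) (at 0)"
      using has_vector_derivative_add[OF isometry_flow_deriv_0[OF flow, of 0] has_vector_derivative_const[of z]]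
      by simp
    then show ?thesis using isometry_flow_deriv_0[OF flow, of z] vector_derivative_unique_at by auto
  qed
  then show ?thesis using isometry_flow_field_translation[OF flow, of "X z" w] by (metis UNIV_I add_diff_cancel_left' plane.simps(1))
qed

text \<open>Uniqueness of the field. The flow commutes with \<open>T\<close>, so \<open>X\<close> is
  invariant under the translation; the Killing equation for \<open>z\<close> and its translate then
  makes \<open>X\<close> real. For points with different real parts it makes the values of
  \<open>X\<close> equal, and time 1 fixes the constant.\<close>

lemma isometry_flow_parabolic_field:
  assumes flow: "isometry_flow Hyperbolic T \<phi> X" and T: "\<And>z. z \<in> half_plane \<Longrightarrow> T z = z + of_real \<nu>"
    and "\<nu> \<noteq> 0" and z: "z \<in> half_plane"
  shows "X z = of_real \<nu>"
proof -
  have inv: "X (z + of_real \<nu>) = X z" if z: "z \<in> half_plane" for z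
  proof -
    have "\<phi> s (z + of_real \<nu>) = \<phi> s z + of_real \<nu>" for s
      using isometry_flow_commute[OF flow z, of s] T[OF z] T[OF isometry_flow_plane[OF flow z]] by simp
    then have "((\<lambda>s. \<phi> s (z + of_real \<nu>)) has_vector_derivative X z) (at 0)"
      using has_vector_derivative_add[OF isometry_flow_deriv_0[OF flow z] has_vector_derivative_const]
      by simp
    moreover have "z + of_real \<nu> \<in> half_plane" using z by simp
    ultimately show ?thesis using isometry_flow_deriv_0[OF flow] vector_derivative_unique_at by blast
  qed
  have real: "Im (X z) = 0" if z: "z \<in> half_plane" for z
    using isometry_flow_killing[OF flow z, of "z + of_real \<nu>"] inv[OF z] z \<open>\<nu> \<noteq> 0\<close> by auto
  have *: "Re (X z) = Re (X w)" if "z \<in> half_plane" "w \<in> half_plane" "Re z \<noteq> Re w" for z w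
    using isometry_flow_killing[OF flow that(1,2)] real[OF that(1)] real[OF that(2)] that by simp
  have const: "X v = X z" if v: "v \<in> half_plane" for v
  proof -
    \<comment> \<open>An intermediate point whose real part differs from those of both
      \<open>v\<close> and \<open>z\<close>.\<close>
    define u where "u = Complex (\<bar>Re v\<bar> + \<bar>Re z\<bar> + 1) 1"
    have "u \<in> half_plane" "Re v \<noteq> Re u" "Re z \<noteq> Re u" by (auto simp: u_def)
    then have "Re (X v) = Re (X z)" using *[of v u] *[of z u] v z by simp
    then show ?thesis using real v z by (simp add: complex_eq_iff)
  qed
  show ?thesis using isometry_flow_field_translation[OF flow const z] T[OF z] by simp
qed

text \<open>Uniqueness of the field, through \<open>q = X / z\<close>. As \<open>X\<close> commutes
  with the dilation, the Killing equation for \<open>z\<close> and \<open>\<mu> * z\<close> makes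
  \<open>q\<close> real off the imaginary axis. For two points off the axis with different norms it
  gives equal values of \<open>q\<close>. The axis is reached by comparison with nearby columns, and
  the remaining constant is found at time 1.\<close>

lemma isometry_flow_hyperbolic_field:
  assumes flow: "isometry_flow Hyperbolic T \<phi> X" and T: "\<And>z. z \<in> half_plane \<Longrightarrow> T z = of_real \<mu> * z"
    and \<mu>: "0 < \<mu>" "\<mu> \<noteq> 1" and z: "z \<in> half_plane"
  shows "X z = of_real (ln \<mu>) * z"
proof -
  have nz: "z \<noteq> 0" if "z \<in> half_plane" for z using that by auto
  have inv: "X (of_real \<mu> * z) = of_real \<mu> * X z" if z: "z \<in> half_plane" for z
  proof -
    have "\<phi> s (of_real \<mu> * z) = of_real \<mu> * \<phi> s z" for s
      using isometry_flow_commute[OF flow z, of s] T[OF z] T[OF isometry_flow_plane[OF flow z]] by simp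
    then have "((\<lambda>s. \<phi> s (of_real \<mu> * z)) has_vector_derivative of_real \<mu> * X z) (at 0)"
      using has_vector_derivative_mult_right[OF isometry_flow_deriv_0[OF flow z]] by simp
    moreover have "of_real \<mu> * z \<in> half_plane" using z \<mu> by simp
    ultimately show ?thesis using isometry_flow_deriv_0[OF flow] vector_derivative_unique_at by blast
  qed
  define q where "q = (\<lambda>z. X z / z)"
  have Xq: "X z = q z * z" if "z \<in> half_plane" for z using nz[OF that] by (simp add: q_def)
  have real: "Im (q z) * Re z = 0" if z: "z \<in> half_plane" for z
  proof -
    have "of_real \<mu> * z \<in> half_plane" using z \<mu> by simp
    from isometry_flow_killing[OF flow z this]
    have "2 * Re ((X z - of_real \<mu> * X z) * cnj (z - of_real \<mu> * z)) * (Im z * (\<mu> * Im z)) =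
      (norm (z - of_real \<mu> * z))\<^sup>2 * (Im (X z) * (\<mu> * Im z) + Im z * (\<mu> * Im (X z)))"
      by (simp add: inv[OF z])
    also have "(X z - of_real \<mu> * X z) * cnj (z - of_real \<mu> * z) = of_real ((1 - \<mu>)\<^sup>2) * (q z * (z * cnj z))"
      unfolding Xq[OF z] by (simp add: algebra_simps power2_eq_square)
    also have "z * cnj z = of_real ((norm z)\<^sup>2)" by (simp only: complex_norm_square[symmetric] of_real_power)
    also have "z - of_real \<mu> * z = of_real (1 - \<mu>) * z" by (simp add: algebra_simps)
    finally have "2 * ((1 - \<mu>)\<^sup>2 * (norm z)\<^sup>2 * Re (q z)) * (Im z * (\<mu> * Im z))
        = ((1 - \<mu>)\<^sup>2 * (norm z)\<^sup>2) * (2 * \<mu> * Im z * Im (X z))"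
      by (simp add: norm_mult power_mult_distrib algebra_simps del: of_real_diff)
    then have "((1 - \<mu>)\<^sup>2 * (norm z)\<^sup>2 * (2 * \<mu> * Im z)) * (Re (q z) * Im z)
        = ((1 - \<mu>)\<^sup>2 * (norm z)\<^sup>2 * (2 * \<mu> * Im z)) * Im (X z)" by (simp only: mult_ac)
    moreover have "(1 - \<mu>)\<^sup>2 * (norm z)\<^sup>2 * (2 * \<mu> * Im z) \<noteq> 0" using \<mu> z nz[OF z] by simp
    ultimately have "Re (q z) * Im z = Im (X z)" by (simp only: mult_cancel_left) simp
    then show ?thesis unfolding Xq[OF z] by simp
  qed
  have *: "Re (q z) = Re (q w)"
    if z: "z \<in> half_plane" "Re z \<noteq> 0" and w: "w \<in> half_plane" "Re w \<noteq> 0" and ne: "norm z \<noteq> norm w" for z w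
  proof -
    obtain r s where rs: "q z = of_real r" "q w = of_real s"
      using real[OF z(1)] real[OF w(1)] z w by (metis complex_is_Real_iff mult_eq_0_iff Reals_cases)
    have "2 * Re ((of_real r * z - of_real s * w) * cnj (z - w)) * (Im z * Im w)
        = (norm (z - w))\<^sup>2 * (r + s) * (Im z * Im w)"
      using isometry_flow_killing[OF flow z(1) w(1)] by (simp add: Xq[OF z(1)] Xq[OF w(1)] rs algebra_simps)
    then have "2 * Re ((of_real r * z - of_real s * w) * cnj (z - w)) = (norm (z - w))\<^sup>2 * (r + s)"
      using z w by simp
    then have "(r - s) * ((norm z)\<^sup>2 - (norm w)\<^sup>2) = 0"
      unfolding cmod_power2 by (simp add: power2_eq_square algebra_simps)
    moreover have "(norm z)\<^sup>2 \<noteq> (norm w)\<^sup>2" using ne by simp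
    ultimately show ?thesis by (simp add: rs)
  qed
  define K where "K = Re (q (1 + \<i>))"
  have off: "q z = of_real K" if z: "z \<in> half_plane" "Re z \<noteq> 0" for z
  proof -
    \<comment> \<open>An intermediate point off the axis whose norm exceeds both that of
      \<open>z\<close> and that of the base point \<open>1 + \<i>\<close>.\<close>
    define u where "u = of_real (norm z + 2) * (1 + \<i>)"
    have nu: "norm u = (norm z + 2) * sqrt 2"
      unfolding u_def norm_mult by (simp add: cmod_def)

    have pz: "0 < norm z + 2" "1 < norm z + 2" using norm_ge_zero[of z] by linarith+
    have u: "u \<in> half_plane" "Re u \<noteq> 0" using pz by (simp_all add: u_def)
    have "norm z + 2 \<le> norm u" using complex_Re_le_cmod[of u] by (simp add: u_def)
    then have "Re (q z) = Re (q u)" using z u by (intro *) auto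
    also have "\<dots> = K" unfolding K_def
    proof (intro *)
      have "1 * sqrt 2 < (norm z + 2) * sqrt 2" using pz by (intro mult_strict_right_mono) auto
      then show "norm u \<noteq> norm (1 + \<i>)" unfolding nu by (simp add: cmod_def)
    qed (use u in auto)
    finally show ?thesis using real[OF z(1)] z(2) by (simp add: complex_eq_iff)
  qed
  have Xk: "X z = of_real K * z" if z: "z \<in> half_plane" for z
  proof (cases "Re z = 0")
    case False
    then show ?thesis using off Xq z by simp
  next
    case True
    define y where "y = Im z"
    have zy: "z = Complex 0 y" "0 < y" using True z by (simp_all add: y_def complex_eq_iff)
    \<comment> \<open>The real and imaginary errors of \<open>q\<close> on the axis. Comparing with
      the points at the same height yields a linear function of \<open>t\<close> equal to a
      quadratic one for all \<open>t \<noteq> 0\<close>, so both vanish.\<close>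
    define e1 e2 where "e1 = Re (q z) - K" and "e2 = Im (q z)"
    have main: "2 * (y * e2) * t = e1 * t\<^sup>2" if "t \<noteq> 0" for t
    proof -
      have w: "Complex t y \<in> half_plane" "Re (Complex t y) \<noteq> 0" using zy that by auto
      have Xw: "X (Complex t y) = of_real K * Complex t y" using Xq[OF w(1)] off[OF w] by simp
      have Xz: "X z = Complex (- (e2 * y)) ((e1 + K) * y)"
        unfolding Xq[OF z] using zy by (simp add: e1_def e2_def complex_eq_iff)
      have "(2 * ((e2 * y + K * t) * t)) * (y * y) = t\<^sup>2 * ((e1 + K) * y * y + y * (K * y))"
        using isometry_flow_killing[OF flow z w(1)] unfolding cmod_power2 zy(1) Xw Xz[unfolded zy(1)]
        by (simp add: algebra_simps)
      then have "(y * y) * (2 * ((e2 * y + K * t) * t)) = (y * y) * (t\<^sup>2 * (e1 + 2 * K))"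
        by (simp add: algebra_simps)
      then have "2 * ((e2 * y + K * t) * t) = t\<^sup>2 * (e1 + 2 * K)" using zy by simp
      then show ?thesis by (simp add: algebra_simps power2_eq_square)
    qed
    have "e1 = 0" using main[of 1] main[of 2] by simp
    moreover have "e2 = 0" using main[of 1] \<open>e1 = 0\<close> zy by simp
    ultimately have "q z = of_real K" by (simp add: e1_def e2_def complex_eq_iff)
    then show ?thesis using Xq[OF z] by simp
  qed
  \<comment> \<open>The integrating factor makes the solution of the linear equation constant;
    comparing times 0 and 1 gives \<open>\<mu> = exp K\<close>.\<close>
  have "((\<lambda>s. of_real (exp (- K * s)) * \<phi> s z) has_vector_derivative 0) (at s)" for s
  proof -
    have "((\<lambda>s. exp (- K * s)) has_real_derivative - K * exp (- K * s)) (at s)"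
      by (auto intro!: derivative_eq_intros)
    from has_vector_derivative_mult[OF has_vector_derivative_of_real[OF this] isometry_flow_deriv[OF flow z]]
    show ?thesis using Xk[OF isometry_flow_plane[OF flow z]] by (simp add: algebra_simps)
  qed
  then have "((\<lambda>s. of_real (exp (- K * s)) * \<phi> s z) has_derivative (\<lambda>_. 0)) (at s within UNIV)" for s
    by (simp add: has_vector_derivative_def)
  from has_derivative_zero_unique[OF convex_UNIV this, of 0 1]
  have "of_real (exp (- K)) * (of_real \<mu> * z) = z"
    using isometry_flow_0[OF flow z] isometry_flow_1[OF flow z] T[OF z] by simp
  then have "of_real (exp (- K) * \<mu>) * z = 1 * z" by (simp add: mult.assoc)
  then have "of_real (exp (- K) * \<mu>) = (1::complex)" using nz[OF z] by (simp only: mult_cancel_right) simp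
  then have "exp (- K) * \<mu> = 1" by (simp only: of_real_eq_1_iff)
  then have "\<mu> = exp K" by (simp add: exp_minus field_simps)
  then show ?thesis using Xk[OF z] by simp
qed


section \<open>Flow and straightening coordinate of a fixed-point-free deck transformation\<close>

lemma hyperbolic_deck_mob:
  assumes M: "complete_geometric_surface Hyperbolic p M" and T: "deck_transformation Hyperbolic p T"
    and op: "orientation_preserving_map Hyperbolic T"
  obtains a b c d where "0 < a * d - b * c" "\<And>z. z \<in> half_plane \<Longrightarrow> T z = mob a b c d z"
proof -
  have "T holomorphic_on half_plane"
    unfolding holomorphic_on_open[OF open_plane] using deck_transformation_conformal(1)[OF M T op] by blast
  then show ?thesis
    using half_plane_automorphism deck_transformation_inj[OF T] deck_transformation_image[OF T] that by metis
qed

lemma isometry_flow_exists: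
  assumes M: "complete_geometric_surface g p M" and T: "deck_transformation g p T"
    and op: "orientation_preserving_map g T" and nofix: "\<And>z. z \<in> plane g \<Longrightarrow> T z \<noteq> z"
  shows "\<exists>\<phi> X. isometry_flow g T \<phi> X"
proof (cases g)
  case Euclidean
  obtain v where "v \<noteq> 0" "\<And>z. T z = z + v"
    using euclidean_deck_translation[of p M T] M T op nofix Euclidean by auto
  then show ?thesis using isometry_flow_translation[of g T v] Euclidean by blast
next
  case Hyperbolic
  note hyp = M[unfolded Hyperbolic] T[unfolded Hyperbolic] op[unfolded Hyperbolic]
  obtain a b c d where det: "0 < a * d - b * c" and Tm: "\<And>z. z \<in> half_plane \<Longrightarrow> T z = mob a b c d z"
    using hyperbolic_deck_mob[OF hyp] by metis
  have TH: "T z \<in> half_plane" if "z \<in> half_plane" for z using deck_transformation_plane[OF hyp(2) that] .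
  \<comment> \<open>A flow through the normal form is pulled back by the inverse Moebius map, whose
    coefficients are \<open>n\<close>, \<open>- l\<close>, \<open>- m\<close>,
    \<open>k\<close>.\<close>
  have conj: "\<exists>\<phi> X. isometry_flow g T \<phi> X"
    if N: "0 < k * n - l * m" and flow: "isometry_flow Hyperbolic T1 \<psi> Y"
      and T1: "\<And>z. z \<in> half_plane \<Longrightarrow> mob k l m n (T z) = T1 (mob k l m n z)" for k l m n T1 \<psi> Y
  proof -
    have det': "0 < n * k - (- l) * (- m)" using N by (simp add: mult.commute)
    have "T (mob n (- l) (- m) k w) = mob n (- l) (- m) k (T1 w)" if w: "w \<in> half_plane" for w
    proof -
      have z: "mob n (- l) (- m) k w \<in> half_plane" by (rule mob_in_half_plane[OF det' w])
      have "T1 w = mob k l m n (T (mob n (- l) (- m) k w))" using T1[OF z] mob_inverse'[OF N w] by simp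
      then show ?thesis using mob_inverse[OF N TH[OF z]] by simp
    qed
    from isometry_flow_conj[OF flow det' this] show ?thesis using Hyperbolic by blast
  qed
  show ?thesis
  proof (rule mob_normal_form[OF det Tm])
    show "T z \<noteq> z" if "z \<in> half_plane" for z using nofix that Hyperbolic by simp
  next
    fix k l m n \<nu> assume "0 < k * n - l * m" "\<nu> \<noteq> 0"
      "\<And>z. z \<in> half_plane \<Longrightarrow> mob k l m n (T z) = mob k l m n z + of_real \<nu>"
    moreover have "isometry_flow Hyperbolic (\<lambda>w. w + of_real \<nu>) (\<lambda>s z. z + of_real s * of_real \<nu>) (\<lambda>_. of_real \<nu>)"
      by (intro isometry_flow_translation) auto
    ultimately show ?thesis using conj[of k n l m "\<lambda>w. w + of_real \<nu>"] by blast
  next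
    fix k l m n \<mu> assume "0 < k * n - l * m" "0 < \<mu>" "\<mu> \<noteq> 1"
      "\<And>z. z \<in> half_plane \<Longrightarrow> mob k l m n (T z) = of_real \<mu> * mob k l m n z"
    moreover note isometry_flow_dilation[OF refl \<open>0 < \<mu>\<close>]
    ultimately show ?thesis using conj[of k n l m "\<lambda>w. of_real \<mu> * w"] by blast
  qed
qed

text \<open>In the coordinate \<open>\<Phi>\<close> the flow becomes a flow of translations, so angles with the field become
  angles with the fixed direction \<open>c\<close>.\<close>

lemma isometry_flow_coordinate:
  assumes M: "complete_geometric_surface g p M" and T: "deck_transformation g p T"
    and op: "orientation_preserving_map g T" and nofix: "\<And>z. z \<in> plane g \<Longrightarrow> T z \<noteq> z"
    and flow: "isometry_flow g T \<phi> X"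
  obtains \<Phi> c where "c \<noteq> 0" "\<Phi> holomorphic_on plane g" "inj_on \<Phi> (plane g)"
    "\<And>z. z \<in> plane g \<Longrightarrow> deriv \<Phi> z * X z = c" "\<And>z. z \<in> plane g \<Longrightarrow> \<Phi> (T z) = \<Phi> z + c"
proof (cases g)
  case Euclidean
  obtain v where v: "v \<noteq> 0" "\<And>z. T z = z + v"
    using euclidean_deck_translation[of p M T] M T op nofix Euclidean by auto
  show ?thesis
  proof (rule that[of v "\<lambda>z. z"])
    show "deriv (\<lambda>z. z) z * X z = v" for z
      using isometry_flow_euclidean_field[of T \<phi> X z 0] flow v Euclidean by simp
  qed (use v in auto)
next
  case Hyperbolic
  note hyp = M[unfolded Hyperbolic] T[unfolded Hyperbolic] op[unfolded Hyperbolic]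
  have fl: "isometry_flow Hyperbolic T \<phi> X" using flow Hyperbolic by simp
  obtain a b c d where det: "0 < a * d - b * c" and Tm: "\<And>z. z \<in> half_plane \<Longrightarrow> T z = mob a b c d z"
    using hyperbolic_deck_mob[OF hyp] by metis
  have N_props: "mob k l m n holomorphic_on half_plane" "inj_on (mob k l m n) half_plane"
    "\<And>z. z \<in> half_plane \<Longrightarrow> deriv (mob k l m n) z = mob_deriv k l m n z" if N: "0 < k * n - l * m" for k l m n
  proof -
    show "mob k l m n holomorphic_on half_plane"
      unfolding holomorphic_on_open[OF open_plane] using mob_has_field_derivative[OF N] by blast
    show "inj_on (mob k l m n) half_plane" using mob_inverse[OF N] by (rule inj_on_inverseI)
    show "\<And>z. z \<in> half_plane \<Longrightarrow> deriv (mob k l m n) z = mob_deriv k l m n z"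
      by (rule DERIV_imp_deriv[OF mob_has_field_derivative[OF N]])
  qed
  show ?thesis
  proof (rule mob_normal_form[OF det Tm])
    show "T z \<noteq> z" if "z \<in> half_plane" for z using nofix that Hyperbolic by simp
  next
    fix k l m n \<nu> assume N: "0 < k * n - l * m" and \<nu>: "\<nu> \<noteq> 0"
      and NT: "\<And>z. z \<in> half_plane \<Longrightarrow> mob k l m n (T z) = mob k l m n z + of_real \<nu>"
    have "deriv (mob k l m n) z * X z = of_real \<nu>" if z: "z \<in> half_plane" for z
    proof -
      have "\<And>z. z \<in> half_plane \<Longrightarrow> mob k l m n z + of_real \<nu> = mob k l m n (T z)" using NT by simp
      from isometry_flow_conj[OF fl N, where T' = "\<lambda>w. w + of_real \<nu>", OF this]
      have "X (mob n (- l) (- m) k w) * mob_deriv k l m n (mob n (- l) (- m) k w) = of_real \<nu>"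
        if "w \<in> half_plane" for w
        using isometry_flow_parabolic_field \<nu> that by blast
      from this[OF mob_in_half_plane[OF N z]] show ?thesis
        using mob_inverse[OF N z] N_props(3)[OF N z] by (simp add: mult.commute)
    qed
    then show ?thesis
      using \<nu> NT N_props[OF N] Hyperbolic by (intro that[of "of_real \<nu>" "mob k l m n"]) auto
  next
    fix k l m n \<mu> assume N: "0 < k * n - l * m" and \<mu>: "0 < \<mu>" "\<mu> \<noteq> 1"
      and NT: "\<And>z. z \<in> half_plane \<Longrightarrow> mob k l m n (T z) = of_real \<mu> * mob k l m n z"
    let ?N = "mob k l m n"
    have NH: "?N z \<in> half_plane" if "z \<in> half_plane" for z by (rule mob_in_half_plane[OF N that])
    have Nz: "?N z \<noteq> 0" "?N z \<notin> \<real>\<^sub>\<le>\<^sub>0" if "z \<in> half_plane" for z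
      using NH[OF that] by (auto simp: complex_nonpos_Reals_iff)
    have field: "mob_deriv k l m n z * X z = of_real (ln \<mu>) * ?N z" if z: "z \<in> half_plane" for z
    proof -
      have "\<And>z. z \<in> half_plane \<Longrightarrow> of_real \<mu> * mob k l m n z = mob k l m n (T z)" using NT by simp
      from isometry_flow_conj[OF fl N, where T' = "\<lambda>w. of_real \<mu> * w", OF this]
      have "X (mob n (- l) (- m) k w) * mob_deriv k l m n (mob n (- l) (- m) k w) = of_real (ln \<mu>) * w"
        if "w \<in> half_plane" for w
        using isometry_flow_hyperbolic_field \<mu> that by blast
      from this[OF mob_in_half_plane[OF N z]] show ?thesis
        using mob_inverse[OF N z] by (simp add: mult.commute)
    qed
    \<comment> \<open>The logarithm turns the dilation by \<mu> into the translation by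
      \<open>ln \<mu>\<close>, and the half-plane avoids its branch cut.\<close>
    let ?\<Phi> = "\<lambda>z. Ln (?N z)"
    have der: "(?\<Phi> has_field_derivative mob_deriv k l m n z / ?N z) (at z)" if z: "z \<in> half_plane" for z
      using mob_has_field_derivative[OF N z] Nz[OF z] by (auto intro!: derivative_eq_intros simp: field_simps)
    show ?thesis
    proof (rule that[of "of_real (ln \<mu>)" ?\<Phi>])
      show "of_real (ln \<mu>) \<noteq> (0::complex)" using \<mu> by simp
      show "?\<Phi> holomorphic_on plane g"
        unfolding Hyperbolic holomorphic_on_open[OF open_plane] using der by blast
      show "inj_on ?\<Phi> (plane g)"
        unfolding Hyperbolic
      proof (rule inj_onI)
        fix x y assume xy: "x \<in> half_plane" "y \<in> half_plane" "?\<Phi> x = ?\<Phi> y"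
        then have "?N x = ?N y" by (metis Nz(1) exp_Ln)
        then show "x = y" using N_props(2)[OF N] xy by (auto dest: inj_onD)
      qed
      show "deriv ?\<Phi> z * X z = of_real (ln \<mu>)" if "z \<in> plane g" for z
        using DERIV_imp_deriv[OF der, of z] field[of z] Nz(1)[of z] that Hyperbolic by simp
      show "?\<Phi> (T z) = ?\<Phi> z + of_real (ln \<mu>)" if "z \<in> plane g" for z
        using NT[of z] Ln_times_of_real[OF \<mu>(1) Nz(1)[of z]] that Hyperbolic \<mu> by (simp add: Ln_of_real add.commute)
    qed
  qed
qed

section \<open>Lifting through the covering of a metric space\<close>

text \<open>The lifting theorems of the library are stated for coverings of subsets of normed spaces, so \<open>M\<close>
  is embedded isometrically into the bounded continuous functions on it (Kuratowski's embedding).\<close>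

definition kuratowski :: "'m::metric_space \<Rightarrow> ('m \<Rightarrow>\<^sub>C real)" where
  "kuratowski x = Bcontfun (\<lambda>y. dist x y - dist undefined y)"

lemma kuratowski_apply: "apply_bcontfun (kuratowski x) y = dist x y - dist undefined y"
proof -
  \<comment> \<open>\<open>undefined\<close> is merely a base point: subtracting the distance to it
    keeps the function bounded, by the triangle inequality, even on an unbounded space.\<close>
  have "(\<lambda>y. dist x y - dist undefined y) \<in> bcontfun"
  proof (rule bcontfun_normI)
    show "continuous_on UNIV (\<lambda>y. dist x y - dist undefined y)" by (intro continuous_intros)
    show "norm (dist x y - dist undefined y) \<le> dist x undefined" for y
      using abs_dist_diff_le[of x y undefined] by (simp add: dist_commute)
  qed
  then show ?thesis by (simp add: kuratowski_def Bcontfun_inverse)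
qed

lemma dist_kuratowski: "dist (kuratowski x) (kuratowski y) = dist x y"
proof (rule antisym)
  show "dist (kuratowski x) (kuratowski y) \<le> dist x y"
  proof (rule dist_bound)
    show "dist (kuratowski x z) (kuratowski y z) \<le> dist x y" for z
      using dist_triangle[of x z y] dist_triangle[of y z x]
      by (simp add: kuratowski_apply dist_real_def dist_commute)
  qed
  \<comment> \<open>Evaluation at the point \<open>y\<close> attains the full distance.\<close>
  have "dist (kuratowski x y) (kuratowski y y) \<le> dist (kuratowski x) (kuratowski y)"
    by (rule dist_bounded)
  then show "dist x y \<le> dist (kuratowski x) (kuratowski y)"
    by (simp add: kuratowski_apply dist_real_def)
qed

lemma continuous_on_kuratowski: "continuous_on A kuratowski"
  by (auto simp: continuous_on_iff dist_kuratowski)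

lemma inj_kuratowski: "kuratowski x = kuratowski y \<longleftrightarrow> x = y"
  by (metis dist_eq_0_iff dist_kuratowski)

lemma homeomorphism_kuratowski:
  "homeomorphism A (kuratowski ` A) kuratowski (the_inv kuratowski)"
proof -
  have inv: "the_inv kuratowski (kuratowski x) = x" for x :: 'a
    by (intro the_inv_f_f injI) (simp add: inj_kuratowski)
  have "continuous_on (kuratowski ` A) (the_inv kuratowski)"
    by (auto simp: continuous_on_iff inv dist_kuratowski)
  then show ?thesis by (auto simp: homeomorphism_def continuous_on_kuratowski inv image_image)
qed

lemma covering_space_homeomorphism:
  assumes cov: "covering_space C p S" and hom: "homeomorphism S S' e e'"
  shows "covering_space C (e \<circ> p) S'"
  unfolding covering_space_def
proof (intro conjI ballI)
  have p: "continuous_on C p" "p ` C = S" using cov by (auto simp: covering_space_def)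
  show "continuous_on C (e \<circ> p)"
    using p hom by (intro continuous_on_compose) (auto simp: homeomorphism_def)
  show "(e \<circ> p) ` C = S'" unfolding image_comp[symmetric] p(2) by (rule homeomorphism_image1[OF hom])
  fix y assume y: "y \<in> S'"
  then have "e' y \<in> S" using hom by (auto simp: homeomorphism_def)
  then obtain T v where T: "e' y \<in> T" "openin (top_of_set S) T" "\<Union>v = C \<inter> p -` T"
      "\<forall>u\<in>v. openin (top_of_set C) u" "pairwise disjnt v" and q: "\<forall>u\<in>v. \<exists>q. homeomorphism u T p q"
    using cov unfolding covering_space_def by meson
  have TS: "T \<subseteq> S" using T(2) openin_imp_subset by blast
  show "\<exists>T. y \<in> T \<and> openin (top_of_set S') T \<and>
      (\<exists>v. \<Union>v = C \<inter> (e \<circ> p) -` T \<and> (\<forall>u\<in>v. openin (top_of_set C) u) \<and> pairwise disjnt v \<and>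
        (\<forall>u\<in>v. \<exists>q. homeomorphism u T (e \<circ> p) q))"
  proof (intro exI conjI)
    show "y \<in> e ` T" using T(1) y hom by (metis homeomorphism_apply2 imageI)
    show "openin (top_of_set S') (e ` T)" using homeomorphism_imp_open_map[OF hom T(2)] .
    show "\<Union>v = C \<inter> (e \<circ> p) -` e ` T"
      unfolding T(3)
    proof (intro equalityI subsetI)
      fix x assume x: "x \<in> C \<inter> (e \<circ> p) -` e ` T"
      then obtain t where "t \<in> T" "e (p x) = e t" by auto
      then have "p x = t" using x p TS hom by (metis IntD1 homeomorphism_apply1 imageI subsetD)
      then show "x \<in> C \<inter> p -` T" using x \<open>t \<in> T\<close> by simp
    qed auto
    show "\<forall>u\<in>v. openin (top_of_set C) u" "pairwise disjnt v" by fact+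
    show "\<forall>u\<in>v. \<exists>q. homeomorphism u (e ` T) (e \<circ> p) q"
    proof
      fix u assume "u \<in> v"
      then obtain q where "homeomorphism u T p q" using q by blast
      moreover have "homeomorphism T (e ` T) e e'"
        using homeomorphism_of_subsets[OF hom TS] by blast
      ultimately show "\<exists>q. homeomorphism u (e ` T) (e \<circ> p) q" using homeomorphism_compose by blast
    qed
  qed
qed

lemma covering_space_kuratowski:
  "covering_space C p S \<Longrightarrow> covering_space C (kuratowski \<circ> p) (kuratowski ` S)"
  by (rule covering_space_homeomorphism[OF _ homeomorphism_kuratowski])

lemma metric_covering_lift_homotopy:
  fixes p :: "'a::real_normed_vector \<Rightarrow> 'm::metric_space" and h :: "real \<times> 'c::real_normed_vector \<Rightarrow> 'm"
  assumes cov: "covering_space C p S" and h: "continuous_on ({0..1} \<times> U) h" "h ` ({0..1} \<times> U) \<subseteq> S"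
    and eq: "\<And>y. y \<in> U \<Longrightarrow> h (0, y) = p (f y)" and f: "continuous_on U f" "f ` U \<subseteq> C"
  obtains k where "continuous_on ({0..1} \<times> U) k" "k ` ({0..1} \<times> U) \<subseteq> C"
    "\<And>y. y \<in> U \<Longrightarrow> k (0, y) = f y" "\<And>z. z \<in> {0..1} \<times> U \<Longrightarrow> p (k z) = h z"
proof -
  obtain k where k: "continuous_on ({0..1} \<times> U) k" "k \<in> ({0..1} \<times> U) \<rightarrow> C"
    "\<And>y. y \<in> U \<Longrightarrow> k (0, y) = f y" "\<And>z. z \<in> {0..1} \<times> U \<Longrightarrow> (kuratowski \<circ> h) z = (kuratowski \<circ> p) (k z)"
  proof (rule covering_space_lift_homotopy[OF covering_space_kuratowski[OF cov], of U "kuratowski \<circ> h" f])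
    show "continuous_on ({0..1} \<times> U) (kuratowski \<circ> h)"
      by (intro continuous_on_compose h continuous_on_kuratowski)
    show "kuratowski \<circ> h \<in> {0..1} \<times> U \<rightarrow> kuratowski ` S"
      unfolding Pi_iff o_apply using h(2) by blast
  qed (use eq f in auto)
  show ?thesis
  proof (rule that[OF k(1)])
    show "k ` ({0..1} \<times> U) \<subseteq> C" using k(2) by auto
    show "p (k z) = h z" if "z \<in> {0..1} \<times> U" for z using k(4)[OF that] by (simp add: inj_kuratowski)
  qed (use k in auto)
qed

lemma metric_covering_lift:
  fixes p :: "'a::real_normed_vector \<Rightarrow> 'm::metric_space" and f :: "'c::real_normed_vector \<Rightarrow> 'm"
  assumes cov: "covering_space C p S" "a \<in> C" "z \<in> U" and U: "simply_connected U" "locally path_connected U"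
    and f: "continuous_on U f" "f ` U \<subseteq> S" "f z = p a"
  obtains k where "continuous_on U k" "k ` U \<subseteq> C" "k z = a" "\<And>y. y \<in> U \<Longrightarrow> p (k y) = f y"
proof -
  obtain k where k: "continuous_on U k" "k \<in> U \<rightarrow> C" "k z = a"
    "\<And>y. y \<in> U \<Longrightarrow> (kuratowski \<circ> p) (k y) = (kuratowski \<circ> f) y"
  proof (rule covering_space_lift_strong[OF covering_space_kuratowski[OF cov(1)] cov(2,3) U, of "kuratowski \<circ> f"])
    show "continuous_on U (kuratowski \<circ> f)"
      by (intro continuous_on_compose f continuous_on_kuratowski)
  qed (use f in auto)
  then show ?thesis using that by (auto simp: inj_kuratowski)
qed

lemma metric_covering_monodromy:
  fixes p :: "'a::real_normed_vector \<Rightarrow> 'm::metric_space"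
  assumes cov: "covering_space C p S" and hom: "homotopic_paths S g1 g2"
    and h1: "path h1" "path_image h1 \<subseteq> C" "\<And>t. t \<in> {0..1} \<Longrightarrow> p (h1 t) = g1 t"
    and h2: "path h2" "path_image h2 \<subseteq> C" "\<And>t. t \<in> {0..1} \<Longrightarrow> p (h2 t) = g2 t"
    and start: "pathstart h1 = pathstart h2"
  shows "pathfinish h1 = pathfinish h2"
proof -
  have hom': "homotopic_paths (kuratowski ` S) (kuratowski \<circ> g1) (kuratowski \<circ> g2)"
    by (rule homotopic_paths_continuous_image[OF hom continuous_on_kuratowski]) auto
  note P = homotopic_paths_imp_path[OF hom'] homotopic_paths_imp_subset[OF hom']
  show ?thesis
    by (rule covering_space_monodromy[OF covering_space_kuratowski[OF cov] _ _ _ _ hom' h1(1,2) _ h2(1,2) _ start])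
      (use P h1 h2 in auto)
qed


section \<open>Covers and transported covers\<close>

lemma simply_connected_plane: "simply_connected (plane g)"
  by (rule convex_imp_simply_connected[OF convex_plane])

lemma locally_path_connected_plane: "locally path_connected (plane g)"
  by (rule open_imp_locally_path_connected[OF open_plane])

lemma homotopic_paths_plane:
  assumes "path a" "path_image a \<subseteq> plane g" "path b" "path_image b \<subseteq> plane g"
    and "pathstart a = pathstart b" "pathfinish a = pathfinish b"
  shows "homotopic_paths (plane g) a b"
  using simply_connected_plane[of g] assms unfolding simply_connected_eq_homotopic_paths by metis

lemma lift_eq:
  fixes p :: "'c::real_normed_vector \<Rightarrow> 'd::topological_space" and a b :: "'a::topological_space \<Rightarrow> 'c"
  assumes cov: "covering_space C p S" and ab: "continuous_on A a" "a ` A \<subseteq> C" "continuous_on A b" "b ` A \<subseteq> C"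
    and eq: "\<And>x. x \<in> A \<Longrightarrow> p (a x) = p (b x)" and A: "connected A" "x0 \<in> A" "a x0 = b x0" and x: "x \<in> A"
  shows "a x = b x"
proof (rule covering_space_lift_unique[where p = p and ?g1.0 = a and ?g2.0 = b and a = x0 and f = "\<lambda>x. p (a x)", OF cov A(3)])
  have "continuous_on C p" "p ` C = S" using cov by (auto simp: covering_space_def)
  then show "continuous_on A (\<lambda>x. p (a x))" "(\<lambda>x. p (a x)) \<in> A \<rightarrow> S"
    using ab by (auto intro: continuous_on_compose2)
qed (use ab eq A x in auto)

lemma surface_covering: "complete_geometric_surface g p M \<Longrightarrow> covering_space (plane g) p M"
  by (simp add: complete_geometric_surface_def)

lemma deck_transformation_over: "deck_transformation g p f \<Longrightarrow> z \<in> plane g \<Longrightarrow> p (f z) = p z"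
  by (simp add: deck_transformation_def)

lemma deck_transformation_eq:
  assumes "complete_geometric_surface g p M" "deck_transformation g p f" "deck_transformation g p h"
    and "z0 \<in> plane g" "f z0 = h z0" "z \<in> plane g"
  shows "f z = h z"
proof (rule lift_eq[OF surface_covering[OF assms(1)], of "plane g" f h z0 z])
  show "f ` plane g \<subseteq> plane g" "h ` plane g \<subseteq> plane g"
    using deck_transformation_plane assms by blast+
  show "connected (plane g)" by (rule convex_connected[OF convex_plane])
qed (use assms deck_transformation_continuous deck_transformation_over in \<open>auto simp: deck_transformation_over\<close>)

lemma deck_transformation_id: "deck_transformation g p (\<lambda>z. z)"
  unfolding deck_transformation_def homeomorphism_def by (auto intro!: exI[of _ "\<lambda>z. z"])

text \<open>The plane is simply connected, so \<open>p\<close> lifts through itself with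
  \<open>z\<close> sent to \<open>w\<close>, and also with \<open>w\<close> sent to
  \<open>z\<close>. The compositions lift \<open>p\<close> and fix a point, so uniqueness of lifts
  makes the two maps inverse to each other.\<close>

lemma deck_transformation_exists:
  fixes p :: "complex \<Rightarrow> 'm::metric_space"
  assumes M: "complete_geometric_surface g p M" and z: "z \<in> plane g" "w \<in> plane g" "p z = p w"
  obtains f where "deck_transformation g p f" "f z = w"
proof -
  note cov = surface_covering[OF M]
  have p: "continuous_on (plane g) p" "p ` plane g \<subseteq> M" using cov by (auto simp: covering_space_def)
  have lift: "\<exists>k. continuous_on (plane g) k \<and> k ` plane g \<subseteq> plane g \<and> k z = w \<and> (\<forall>y\<in>plane g. p (k y) = p y)"
    if "z \<in> plane g" "w \<in> plane g" "p z = p w" for z w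
    using metric_covering_lift[OF cov that(2,1) simply_connected_plane locally_path_connected_plane p that(3)]
    by metis
  obtain f where f: "continuous_on (plane g) f" "f ` plane g \<subseteq> plane g" "f z = w" "\<And>y. y \<in> plane g \<Longrightarrow> p (f y) = p y"
    using lift[OF z] by metis
  obtain h where h: "continuous_on (plane g) h" "h ` plane g \<subseteq> plane g" "h w = z" "\<And>y. y \<in> plane g \<Longrightarrow> p (h y) = p y"
    using lift[OF z(2,1) z(3)[symmetric]] by metis
  have inverse: "h (f y) = y"
    if "continuous_on (plane g) f" "f ` plane g \<subseteq> plane g" "\<And>y. y \<in> plane g \<Longrightarrow> p (f y) = p y"
      "continuous_on (plane g) h" "h ` plane g \<subseteq> plane g" "\<And>y. y \<in> plane g \<Longrightarrow> p (h y) = p y"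
      "u \<in> plane g" "h (f u) = u" "y \<in> plane g" for f h u y
  proof (rule lift_eq[OF cov, of "plane g" "\<lambda>y. h (f y)" "\<lambda>y. y" u y])
    show "continuous_on (plane g) (\<lambda>y. h (f y))" using that by (auto intro: continuous_on_compose2)
    show "connected (plane g)" by (rule convex_connected[OF convex_plane])
    show "p (h (f y)) = p y" if "y \<in> plane g" for y
      using that \<open>f ` plane g \<subseteq> plane g\<close> \<open>\<And>y. y \<in> plane g \<Longrightarrow> p (f y) = p y\<close>
        \<open>\<And>y. y \<in> plane g \<Longrightarrow> p (h y) = p y\<close> by (metis imageI subsetD)
  qed (use that in auto)
  have "h (f y) = y" "f (h y) = y" if "y \<in> plane g" for y
    using inverse[OF f(1,2,4) h(1,2,4) z(1) _ that] inverse[OF h(1,2,4) f(1,2,4) z(2) _ that] f(3) h(3) by auto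
  then have "homeomorphism (plane g) (plane g) f h"
    using f h by (auto simp: homeomorphism_def image_iff) (metis image_subset_iff)+
  then have "deck_transformation g p f" using f(4) unfolding deck_transformation_def by blast
  then show ?thesis using that f(3) by blast
qed

lemma p_S1_add_1: "p_S1 (t + 1) = p_S1 t"
  by (simp add: p_S1_def distrib_left cis_mult[symmetric])

lemma p_S1_sphere: "p_S1 t \<in> sphere 0 1"
  by (simp add: p_S1_def)

lemma p_S1_eq: "p_S1 s = p_S1 t \<longleftrightarrow> (\<exists>k::int. s = t + of_int k)"
proof -
  have "p_S1 s = p_S1 t \<longleftrightarrow> exp (\<i> * of_real (2 * pi * s)) = exp (\<i> * of_real (2 * pi * t))"
    by (simp add: p_S1_def cis_conv_exp)
  also have "\<dots> \<longleftrightarrow> (\<exists>k::int. 2 * pi * s = 2 * pi * t + of_int (2 * k) * pi)"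
    unfolding exp_eq by (auto simp: complex_eq_iff)
  also have "\<dots> \<longleftrightarrow> (\<exists>k::int. s = t + of_int k)"
  proof (rule ex_cong1)
    fix k :: int
    have "2 * pi * t + of_int (2 * k) * pi = 2 * pi * (t + of_int k)" by (simp add: algebra_simps)
    then show "2 * pi * s = 2 * pi * t + of_int (2 * k) * pi \<longleftrightarrow> s = t + of_int k"
      by (simp only: mult_cancel_left) simp
  qed
  finally show ?thesis .
qed

lemma continuous_on_p_S1: "continuous_on A p_S1"
  unfolding p_S1_def cis_conv_exp by (intro continuous_intros)

lemma cover_of_plane: "cover_of g p \<gamma> \<gamma>t \<Longrightarrow> \<gamma>t t \<in> plane g"
  unfolding cover_of_def by blast

lemma cover_of_continuous: "cover_of g p \<gamma> \<gamma>t \<Longrightarrow> continuous_on A \<gamma>t"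
  unfolding cover_of_def using continuous_on_subset by blast

lemma cover_of_over: "cover_of g p \<gamma> \<gamma>t \<Longrightarrow> p (\<gamma>t t) = \<gamma> (p_S1 t)"
  unfolding cover_of_def by blast

lemma cover_of_path: "cover_of g p \<gamma> \<gamma>t \<Longrightarrow> path \<gamma>t" "cover_of g p \<gamma> \<gamma>t \<Longrightarrow> path_image \<gamma>t \<subseteq> plane g"
  using cover_of_continuous[of g p \<gamma> \<gamma>t] cover_of_plane[of g p \<gamma> \<gamma>t] by (auto simp: path_def path_image_def)

lemma transported_cover_of:
  assumes "transported_cover g p M \<gamma>0 \<gamma>t0 \<gamma> \<gamma>t"
  shows "cover_of g p \<gamma> \<gamma>t"
proof -
  obtain H and K :: "real \<times> real \<Rightarrow> complex" where HK: "\<forall>u\<in>sphere 0 1. H (0, u) = \<gamma>0 u \<and> H (1, u) = \<gamma> u"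
     "continuous_on ({0..1} \<times> UNIV) K" "K ` ({0..1} \<times> UNIV) \<subseteq> plane g"
     "\<forall>s\<in>{0..1}. \<forall>t. p (K (s, t)) = H (s, p_S1 t)" "\<forall>t. K (0, t) = \<gamma>t0 t \<and> K (1, t) = \<gamma>t t"
    using assms unfolding transported_cover_def by metis
  have K1: "\<gamma>t = (\<lambda>t. K (1, t))" using HK(5) by auto
  show ?thesis unfolding cover_of_def
  proof (intro conjI allI)
    show "continuous_on UNIV \<gamma>t" unfolding K1
      by (intro continuous_on_compose2[OF HK(2)] continuous_intros) auto
    show "range \<gamma>t \<subseteq> plane g" using HK(3) unfolding K1 by auto
    show "p (\<gamma>t t) = \<gamma> (p_S1 t)" for t using HK(1,4) p_S1_sphere unfolding K1 by simp
  qed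
qed

lemma transported_cover_exists:
  fixes p :: "complex \<Rightarrow> 'm::metric_space"
  assumes M: "complete_geometric_surface g p M" and cov: "cover_of g p \<gamma>0 \<gamma>t0" and hom: "freely_homotopic M \<gamma>0 \<gamma>"
  shows "\<exists>\<gamma>t. transported_cover g p M \<gamma>0 \<gamma>t0 \<gamma> \<gamma>t"
proof -
  obtain H :: "real \<times> complex \<Rightarrow> 'm" where H: "continuous_on ({0..1} \<times> sphere 0 1) H"
    "H \<in> ({0..1} \<times> sphere 0 1) \<rightarrow> M" "\<And>u. H (0, u) = \<gamma>0 u" "\<And>u. H (1, u) = \<gamma> u"
    using hom unfolding freely_homotopic_def by (auto simp: homotopic_with_def)
  let ?h = "\<lambda>(s::real, t). H (s, p_S1 t)"
  have im: "(\<lambda>(s, t). (s, p_S1 t)) ` ({0..1} \<times> UNIV) \<subseteq> {0..1} \<times> sphere 0 1"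
    using p_S1_sphere by auto
  obtain K where K: "continuous_on ({0..1} \<times> UNIV) K" "K ` ({0..1} \<times> UNIV) \<subseteq> plane g"
    "\<And>t. t \<in> UNIV \<Longrightarrow> K (0, t) = \<gamma>t0 t" "\<And>z. z \<in> {0..1} \<times> UNIV \<Longrightarrow> p (K z) = ?h z"
  proof (rule metric_covering_lift_homotopy[OF surface_covering[OF M], of UNIV ?h \<gamma>t0])
    show "continuous_on ({0..1} \<times> UNIV) ?h"
      unfolding case_prod_unfold
      by (intro continuous_on_compose2[OF H(1)] continuous_on_compose2[OF continuous_on_p_S1[of UNIV]] continuous_intros)
        (use p_S1_sphere in auto)
    show "?h ` ({0..1} \<times> UNIV) \<subseteq> M" using H(2) p_S1_sphere by fastforce
    show "?h (0, t) = p (\<gamma>t0 t)" for t using H(3) cover_of_over[OF cov] by simp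
    show "continuous_on UNIV \<gamma>t0" by (rule cover_of_continuous[OF cov])
    show "\<gamma>t0 ` UNIV \<subseteq> plane g" using cover_of_plane[OF cov] by auto
  qed (rule that)
  have "transported_cover g p M \<gamma>0 \<gamma>t0 \<gamma> (\<lambda>t. K (1, t))"
    unfolding transported_cover_def
  proof (intro exI conjI)
    show "H ` ({0..1} \<times> sphere 0 1) \<subseteq> M" using H(2) by auto
  qed (use H K in auto)
  then show ?thesis by blast
qed

text \<open>\<open>T0\<close> is pinned down by the initial cover alone, so that one and the same
  map serves all transported covers.\<close>

locale nonreversible_homotopy =
  fixes g :: geometry and p :: "complex \<Rightarrow> 'm::metric_space" and M :: "'m set"
    and \<gamma>0 \<gamma> :: "complex \<Rightarrow> 'm" and \<gamma>t0 :: "real \<Rightarrow> complex" and T0 :: "complex \<Rightarrow> complex"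
  assumes M: "complete_geometric_surface g p M"
    and or: "orientation_preserving_curve g p \<gamma>0"
    and nnull: "\<not> null_homotopic M \<gamma>0"
    and nrev: "\<not> reversible g p M \<gamma>0"
    and cov0: "cover_of g p \<gamma>0 \<gamma>t0"
    and gen: "generic_regular_closed_curve g p M \<gamma>"
    and T0: "deck_transformation g p T0" and T0_0: "T0 (\<gamma>t0 0) = \<gamma>t0 1"
begin

lemma T0_op: "orientation_preserving_map g T0"
proof -
  have "\<forall>h f. path h \<and> path_image h \<subseteq> plane g \<and> (\<forall>t\<in>{0..1}. p (h t) = (\<gamma>0 \<circ> p_S1) t) \<and>
      deck_transformation g p f \<and> f (pathstart h) = pathfinish h \<longrightarrow> orientation_preserving_map g f"
    using or unfolding orientation_preserving_curve_def orientation_hom_def by (simp split: if_splits)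
  from this[rule_format, of \<gamma>t0 T0] show ?thesis
    using cover_of_path[OF cov0] cover_of_over[OF cov0] T0 T0_0 by (simp add: pathstart_def pathfinish_def)
qed

text \<open>A deck transformation with a fixed point is the identity. The cover would then close up
  after one period, and contracting this loop in the plane would contract \<open>\<gamma>0\<close>
  in \<open>M\<close>.\<close>

lemma T0_no_fixed_point:
  assumes z: "z \<in> plane g" shows "T0 z \<noteq> z"
proof
  assume "T0 z = z"
  then have id: "T0 w = w" if "w \<in> plane g" for w
    using deck_transformation_eq[OF M T0 deck_transformation_id z _ that] by simp
  let ?a = "\<gamma>t0 0"
  have "homotopic_loops (plane g) \<gamma>t0 (linepath ?a ?a)"
    using simply_connected_plane[of g] cover_of_path[OF cov0] cover_of_plane[OF cov0] id[of ?a] T0_0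
    unfolding simply_connected_eq_contractible_loop_any by (simp add: pathstart_def pathfinish_def)
  then have "homotopic_loops M (p \<circ> \<gamma>t0) (p \<circ> linepath ?a ?a)"
    using surface_covering[OF M] by (intro homotopic_loops_continuous_image) (auto simp: covering_space_def)
  \<comment> \<open>Null-homotopy is defined for maps of the circle, so the parameter in the unit
    interval is replaced by \<open>Arg2pi z / (2 * pi)\<close>.\<close>
  from homotopic_loops_imp_homotopic_circlemaps[OF this]
  have "homotopic_with_canon (\<lambda>h. True) (sphere 0 1) M ((p \<circ> \<gamma>t0) \<circ> (\<lambda>z. Arg2pi z / (2 * pi)))
      ((p \<circ> linepath ?a ?a) \<circ> (\<lambda>z. Arg2pi z / (2 * pi)))" .
  then have "homotopic_with_canon (\<lambda>h. True) (sphere 0 1) M \<gamma>0 (\<lambda>_. p ?a)"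
  proof (rule homotopic_with_eq)
    fix u :: complex assume "u \<in> topspace (top_of_set (sphere 0 1))"
    then have "p_S1 (Arg2pi u / (2 * pi)) = u"
      using Arg2pi_eq[of u] by (simp add: p_S1_def cis_conv_exp)
    then show "\<gamma>0 u = ((p \<circ> \<gamma>t0) \<circ> (\<lambda>z. Arg2pi z / (2 * pi))) u" by (simp add: cover_of_over[OF cov0])
  qed (auto simp: linepath_refl)
  moreover have "p ?a \<in> M" using surface_covering[OF M] cover_of_plane[OF cov0] by (auto simp: covering_space_def)
  ultimately show False using nnull unfolding null_homotopic_def freely_homotopic_def by blast
qed

text \<open>\<open>T0 \<circ> K\<close> and the shift of \<open>K\<close> by one period lift the
  same map and agree at \<open>(0, 0)\<close>, hence everywhere; the period relation is thus carried
  along the homotopy.\<close>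

lemma T0_transported:
  assumes tr: "transported_cover g p M \<gamma>0 \<gamma>t0 \<gamma> \<gamma>t"
  shows "T0 (\<gamma>t t) = \<gamma>t (t + 1)"
proof -
  obtain H and K :: "real \<times> real \<Rightarrow> complex" where HK:
     "continuous_on ({0..1} \<times> UNIV) K" "K ` ({0..1} \<times> UNIV) \<subseteq> plane g"
     "\<forall>s\<in>{0..1}. \<forall>t. p (K (s, t)) = H (s, p_S1 t)" "\<forall>t. K (0, t) = \<gamma>t0 t \<and> K (1, t) = \<gamma>t t"
    using tr unfolding transported_cover_def by metis
  have "T0 (K (1, t)) = (\<lambda>z. K (fst z, snd z + 1)) (1, t)"
  proof (rule lift_eq[OF surface_covering[OF M], of "{0..1} \<times> UNIV" "\<lambda>z. T0 (K z)" _ "(0, 0)"])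
    show "continuous_on ({0..1} \<times> UNIV) (\<lambda>z. T0 (K z))"
      by (rule continuous_on_compose2[OF deck_transformation_continuous[OF T0] HK(1,2)])
    show "(\<lambda>z. T0 (K z)) ` ({0..1} \<times> UNIV) \<subseteq> plane g"
      using HK(2) deck_transformation_plane[OF T0] by blast
    show "continuous_on ({0..1} \<times> UNIV) (\<lambda>z. K (fst z, snd z + 1))"
      by (intro continuous_on_compose2[OF HK(1)] continuous_intros) auto
    show "(\<lambda>z. K (fst z, snd z + 1)) ` ({0..1} \<times> UNIV) \<subseteq> plane g" using HK(2) by auto
    show "p (T0 (K z)) = p (K (fst z, snd z + 1))" if z: "z \<in> {0..1} \<times> UNIV" for z
    proof -
      have "p (T0 (K z)) = p (K (fst z, snd z))" using HK(2) z deck_transformation_over[OF T0, of "K z"] by auto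
      also have "\<dots> = p (K (fst z, snd z + 1))" using HK(3) z p_S1_add_1[of "snd z"] by auto
      finally show ?thesis .
    qed
    show "connected ({0..1::real} \<times> (UNIV::real set))"
      by (intro connected_Times connected_UNIV) auto
    show "T0 (K (0, 0)) = K (fst (0, 0), snd (0, 0) + 1)" using HK(4) T0_0 by simp
  qed auto
  then show ?thesis using HK(4) by simp
qed

text \<open>Non-reversibility enters here. Both covers satisfy the same period relation, so
  \<open>f\<close> commutes with \<open>T0\<close>. A path \<open>h\<close> from the base point to
  its image under \<open>f\<close> projects to a loop in the centralizer of
  \<open>\<gamma>0\<close>; this loop cannot have orientation -1, and its orientation is that of
  \<open>f\<close>.\<close>

lemma transported_deck_transformation:
  assumes a: "transported_cover g p M \<gamma>0 \<gamma>t0 \<gamma> \<gamma>a" and b: "transported_cover g p M \<gamma>0 \<gamma>t0 \<gamma> \<gamma>b"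
  obtains f where "deck_transformation g p f" "orientation_preserving_map g f" "\<And>t. f (\<gamma>b t) = \<gamma>a t"
proof -
  note ca = transported_cover_of[OF a] and cb = transported_cover_of[OF b]
  have "p (\<gamma>b 0) = p (\<gamma>a 0)" by (simp add: cover_of_over[OF ca] cover_of_over[OF cb])
  then obtain f where f: "deck_transformation g p f" "f (\<gamma>b 0) = \<gamma>a 0"
    using deck_transformation_exists[OF M cover_of_plane[OF cb] cover_of_plane[OF ca]] by blast
  have fb: "f (\<gamma>b t) = \<gamma>a t" for t
  proof (rule lift_eq[OF surface_covering[OF M], of UNIV "\<lambda>t. f (\<gamma>b t)" \<gamma>a 0])
    show "continuous_on UNIV (\<lambda>t. f (\<gamma>b t))"
      using cover_of_plane[OF cb]
      by (intro continuous_on_compose2[OF deck_transformation_continuous[OF f(1)]] cover_of_continuous[OF cb]) auto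
    show "p (f (\<gamma>b t)) = p (\<gamma>a t)" for t
      using deck_transformation_over[OF f(1) cover_of_plane[OF cb]] cover_of_over[OF ca] cover_of_over[OF cb] by simp
  qed (use cover_of_plane[OF cb] cover_of_plane[OF ca] deck_transformation_plane[OF f(1)] f(2)
      cover_of_continuous[OF ca] in auto)
  define z0 where "z0 = \<gamma>t0 0"
  have z0: "z0 \<in> plane g" unfolding z0_def by (rule cover_of_plane[OF cov0])
  have fP: "f z \<in> plane g" "T0 z \<in> plane g" if "z \<in> plane g" for z
    using deck_transformation_plane f(1) T0 that by blast+
  have commute: "f (T0 z0) = T0 (f z0)"
  proof (rule lift_eq[OF surface_covering[OF M], of "plane g" "\<lambda>z. f (T0 z)" "\<lambda>z. T0 (f z)" "\<gamma>b 0"])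
    show "continuous_on (plane g) (\<lambda>z. f (T0 z))" "continuous_on (plane g) (\<lambda>z. T0 (f z))"
      using deck_transformation_continuous[OF f(1)] deck_transformation_continuous[OF T0] fP
      by (auto intro: continuous_on_compose2)
    show "p (f (T0 z)) = p (T0 (f z))" if "z \<in> plane g" for z
      using deck_transformation_over[OF f(1)] deck_transformation_over[OF T0] fP that by simp
    show "connected (plane g)" by (rule convex_connected[OF convex_plane])
    show "f (T0 (\<gamma>b 0)) = T0 (f (\<gamma>b 0))"
      using T0_transported[OF a] T0_transported[OF b] fb by simp
  qed (use fP z0 cover_of_plane[OF cb] in auto)
  define h where "h = linepath z0 (f z0)"
  define c where "c = p \<circ> h"
  have h: "path h" "path_image h \<subseteq> plane g" "pathstart h = z0" "pathfinish h = f z0"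
    using z0 fP closed_segment_subset[OF _ _ convex_plane] by (auto simp: h_def)
  have pM: "continuous_on (plane g) p" "p ` plane g \<subseteq> M"
    using surface_covering[OF M] by (auto simp: covering_space_def)
  have pc: "path (p \<circ> \<beta>)" "path_image (p \<circ> \<beta>) \<subseteq> M" if "path \<beta>" "path_image \<beta> \<subseteq> plane g" for \<beta>
    using that pM continuous_on_subset[OF pM(1) that(2)]
    by (auto intro!: path_continuous_image simp: path_image_compose)
  have fo: "p (f z0) = p z0" by (rule deck_transformation_over[OF f(1) z0])
  have loop: "loop_in M c"
    unfolding loop_in_def c_def using pc[OF h(1,2)] h fo by (simp add: pathstart_compose pathfinish_compose)
  let ?f\<gamma> = "f \<circ> \<gamma>t0" and ?Th = "T0 \<circ> h"
  have f\<gamma>: "path ?f\<gamma>" "path_image ?f\<gamma> \<subseteq> plane g"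
    using cover_of_path[OF cov0] fP continuous_on_subset[OF deck_transformation_continuous[OF f(1)]]
    by (auto intro!: path_continuous_image simp: path_image_compose)
  have Th: "path ?Th" "path_image ?Th \<subseteq> plane g"
    using h fP continuous_on_subset[OF deck_transformation_continuous[OF T0]]
    by (auto intro!: path_continuous_image simp: path_image_compose)
  note g0 = cover_of_path[OF cov0]
  \<comment> \<open>Lifts of the two products in the fundamental group. They end at
    \<open>f (T0 z0)\<close> and \<open>T0 (f z0)\<close>; as these points agree, the lifts are
    homotopic in the simply connected plane.\<close>
  have "homotopic_paths (plane g) (h +++ ?f\<gamma>) (\<gamma>t0 +++ ?Th)"
  proof (rule homotopic_paths_plane)
    show "path (h +++ ?f\<gamma>)" "path_image (h +++ ?f\<gamma>) \<subseteq> plane g"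
      using h f\<gamma> by (auto simp: pathstart_compose z0_def pathstart_def intro!: path_join_imp path_image_join_subset[THEN order_trans])
    show "path (\<gamma>t0 +++ ?Th)" "path_image (\<gamma>t0 +++ ?Th) \<subseteq> plane g"
      using g0 Th h T0_0 by (auto simp: pathstart_compose pathfinish_def z0_def intro!: path_join_imp path_image_join_subset[THEN order_trans])
    show "pathstart (h +++ ?f\<gamma>) = pathstart (\<gamma>t0 +++ ?Th)" using h by (simp add: z0_def pathstart_def joinpaths_def)
    show "pathfinish (h +++ ?f\<gamma>) = pathfinish (\<gamma>t0 +++ ?Th)"
      using h commute T0_0 by (simp add: pathfinish_def z0_def joinpaths_def)
  qed
  then have "homotopic_paths M (p \<circ> (h +++ ?f\<gamma>)) (p \<circ> (\<gamma>t0 +++ ?Th))"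
    using pM by (intro homotopic_paths_continuous_image) auto
  moreover have "p \<circ> ?f\<gamma> = \<gamma>0 \<circ> p_S1" "p \<circ> \<gamma>t0 = \<gamma>0 \<circ> p_S1"
    using deck_transformation_over[OF f(1) cover_of_plane[OF cov0]] cover_of_over[OF cov0] by (auto simp: fun_eq_iff)
  ultimately have hom1: "homotopic_paths M (c +++ (\<gamma>0 \<circ> p_S1)) ((\<gamma>0 \<circ> p_S1) +++ (p \<circ> ?Th))"
    by (simp add: path_compose_join c_def)
  have "homotopic_paths M (p \<circ> ?Th) c"
  proof (rule homotopic_paths_eq)
    show "path (p \<circ> ?Th)" "path_image (p \<circ> ?Th) \<subseteq> M" by (rule pc[OF Th])+
    show "(p \<circ> ?Th) t = c t" if "t \<in> {0..1}" for t
    proof -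
      have "h t \<in> plane g" using that h(2) unfolding path_image_def by blast
      then show ?thesis using deck_transformation_over[OF T0] by (simp add: c_def)
    qed
  qed
  moreover have "homotopic_paths M (\<gamma>0 \<circ> p_S1) (\<gamma>0 \<circ> p_S1)"
    using pc[OF g0] \<open>p \<circ> \<gamma>t0 = \<gamma>0 \<circ> p_S1\<close> by simp
  moreover have "pathfinish (\<gamma>0 \<circ> p_S1) = pathstart (p \<circ> ?Th)"
    using h cover_of_over[OF cov0, of 0] deck_transformation_over[OF T0 z0] p_S1_add_1[of 0]
    by (simp add: pathstart_compose pathfinish_compose) (simp add: pathfinish_def z0_def)
  ultimately have hom2: "homotopic_paths M ((\<gamma>0 \<circ> p_S1) +++ (p \<circ> ?Th)) ((\<gamma>0 \<circ> p_S1) +++ c)"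
    by (intro homotopic_paths_join) auto
  have "pathstart c = \<gamma>0 1"
    using h cover_of_over[OF cov0, of 0] by (simp add: c_def pathstart_compose z0_def p_S1_def)
  then have "orientation_hom g p c \<noteq> - 1"
    using nrev loop homotopic_paths_trans[OF hom1 hom2] unfolding reversible_def by blast
  then have "\<forall>h f. path h \<and> path_image h \<subseteq> plane g \<and> (\<forall>t\<in>{0..1}. p (h t) = c t) \<and>
      deck_transformation g p f \<and> f (pathstart h) = pathfinish h \<longrightarrow> orientation_preserving_map g f"
    unfolding orientation_hom_def by (simp split: if_splits)
  from this[rule_format, of h f] have "orientation_preserving_map g f" using h f(1) by (simp add: c_def)
  then show ?thesis using that f(1) fb by blast
qed

end


section \<open>Double points and the winding number\<close>

lemma crossing_sgn_scale:
  assumes "cdet (vector_derivative \<alpha> (at s)) (vector_derivative \<alpha> (at t))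
      = k * cdet (vector_derivative \<beta> (at s')) (vector_derivative \<beta> (at t'))" and "0 < k"
  shows "crossing_sgn \<alpha> s t = crossing_sgn \<beta> s' t'"
  using assms by (simp add: crossing_sgn_def Let_def zero_less_mult_iff mult_less_0_iff)

lemma cdet_mult: "cdet (w * x) (w * y) = (norm w)\<^sup>2 * cdet x y"
  unfolding cdet_def cmod_power2 by (simp add: power2_eq_square algebra_simps)

lemma cdet_linear:
  assumes "linear D" shows "cdet (D x) (D y) = cdet (D 1) (D \<i>) * cdet x y"
proof -
  have D: "D v = Re v *\<^sub>R D 1 + Im v *\<^sub>R D \<i>" for v
  proof -
    have "D v = D (Re v *\<^sub>R 1 + Im v *\<^sub>R \<i>)"
      by (rule arg_cong[where f = D]) (simp add: complex_eq_iff)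
    then show ?thesis by (simp only: linear_add[OF assms] linear_scale[OF assms])
  qed
  show ?thesis unfolding D[of x] D[of y] by (simp add: cdet_def algebra_simps)
qed

context nonreversible_homotopy
begin

definition double_point_choice :: "(real \<Rightarrow> complex) \<Rightarrow> ('m \<Rightarrow> real) \<Rightarrow> ('m \<Rightarrow> real) \<Rightarrow> bool" where
  "double_point_choice \<gamma>t t1 t2 \<longleftrightarrow>
     (\<forall>d\<in>D_pm M \<gamma>. t1 d < t2 d \<and> \<gamma>t (t1 d) = \<gamma>t (t2 d) \<and> p (\<gamma>t (t1 d)) = d)"

lemma cover_derivative:
  assumes "cover_of g p \<gamma> \<gamma>t"
  shows "(\<gamma>t has_vector_derivative vector_derivative \<gamma>t (at t)) (at t)"
    "continuous_on UNIV (\<lambda>t. vector_derivative \<gamma>t (at t))" "vector_derivative \<gamma>t (at t) \<noteq> 0"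
proof -
  have C1: "\<gamma>t C1_differentiable_on UNIV" and "vector_derivative \<gamma>t (at t) \<noteq> 0"
    using gen assms unfolding generic_regular_closed_curve_def regular_closed_curve_def by auto
  then show "vector_derivative \<gamma>t (at t) \<noteq> 0" by simp
  obtain D where D: "\<And>x. (\<gamma>t has_vector_derivative D x) (at x)" "continuous_on UNIV D"
    using C1 unfolding C1_differentiable_on_def by blast
  have "vector_derivative \<gamma>t (at x) = D x" for x by (rule vector_derivative_at[OF D(1)])
  then show "(\<gamma>t has_vector_derivative vector_derivative \<gamma>t (at t)) (at t)"
    "continuous_on UNIV (\<lambda>t. vector_derivative \<gamma>t (at t))" using D by simp_all
qed

text \<open>\<open>w\<close> is the derivative of the coordinate. It multiplies the tangent and the
  field at a point alike, and by a nonzero number, so it preserves angles with the field as well as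
  crossing signs.\<close>

lemma flow_coordinate_curve:
  assumes tr: "transported_cover g p M \<gamma>0 \<gamma>t0 \<gamma> \<gamma>t" and flow: "isometry_flow g T0 \<phi> X"
  obtains b :: "real \<Rightarrow> complex" and b' w c where "c \<noteq> 0" "\<And>t. (b has_vector_derivative b' t) (at t)" "continuous_on UNIV b'"
    "\<And>t. b (t + 1) = b t + c" "\<And>s t. b s = b t \<longleftrightarrow> \<gamma>t s = \<gamma>t t"
    "\<And>t. b' t = w (\<gamma>t t) * vector_derivative \<gamma>t (at t)" "\<And>t. w (\<gamma>t t) * X (\<gamma>t t) = c"
proof -
  note cov = transported_cover_of[OF tr]
  obtain \<Phi> c where \<Phi>: "c \<noteq> 0" "\<Phi> holomorphic_on plane g" "inj_on \<Phi> (plane g)"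
    "\<And>z. z \<in> plane g \<Longrightarrow> deriv \<Phi> z * X z = c" "\<And>z. z \<in> plane g \<Longrightarrow> \<Phi> (T0 z) = \<Phi> z + c"
    using isometry_flow_coordinate[OF M T0 T0_op T0_no_fixed_point flow] by metis
  have P: "\<gamma>t t \<in> plane g" for t by (rule cover_of_plane[OF cov])
  show ?thesis
  proof (rule that[of c "\<lambda>t. \<Phi> (\<gamma>t t)" "\<lambda>t. deriv \<Phi> (\<gamma>t t) * vector_derivative \<gamma>t (at t)" "deriv \<Phi>"])
    fix t
    have "(\<Phi> has_field_derivative deriv \<Phi> (\<gamma>t t)) (at (\<gamma>t t))"
      by (rule holomorphic_derivI[OF \<Phi>(2) open_plane P])
    from field_vector_diff_chain_at[OF cover_derivative(1)[OF cov] this]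
    show "((\<lambda>t. \<Phi> (\<gamma>t t)) has_vector_derivative deriv \<Phi> (\<gamma>t t) * vector_derivative \<gamma>t (at t)) (at t)"
      by (simp add: o_def mult.commute)
    show "\<Phi> (\<gamma>t (t + 1)) = \<Phi> (\<gamma>t t) + c" using \<Phi>(5)[OF P] T0_transported[OF tr] by simp
    show "deriv \<Phi> (\<gamma>t t) * X (\<gamma>t t) = c" by (rule \<Phi>(4)[OF P])
    show "\<Phi> (\<gamma>t s) = \<Phi> (\<gamma>t t) \<longleftrightarrow> \<gamma>t s = \<gamma>t t" for s
      using inj_on_eq_iff[OF \<Phi>(3) P P] .
  next
    have "continuous_on (plane g) (deriv \<Phi>)"
      by (intro holomorphic_on_imp_continuous_on holomorphic_deriv \<Phi> open_plane)
    then show "continuous_on UNIV (\<lambda>t. deriv \<Phi> (\<gamma>t t) * vector_derivative \<gamma>t (at t))"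
      using P by (intro continuous_intros cover_derivative(2)[OF cov]
          continuous_on_compose2[OF _ cover_of_continuous[OF cov, of UNIV]]) auto
  qed (use \<Phi> in auto)
qed

lemma flow_exists: "\<exists>\<phi> X. isometry_flow g T0 \<phi> X"
  by (rule isometry_flow_exists[OF M T0 T0_op T0_no_fixed_point])

text \<open>In the coordinate a shift by \<open>k\<close> periods adds \<open>k * c\<close> with
  \<open>c \<noteq> 0\<close>: powers of \<open>T0\<close> are told apart by their effect on a
  single point.\<close>

lemma transported_shift_eq:
  assumes tr: "transported_cover g p M \<gamma>0 \<gamma>t0 \<gamma> \<gamma>t"
    and "\<gamma>t a = \<gamma>t e" "\<gamma>t (a + of_int i) = \<gamma>t (e + of_int j)"
  shows "i = j"
proof -
  obtain \<phi> X where flow: "isometry_flow g T0 \<phi> X" using flow_exists by blast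
  obtain b :: "real \<Rightarrow> complex" and b' w c where b: "c \<noteq> 0" "\<And>t. b (t + 1) = b t + c" "\<And>s t. b s = b t \<longleftrightarrow> \<gamma>t s = \<gamma>t t"
    by (rule flow_coordinate_curve[OF tr flow]) (rule that)
  have "b (t + 1) - of_real (t + 1) * c = b t - of_real t * c" for t
    unfolding b(2) by (simp add: algebra_simps)
  from add_of_int_period[of "\<lambda>t. b t - of_real t * c", OF this]
  have shift: "b (t + of_int k) = b t + of_int k * c" for t k
    by (simp add: algebra_simps)
  have "b a = b e" "b (a + of_int i) = b (e + of_int j)" using assms by (simp_all add: b(3))
  then have "of_int i * c = of_int j * c" by (simp add: shift)
  then show ?thesis using b(1) by simp
qed

text \<open>Monodromy: a loop homotopic to a constant path has a closed lift.\<close>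

lemma D_pm_imp_double_point:
  assumes cov: "cover_of g p \<gamma> \<gamma>t" and d: "d \<in> D_pm M \<gamma>"
  obtains a b where "a < b" "b < a + 1" "\<gamma>t a = \<gamma>t b" "p (\<gamma>t a) = d"
proof -
  obtain a b where ab: "a < b" "b < a + 1" "\<gamma> (p_S1 a) = d" "\<gamma> (p_S1 b) = d"
     "homotopic_paths M (\<lambda>x. \<gamma> (p_S1 (a + (b - a) * x))) (\<lambda>_. d)"
    using d unfolding D_pm_def by blast
  have "pathfinish (\<lambda>x. \<gamma>t (a + (b - a) * x)) = pathfinish (\<lambda>_. \<gamma>t a)"
  proof (rule metric_covering_monodromy[OF surface_covering[OF M] ab(5)])
    show "path (\<lambda>x. \<gamma>t (a + (b - a) * x))" unfolding path_def
      by (intro continuous_on_compose2[OF cover_of_continuous[OF cov, of UNIV]] continuous_intros) auto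
    show "path_image (\<lambda>x. \<gamma>t (a + (b - a) * x)) \<subseteq> plane g" "path_image (\<lambda>_. \<gamma>t a) \<subseteq> plane g"
      using cover_of_plane[OF cov] by (auto simp: path_image_def)
    show "path (\<lambda>_. \<gamma>t a)" by (simp add: path_def)
  qed (use cover_of_over[OF cov] ab in \<open>auto simp: pathstart_def\<close>)
  then have "\<gamma>t b = \<gamma>t a" by (simp add: pathfinish_def)
  then show ?thesis using that[of a b] ab cover_of_over[OF cov] by simp
qed

text \<open>The arc of the cover between the two parameters is a loop in a simply connected plane,
  and its contraction projects to \<open>M\<close>.\<close>

lemma double_point_imp_D_pm:
  assumes cov: "cover_of g p \<gamma> \<gamma>t" and ab: "a < b" "b < a + 1" "\<gamma>t a = \<gamma>t b"
  shows "p (\<gamma>t a) \<in> D_pm M \<gamma>"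
proof -
  have "homotopic_paths (plane g) (\<lambda>x. \<gamma>t (a + (b - a) * x)) (\<lambda>_. \<gamma>t a)"
  proof (rule homotopic_paths_plane)
    show "path (\<lambda>x. \<gamma>t (a + (b - a) * x))" unfolding path_def
      by (intro continuous_on_compose2[OF cover_of_continuous[OF cov, of UNIV]] continuous_intros) auto
  qed (use cover_of_plane[OF cov] ab in \<open>auto simp: path_image_def path_def pathstart_def pathfinish_def\<close>)
  then have "homotopic_paths M (p \<circ> (\<lambda>x. \<gamma>t (a + (b - a) * x))) (p \<circ> (\<lambda>_. \<gamma>t a))"
    using surface_covering[OF M] by (intro homotopic_paths_continuous_image) (auto simp: covering_space_def)
  then have "homotopic_paths M (\<lambda>x. \<gamma> (p_S1 (a + (b - a) * x))) (\<lambda>_. p (\<gamma>t a))"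
    by (simp add: o_def cover_of_over[OF cov])
  moreover have "\<gamma> (p_S1 a) = p (\<gamma>t a)" "\<gamma> (p_S1 b) = p (\<gamma>t a)"
    using cover_of_over[OF cov, of a] cover_of_over[OF cov, of b] ab by auto
  ultimately show ?thesis unfolding D_pm_def using ab by blast
qed

lemma double_point_choice_exists:
  assumes "cover_of g p \<gamma> \<gamma>t" shows "\<exists>t1 t2. double_point_choice \<gamma>t t1 t2"
proof -
  have "\<forall>d\<in>D_pm M \<gamma>. \<exists>ab. fst ab < snd ab \<and> \<gamma>t (fst ab) = \<gamma>t (snd ab) \<and> p (\<gamma>t (fst ab)) = d"
    using D_pm_imp_double_point[OF assms] by (metis fst_conv snd_conv)
  then obtain ab where "\<forall>d\<in>D_pm M \<gamma>. fst (ab d) < snd (ab d) \<and> \<gamma>t (fst (ab d)) = \<gamma>t (snd (ab d)) \<and> p (\<gamma>t (fst (ab d))) = d"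
    by (rule bchoice[THEN exE])
  then show ?thesis unfolding double_point_choice_def
    by (intro exI[of _ "\<lambda>d. fst (ab d)"] exI[of _ "\<lambda>d. snd (ab d)"])
qed

text \<open>The fibre of \<open>\<gamma>\<close> over \<open>d\<close> has only two points, so a chosen double point lies over the same two
  parameters as the given one; the other order would need \<open>T0\<close> to have finite order.\<close>

lemma double_point_choice_shift:
  assumes tr: "transported_cover g p M \<gamma>0 \<gamma>t0 \<gamma> \<gamma>t" and ch: "double_point_choice \<gamma>t t1 t2"
    and ab: "a < b" "b < a + 1" "\<gamma>t a = \<gamma>t b"
  shows "\<exists>i::int. t1 (p (\<gamma>t a)) = a + of_int i \<and> t2 (p (\<gamma>t a)) = b + of_int i"
proof -
  note cov = transported_cover_of[OF tr]
  define d where "d = p (\<gamma>t a)"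
  have d: "d \<in> D_pm M \<gamma>" unfolding d_def by (rule double_point_imp_D_pm[OF cov ab])
  have t: "t1 d < t2 d" "\<gamma>t (t1 d) = \<gamma>t (t2 d)" "p (\<gamma>t (t1 d)) = d"
    using ch d unfolding double_point_choice_def by auto
  let ?F = "{u \<in> sphere 0 1. \<gamma> u = d}"
  have F: "finite ?F" "card ?F \<le> 2" using gen unfolding generic_regular_closed_curve_def by auto
  have ne: "p_S1 a \<noteq> p_S1 b"
  proof
    assume "p_S1 a = p_S1 b"
    then obtain k :: int where k: "b = a + of_int k" using p_S1_eq[of b a] by auto
    then have "0 < k" "k < 1" using ab by auto
    then show False by simp
  qed
  have inF: "p_S1 a \<in> ?F" "p_S1 b \<in> ?F" "p_S1 (t1 d) \<in> ?F" "p_S1 (t2 d) \<in> ?F"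
    using p_S1_sphere cover_of_over[OF cov] t ab(3) by (auto simp: d_def) metis+
  \<comment> \<open>Genericity bounds the fibre by two points, and two distinct ones are known; the
    chosen parameters have to be integer shifts of \<open>a\<close> or \<open>b\<close>.\<close>
  have "?F = {p_S1 a, p_S1 b}"
    using F inF ne by (intro card_seteq[symmetric]) auto
  then have c1: "p_S1 (t1 d) = p_S1 a \<or> p_S1 (t1 d) = p_S1 b" and c2: "p_S1 (t2 d) = p_S1 a \<or> p_S1 (t2 d) = p_S1 b"
    using inF by blast+
  from c1 consider (a1) i :: int where "t1 d = a + of_int i" | (b1) i :: int where "t1 d = b + of_int i"
    by (auto simp: p_S1_eq)
  then show ?thesis
  proof cases
    case (a1 i)
    from c2 consider (a2) j :: int where "t2 d = a + of_int j" | (b2) j :: int where "t2 d = b + of_int j"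
      by (auto simp: p_S1_eq)
    then show ?thesis
    proof cases
      case (a2 j)
      then have "i = j" using transported_shift_eq[OF tr refl, of a i j] t(2) a1 by simp
      then show ?thesis using t(1) a1 a2 by simp
    next
      case (b2 j)
      then have "i = j" using transported_shift_eq[OF tr ab(3), of i j] t(2) a1 by simp
      then show ?thesis using a1 b2 by (auto simp: d_def)
    qed
  next
    case (b1 i)
    from c2 consider (a2) j :: int where "t2 d = a + of_int j" | (b2) j :: int where "t2 d = b + of_int j"
      by (auto simp: p_S1_eq)
    then show ?thesis
    proof cases
      case (a2 j)
      then have "i = j" using transported_shift_eq[OF tr ab(3)[symmetric], of i j] t(2) b1 by simp
      then show ?thesis using t(1) b1 a2 ab by simp
    next
      case (b2 j)
      then have "i = j" using transported_shift_eq[OF tr refl, of b i j] t(2) b1 by simp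
      then show ?thesis using t(1) b1 b2 by simp
    qed
  qed
qed

text \<open>Whitney's formula sums over parameter pairs in one period, which correspond bijectively
  to \<open>D_pm M \<gamma>\<close>. The pair chosen over a point is an integer shift of the pair in
  \<open>Z\<close>, and \<open>b'\<close> is periodic. At a double point both tangents are
  multiplied by the same \<open>w\<close>, so the determinant changes by a positive factor
  only.\<close>

lemma winding_eq_crossing_sum:
  assumes tr: "transported_cover g p M \<gamma>0 \<gamma>t0 \<gamma> \<gamma>t" and ch: "double_point_choice \<gamma>t t1 t2"
    and flow: "isometry_flow g T0 \<phi> X" and \<theta>: "continuous_on UNIV \<theta>"
    "\<And>t. \<exists>r>0. vector_derivative \<gamma>t (at t) = of_real r * cis (\<theta> t) * X (\<gamma>t t)"
  shows "(\<theta> 1 - \<theta> 0) / (2 * pi) = of_int (\<Sum>d\<in>D_pm M \<gamma>. crossing_sgn \<gamma>t (t1 d) (t2 d))"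
proof -
  note cov = transported_cover_of[OF tr]
  obtain b :: "real \<Rightarrow> complex" and b' w c where c: "c \<noteq> 0" and der: "\<And>t. (b has_vector_derivative b' t) (at t)"
    and cont: "continuous_on UNIV b'" and per: "\<And>t. b (t + 1) = b t + c"
    and inj: "\<And>s t. b s = b t \<longleftrightarrow> \<gamma>t s = \<gamma>t t"
    and b': "\<And>t. b' t = w (\<gamma>t t) * vector_derivative \<gamma>t (at t)" and wX: "\<And>t. w (\<gamma>t t) * X (\<gamma>t t) = c"
    by (rule flow_coordinate_curve[OF tr flow]) (rule that)
  define Z where "Z = {(s, t). 0 \<le> s \<and> s < 1 \<and> s < t \<and> t < s + 1 \<and> b s = b t}"
  have vd: "vector_derivative b (at t) = b' t" for t by (rule vector_derivative_at[OF der])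
  have wnz: "w (\<gamma>t t) \<noteq> 0" for t using wX[of t] c by auto
  have cdet_b: "cdet (b' s) (b' t) = (norm (w (\<gamma>t s)))\<^sup>2 *
      cdet (vector_derivative \<gamma>t (at s)) (vector_derivative \<gamma>t (at t))" if "\<gamma>t s = \<gamma>t t" for s t
    unfolding b' that cdet_mult ..
  have tr': "cdet (b' s) (b' t) \<noteq> 0" if st: "s < t" "t < s + 1" "b s = b t" for s t
  proof -
    have "p_S1 s \<noteq> p_S1 t"
    proof
      assume "p_S1 s = p_S1 t"
      then obtain k :: int where k: "t = s + of_int k" using p_S1_eq[of t s] by auto
      then have "0 < k" "k < 1" using st by auto
      then show False by simp
    qed
    moreover have eq: "\<gamma>t s = \<gamma>t t" using st inj by simp
    ultimately have "cdet (vector_derivative \<gamma>t (at s)) (vector_derivative \<gamma>t (at t)) \<noteq> 0"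
      using gen cov unfolding generic_regular_closed_curve_def by blast
    then show ?thesis using cdet_b[OF eq] wnz by simp
  qed
  have b'\<theta>: "\<exists>r>0. b' t = of_real r * cis (\<theta> t) * c" for t
  proof -
    obtain r where r: "r > 0" "vector_derivative \<gamma>t (at t) = of_real r * cis (\<theta> t) * X (\<gamma>t t)"
      using \<theta>(2) by blast
    have "b' t = of_real r * cis (\<theta> t) * (w (\<gamma>t t) * X (\<gamma>t t))" unfolding b' r(2) by simp
    then show ?thesis using r(1) wX by auto
  qed
  note whitney = whitney_formula_periodic[OF der cont per c tr' \<theta>(1) b'\<theta>, folded Z_def]
  have shift: "crossing_sgn b (s + of_int i) (t + of_int i) = crossing_sgn b s t" for s t and i :: int
  proof -
    have "b' (t + 1) = b' t" for t
    proof -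
      have "((\<lambda>x::real. x + 1) has_vector_derivative 1) (at t)"
        using has_vector_derivative_add[OF has_vector_derivative_id has_vector_derivative_const]
        by (auto simp: id_def)
      from vector_diff_chain_at[OF this der] have "((\<lambda>x. b (x + 1)) has_vector_derivative b' (t + 1)) (at t)"
        by (simp add: o_def)
      moreover have "((\<lambda>x. b (x + 1)) has_vector_derivative b' t) (at t)"
        unfolding per using has_vector_derivative_add[OF der has_vector_derivative_const] by simp
      ultimately show ?thesis by (rule vector_derivative_unique_at)
    qed
    from add_of_int_period[of b', OF this] show ?thesis by (simp add: crossing_sgn_def vd)
  qed
  have Z: "(s, t) \<in> Z \<longleftrightarrow> 0 \<le> s \<and> s < 1 \<and> s < t \<and> t < s + 1 \<and> \<gamma>t s = \<gamma>t t" for s t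
    by (simp add: Z_def inj)
  have "bij_betw (\<lambda>(s, t). p (\<gamma>t s)) Z (D_pm M \<gamma>)"
    unfolding bij_betw_def
  proof
    show "inj_on (\<lambda>(s, t). p (\<gamma>t s)) Z"
    proof (rule inj_onI, clarify)
      fix s t s' t' assume st: "(s, t) \<in> Z" "(s', t') \<in> Z" "p (\<gamma>t s) = p (\<gamma>t s')"
      obtain i where i: "t1 (p (\<gamma>t s)) = s + of_int i" "t2 (p (\<gamma>t s)) = t + of_int i"
        using double_point_choice_shift[OF tr ch, of s t] st(1) Z by blast
      obtain j where j: "t1 (p (\<gamma>t s')) = s' + of_int j" "t2 (p (\<gamma>t s')) = t' + of_int j"
        using double_point_choice_shift[OF tr ch, of s' t'] st(2) Z by blast
      have e: "s + of_int i = s' + of_int j" "t + of_int i = t' + of_int j" using i j st(3) by auto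
      have "0 \<le> s" "s < 1" "0 \<le> s'" "s' < 1" using st Z by auto
      then have "i = j" using e(1) by linarith
      then show "s = s' \<and> t = t'" using e by simp
    qed
    show "(\<lambda>(s, t). p (\<gamma>t s)) ` Z = D_pm M \<gamma>"
    proof (intro equalityI subsetI)
      fix d assume "d \<in> (\<lambda>(s, t). p (\<gamma>t s)) ` Z"
      then show "d \<in> D_pm M \<gamma>" using double_point_imp_D_pm[OF cov] Z by auto
    next
      fix d assume "d \<in> D_pm M \<gamma>"
      then obtain a e where ae: "a < e" "e < a + 1" "\<gamma>t a = \<gamma>t e" "p (\<gamma>t a) = d"
        by (rule D_pm_imp_double_point[OF cov])
      \<comment> \<open>Shifts both parameters so that the first lies in the period starting at 0;
        the double point persists since in the coordinate both values change by the same multiple of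
        \<open>c\<close>.\<close>
      define n where "n = - \<lfloor>a\<rfloor>"
      have per\<gamma>: "\<gamma> (p_S1 (x + of_int n)) = \<gamma> (p_S1 x)" for x
        using add_of_int_period[of p_S1 x n, OF p_S1_add_1] by simp
      have "b (t + 1) - of_real (t + 1) * c = b t - of_real t * c" for t
        unfolding per by (simp add: algebra_simps)
      from add_of_int_period[of "\<lambda>t. b t - of_real t * c", OF this]
      have "b (x + of_int n) = b x + of_int n * c" for x by (simp add: algebra_simps)
      then have "\<gamma>t (a + of_int n) = \<gamma>t (e + of_int n)" using inj ae(3) by metis
      moreover have "0 \<le> a + of_int n" "a + of_int n < 1" unfolding n_def by (simp_all, linarith+)
      ultimately have "(a + of_int n, e + of_int n) \<in> Z" using ae Z by simp
      moreover have "p (\<gamma>t (a + of_int n)) = d" using ae(4) per\<gamma> by (simp add: cover_of_over[OF cov])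
      ultimately show "d \<in> (\<lambda>(s, t). p (\<gamma>t s)) ` Z" by (metis (mono_tags, lifting) case_prod_conv image_eqI)
    qed
  qed
  from sum.reindex_bij_betw[OF this, of "\<lambda>d. crossing_sgn \<gamma>t (t1 d) (t2 d)", symmetric]
  have "(\<Sum>d\<in>D_pm M \<gamma>. crossing_sgn \<gamma>t (t1 d) (t2 d)) =
      (\<Sum>(s, t)\<in>Z. crossing_sgn \<gamma>t (t1 (p (\<gamma>t s))) (t2 (p (\<gamma>t s))))"
    by (simp add: case_prod_unfold)
  also have "\<dots> = (\<Sum>(s, t)\<in>Z. crossing_sgn b s t)"
  proof (rule sum.cong[OF refl], clarify)
    fix s t assume st: "(s, t) \<in> Z"
    obtain i where i: "t1 (p (\<gamma>t s)) = s + of_int i" "t2 (p (\<gamma>t s)) = t + of_int i"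
      using double_point_choice_shift[OF tr ch, of s t] st Z by blast
    have "p (\<gamma>t s) \<in> D_pm M \<gamma>" using double_point_imp_D_pm[OF cov] st Z by blast
    then have "\<gamma>t (s + of_int i) = \<gamma>t (t + of_int i)" using ch i unfolding double_point_choice_def by metis
    from cdet_b[OF this] have "crossing_sgn b (s + of_int i) (t + of_int i) = crossing_sgn \<gamma>t (s + of_int i) (t + of_int i)"
      using wnz by (intro crossing_sgn_scale) (auto simp: vd)
    then show "crossing_sgn \<gamma>t (t1 (p (\<gamma>t s))) (t2 (p (\<gamma>t s))) = crossing_sgn b s t"
      unfolding i shift by simp
  qed
  finally show ?thesis by (simp only: whitney(2)) simp
qed

text \<open>\<open>b' / c\<close> has no zeros on the line, hence a continuous logarithm; its
  imaginary part is the angle because tangent and field carry the same factor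
  \<open>w\<close>.\<close>

lemma angle_exists:
  assumes tr: "transported_cover g p M \<gamma>0 \<gamma>t0 \<gamma> \<gamma>t" and flow: "isometry_flow g T0 \<phi> X"
  shows "\<exists>\<theta>. continuous_on UNIV \<theta> \<and>
    (\<forall>t. \<exists>r>0. vector_derivative \<gamma>t (at t) = of_real r * cis (\<theta> t) * X (\<gamma>t t))"
proof -
  note cov = transported_cover_of[OF tr]
  obtain b :: "real \<Rightarrow> complex" and b' w c where c: "c \<noteq> 0" and cont: "continuous_on UNIV b'"
    and b': "\<And>t. b' t = w (\<gamma>t t) * vector_derivative \<gamma>t (at t)" and wX: "\<And>t. w (\<gamma>t t) * X (\<gamma>t t) = c"
    by (rule flow_coordinate_curve[OF tr flow]) (rule that)
  have wnz: "w (\<gamma>t t) \<noteq> 0" for t using wX[of t] c by auto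
  have "continuous_on UNIV (\<lambda>t. b' t / c)" using c by (intro continuous_intros cont) auto
  moreover have "b' t / c \<noteq> 0" for t using b' wnz c cover_derivative(3)[OF cov] by simp
  ultimately obtain G where G: "continuous_on UNIV G" "\<And>t. t \<in> UNIV \<Longrightarrow> b' t / c = exp (G t)"
    by (rule continuous_logarithm_on_contractible[OF _ convex_imp_contractible[OF convex_UNIV]]) (rule that)
  have "vector_derivative \<gamma>t (at t) = of_real (exp (Re (G t))) * cis (Im (G t)) * X (\<gamma>t t)" for t
  proof -
    have "w (\<gamma>t t) * vector_derivative \<gamma>t (at t) = exp (G t) * (w (\<gamma>t t) * X (\<gamma>t t))"
      unfolding wX G(2)[OF UNIV_I, symmetric] b'[symmetric] using c by simp
    then have "vector_derivative \<gamma>t (at t) = exp (G t) * X (\<gamma>t t)"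
      using wnz[of t] by simp
    then show ?thesis using exp_eq_polar[of "G t"] by simp
  qed
  moreover have "continuous_on UNIV (\<lambda>t. Im (G t))" by (intro continuous_intros G)
  ultimately show ?thesis by (intro exI[of _ "\<lambda>t. Im (G t)"] conjI allI) (auto intro!: exI[of _ "exp _"])
qed

text \<open>The deck transformation relating the covers is injective, so the same parameters are
  double points of both, and its differential multiplies every determinant by a positive
  number.\<close>

lemma crossing_sum_independent:
  assumes a: "transported_cover g p M \<gamma>0 \<gamma>t0 \<gamma> \<gamma>a" and b: "transported_cover g p M \<gamma>0 \<gamma>t0 \<gamma> \<gamma>b"
    and ch: "double_point_choice \<gamma>a t1 t2"
  shows "double_point_choice \<gamma>b t1 t2"
    "(\<Sum>d\<in>D_pm M \<gamma>. crossing_sgn \<gamma>a (t1 d) (t2 d)) = (\<Sum>d\<in>D_pm M \<gamma>. crossing_sgn \<gamma>b (t1 d) (t2 d))"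
proof -
  obtain f where f: "deck_transformation g p f" "orientation_preserving_map g f" "\<And>t. f (\<gamma>b t) = \<gamma>a t"
    using transported_deck_transformation[OF a b] by blast
  note cb = transported_cover_of[OF b]
  have P: "\<gamma>b t \<in> plane g" for t by (rule cover_of_plane[OF cb])
  show chb: "double_point_choice \<gamma>b t1 t2"
    unfolding double_point_choice_def
  proof
    fix d assume "d \<in> D_pm M \<gamma>"
    then have "t1 d < t2 d" "\<gamma>a (t1 d) = \<gamma>a (t2 d)" "p (\<gamma>a (t1 d)) = d"
      using ch unfolding double_point_choice_def by auto
    then show "t1 d < t2 d \<and> \<gamma>b (t1 d) = \<gamma>b (t2 d) \<and> p (\<gamma>b (t1 d)) = d"
      using inj_onD[OF deck_transformation_inj[OF f(1)] _ P P] f(3) deck_transformation_over[OF f(1) P] by metis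
  qed
  show "(\<Sum>d\<in>D_pm M \<gamma>. crossing_sgn \<gamma>a (t1 d) (t2 d)) = (\<Sum>d\<in>D_pm M \<gamma>. crossing_sgn \<gamma>b (t1 d) (t2 d))"
  proof (rule sum.cong[OF refl])
    fix d assume "d \<in> D_pm M \<gamma>"
    then have eq: "\<gamma>b (t1 d) = \<gamma>b (t2 d)" using chb unfolding double_point_choice_def by auto
    obtain D where D: "(f has_derivative D) (at (\<gamma>b (t1 d)))" "0 < cdet (D 1) (D \<i>)"
      using f(2) P unfolding orientation_preserving_map_def by blast
    have lin: "linear D" using D(1) has_derivative_linear by blast
    have "vector_derivative \<gamma>a (at t) = D (vector_derivative \<gamma>b (at t))" if "\<gamma>b t = \<gamma>b (t1 d)" for t
    proof (rule vector_derivative_at)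
      have "((\<lambda>t. f (\<gamma>b t)) has_derivative (\<lambda>x. D (x *\<^sub>R vector_derivative \<gamma>b (at t)))) (at t)"
        using has_derivative_compose[OF cover_derivative(1)[OF cb, unfolded has_vector_derivative_def], of f D] D(1) that
        by simp
      then show "(\<gamma>a has_vector_derivative D (vector_derivative \<gamma>b (at t))) (at t)"
        by (simp add: has_vector_derivative_def f(3) linear_scale[OF lin])
    qed
    note V = this[OF refl] this[OF eq[symmetric]]
    have "cdet (vector_derivative \<gamma>a (at (t1 d))) (vector_derivative \<gamma>a (at (t2 d)))
        = cdet (D 1) (D \<i>) * cdet (vector_derivative \<gamma>b (at (t1 d))) (vector_derivative \<gamma>b (at (t2 d)))"
      unfolding V by (rule cdet_linear[OF lin])
    then show "crossing_sgn \<gamma>a (t1 d) (t2 d) = crossing_sgn \<gamma>b (t1 d) (t2 d)"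
      using D(2) by (rule crossing_sgn_scale)
  qed
qed

lemma winding_number_eq:
  assumes hom: "freely_homotopic M \<gamma>0 \<gamma>"
  shows "W_number g p M \<gamma>0 \<gamma>t0 \<gamma> = of_int (I_number g p M \<gamma>0 \<gamma>t0 \<gamma>)"
proof -
  obtain \<gamma>t where tr: "transported_cover g p M \<gamma>0 \<gamma>t0 \<gamma> \<gamma>t"
    using transported_cover_exists[OF M cov0 hom] by blast
  obtain t1 t2 where ch: "double_point_choice \<gamma>t t1 t2"
    using double_point_choice_exists[OF transported_cover_of[OF tr]] by blast
  obtain \<phi> X where flow: "isometry_flow g T0 \<phi> X" using flow_exists by blast
  obtain \<theta> where \<theta>: "continuous_on UNIV \<theta>"
    "\<And>t. \<exists>r>0. vector_derivative \<gamma>t (at t) = of_real r * cis (\<theta> t) * X (\<gamma>t t)"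
    using angle_exists[OF tr flow] by blast
  define N where "N = (\<Sum>d\<in>D_pm M \<gamma>. crossing_sgn \<gamma>t (t1 d) (t2 d))"
  have W: "(\<theta>' 1 - \<theta>' 0) / (2 * pi) = of_int N"
    if tr': "transported_cover g p M \<gamma>0 \<gamma>t0 \<gamma> \<gamma>t'" and flow': "isometry_flow g T0 \<phi>' X'" and \<theta>': "continuous_on UNIV \<theta>'"
      "\<And>t. \<exists>r>0. vector_derivative \<gamma>t' (at t) = of_real r * cis (\<theta>' t) * X' (\<gamma>t' t)" for \<gamma>t' \<phi>' X' \<theta>'
    using winding_eq_crossing_sum[OF tr' crossing_sum_independent(1)[OF tr tr' ch] flow' \<theta>']
      crossing_sum_independent(2)[OF tr tr' ch] by (simp add: N_def)
  \<comment> \<open>An arbitrary choice for an arbitrary cover is first moved to the fixed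
    \<open>\<gamma>t\<close>. There its sum equals the winding number of the fixed angle \<theta>,
    which does not involve the choice.\<close>
  have I: "(\<Sum>d\<in>D_pm M \<gamma>. crossing_sgn \<gamma>t' (t1' d) (t2' d)) = N"
    if tr': "transported_cover g p M \<gamma>0 \<gamma>t0 \<gamma> \<gamma>t'" and ch': "double_point_choice \<gamma>t' t1' t2'" for \<gamma>t' t1' t2'
  proof -
    have "of_int (\<Sum>d\<in>D_pm M \<gamma>. crossing_sgn \<gamma>t (t1' d) (t2' d)) = (of_int N :: real)"
      using winding_eq_crossing_sum[OF tr crossing_sum_independent(1)[OF tr' tr ch'] flow \<theta>] W[OF tr flow \<theta>] by simp
    then show ?thesis using crossing_sum_independent(2)[OF tr' tr ch'] by linarith
  qed
  have "I_number g p M \<gamma>0 \<gamma>t0 \<gamma> = N"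
    unfolding I_number_def
  proof (rule the_equality)
    show "\<exists>\<gamma>t t1 t2. transported_cover g p M \<gamma>0 \<gamma>t0 \<gamma> \<gamma>t \<and>
        (\<forall>d\<in>D_pm M \<gamma>. t1 d < t2 d \<and> \<gamma>t (t1 d) = \<gamma>t (t2 d) \<and> p (\<gamma>t (t1 d)) = d) \<and>
        N = (\<Sum>d\<in>D_pm M \<gamma>. crossing_sgn \<gamma>t (t1 d) (t2 d))"
      using tr ch N_def unfolding double_point_choice_def by blast
  next
    fix n assume "\<exists>\<gamma>t t1 t2. transported_cover g p M \<gamma>0 \<gamma>t0 \<gamma> \<gamma>t \<and>
        (\<forall>d\<in>D_pm M \<gamma>. t1 d < t2 d \<and> \<gamma>t (t1 d) = \<gamma>t (t2 d) \<and> p (\<gamma>t (t1 d)) = d) \<and>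
        n = (\<Sum>d\<in>D_pm M \<gamma>. crossing_sgn \<gamma>t (t1 d) (t2 d))"
    then show "n = N" using I unfolding double_point_choice_def by blast
  qed
  moreover have "W_number g p M \<gamma>0 \<gamma>t0 \<gamma> = of_int N"
    unfolding W_number_def
  proof (rule the_equality)
    show "\<exists>\<gamma>t T \<phi> X \<theta>. transported_cover g p M \<gamma>0 \<gamma>t0 \<gamma> \<gamma>t \<and>
        deck_transformation g p T \<and> (\<forall>t. T (\<gamma>t t) = \<gamma>t (t + 1)) \<and> isometry_flow g T \<phi> X \<and> continuous_on UNIV \<theta> \<and>
        (\<forall>t. \<exists>r>0. vector_derivative \<gamma>t (at t) = of_real r * cis (\<theta> t) * X (\<gamma>t t)) \<and>
        of_int N = (\<theta> 1 - \<theta> 0) / (2 * pi)"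
      using tr T0 T0_transported[OF tr] flow \<theta> W[OF tr flow \<theta>, symmetric]
      by (intro exI[of _ \<gamma>t] exI[of _ T0] exI[of _ \<phi>] exI[of _ X] exI[of _ \<theta>] conjI allI)
  next
    fix x assume "\<exists>\<gamma>t T \<phi> X \<theta>. transported_cover g p M \<gamma>0 \<gamma>t0 \<gamma> \<gamma>t \<and>
        deck_transformation g p T \<and> (\<forall>t. T (\<gamma>t t) = \<gamma>t (t + 1)) \<and> isometry_flow g T \<phi> X \<and> continuous_on UNIV \<theta> \<and>
        (\<forall>t. \<exists>r>0. vector_derivative \<gamma>t (at t) = of_real r * cis (\<theta> t) * X (\<gamma>t t)) \<and>
        x = (\<theta> 1 - \<theta> 0) / (2 * pi)"
    then obtain \<gamma>t' T' \<phi>' X' \<theta>' where t': "transported_cover g p M \<gamma>0 \<gamma>t0 \<gamma> \<gamma>t'"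
        "deck_transformation g p T'" "\<forall>t. T' (\<gamma>t' t) = \<gamma>t' (t + 1)" and fl: "isometry_flow g T' \<phi>' X'"
        and \<theta>': "continuous_on UNIV \<theta>'"
        "\<forall>t. \<exists>r>0. vector_derivative \<gamma>t' (at t) = of_real r * cis (\<theta>' t) * X' (\<gamma>t' t)"
        and x: "x = (\<theta>' 1 - \<theta>' 0) / (2 * pi)"
      by (elim exE conjE) (rule that)
    \<comment> \<open>The description quantifies over \<open>T\<close>, but a deck transformation is
      determined by its value at \<open>\<gamma>t' 0\<close>. Hence every admissible flow is a flow
      through \<open>T0\<close>.\<close>
    have "T' z = T0 z" if "z \<in> plane g" for z
      by (rule deck_transformation_eq[OF M t'(2) T0 cover_of_plane[OF transported_cover_of[OF t'(1)]] _ that, of 0])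
        (use t'(3) T0_transported[OF t'(1)] in simp)
    then have "isometry_flow g T0 \<phi>' X'" using fl unfolding isometry_flow_def by auto
    then show "x = of_int N" unfolding x using W[OF t'(1) _ \<theta>'(1)] \<theta>'(2) by blast
  qed
  ultimately show ?thesis by simp
qed

end

theorem theorem9:
  fixes g :: geometry
    and p :: "complex \<Rightarrow> 'm::metric_space"
    and M :: "'m set"
    and \<gamma>0 \<gamma> :: "complex \<Rightarrow> 'm"
    and \<gamma>t0 :: "real \<Rightarrow> complex"
  assumes "complete_geometric_surface g p M"
    and "non_orientable g p M"
    and "closed_curve M \<gamma>0"
    and "orientation_preserving_curve g p \<gamma>0"
    and "\<not> null_homotopic M \<gamma>0"
    and "\<not> reversible g p M \<gamma>0"
    and "cover_of g p \<gamma>0 \<gamma>t0"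
    and "generic_regular_closed_curve g p M \<gamma>"
    and "freely_homotopic M \<gamma>0 \<gamma>"
  shows "W_number g p M \<gamma>0 \<gamma>t0 \<gamma> = of_int (I_number g p M \<gamma>0 \<gamma>t0 \<gamma>)"
proof -
  \<comment> \<open>The two ends of a period of the initial cover lie over the same point; this
    provides \<open>T0\<close>.\<close>
  have "p (\<gamma>t0 0) = p (\<gamma>t0 1)"
    using cover_of_over[OF assms(7)] p_S1_add_1[of 0] by simp
  then obtain T0 where "deck_transformation g p T0" "T0 (\<gamma>t0 0) = \<gamma>t0 1"
    using deck_transformation_exists[OF assms(1) cover_of_plane[OF assms(7)] cover_of_plane[OF assms(7)]] by blast
  then interpret nonreversible_homotopy g p M \<gamma>0 \<gamma> \<gamma>t0 T0
    using assms by unfold_locales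
  show ?thesis by (rule winding_number_eq[OF assms(9)])
qed

end
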